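(* For a graph class $\mathcal{G}$, the following statements are equivalent: (1) $\mathcal{G}$ has bounded treewidth; (2) $L(\mathcal{G})$ has bounded clique-width; (3) $L(\mathcal{G})$ has bounded mim-width; (4) $L(\mathcal{G})$ has bounded sim-width; (5) $L(\mathcal{G})$ has bounded tree-independence number. Moreover, when restricted to the class of line graphs, sim-width, mim-width, clique-width and tree-independence number are pairwise equivalent; twin-width dominates each of these four parameters; and each of these four parameters dominates treewidth.
   Context: All graphs are finite and simple. The line graph $L(G)$ of $G$ has vertex set $E(G)$, two vertices adjacent iff the corresponding edges share an endpoint; $L(\mathcal{G})=\{L(G):G\in\mathcal{G}\}$. A parameter is bounded on a class if some constant bounds it on every member. A branch decomposition of a graph $G$ is a pair $(T,\delta)$ where $T$ is a tree with maximum degree at most $3$ and $\delta$ is a bijection from $V(G)$ to the leaves of $T$; each edge $e$ of $T$ induces a bipartition $(A_e,\overline{A_e})$ of $V(G)$ according to the two components of $T-e$. For $X\subseteq V(G)$, $\mathrm{cutmim}_G(X)$ is the maximum size of an induced matching of the bipartite graph formed by the edges of $G$ between $X$ and $\overline{X}$; $\mathrm{cutsim}_G(X)$ is the maximum size of a matching of $G$, each edge having one end in $X$ and one in $\overline X$, which is an induced matching of $G$. Mim-width (resp. sim-width) of $G$ is the minimum over branch decompositions of $\max_{e}\mathrm{cutmim}_G(A_e)$ (resp. $\mathrm{cutsim}_G(A_e)$), and $0$ if $|V(G)|\le1$. The tree-independence number of $G$ is the minimum, over all tree decompositions $(T,\{X_t\})$ of $G$, of $\max_t\alpha(G[X_t])$.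 Treewidth, clique-width and twin-width are the standard width parameters. For width parameters $p,q$ and a class $\mathcal{C}$: $p$ dominates $q$ on $\mathcal{C}$ if there is a function $f$ with $p(G)\le f(q(G))$ for all $G\in\mathcal{C}$; they are equivalent on $\mathcal{C}$ if each dominates the other. *)

theory Defs
  imports "Graph_Theory.Graph_Theory"
begin

text \<open>
  A finite simple graph is a symmetric, loop-free, finite digraph without parallel arcs, i.e. a
  value of type \<^typ>\<open>'a pair_pre_digraph\<close> satisfying \<^const>\<open>pair_graph\<close>.  Each undirected edge
  is thus represented by its two orientations in \<^const>\<open>parcs\<close>; \<open>uedges\<close> below is the
  set of undirected edges.  All parameters take values in \<^typ>\<open>nat\<close>, where the infimum of a
  nonempty set is its minimum and the infimum of the empty set is \<open>0\<close>.
\<close>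

definition uedges :: "'a pair_pre_digraph \<Rightarrow> 'a set set" where
  "uedges G = {{u, v} |u v. (u, v) \<in> parcs G}"

definition line_graph :: "'a pair_pre_digraph \<Rightarrow> 'a set pair_pre_digraph" where
  "line_graph G =
     \<lparr>pverts = uedges G,
      parcs = {(e, f). e \<in> uedges G \<and> f \<in> uedges G \<and> e \<noteq> f \<and> e \<inter> f \<noteq> {}}\<rparr>"

lemma pair_graph_line_graph:
  assumes "pair_graph G"
  shows "pair_graph (line_graph G)"
proof -
  interpret pair_graph G by fact
  have "uedges G = (\<lambda>e. {fst e, snd e}) ` parcs G"
    unfolding uedges_def by force
  then have fin: "finite (uedges G)"
    by (simp add: pair_finite_arcs)
  have "finite (parcs (line_graph G))"
    by (rule finite_subset[of _ "uedges G \<times> uedges G"]) (auto simp: line_graph_def fin)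
  with fin show ?thesis
    by unfold_locales
      (auto simp: line_graph_def symmetric_def intro!: symI)
qed


subsection \<open>Trees\<close>

text \<open>
  The library's predicate \<^const>\<open>tree\<close> forbids directed cycles and hence counts \<open>u, v, u\<close> as a
  cycle of a symmetric digraph; undirected cycles are therefore introduced separately.
\<close>

definition ucycle :: "'a pair_pre_digraph \<Rightarrow> 'a list \<Rightarrow> bool" where
  "ucycle G c \<longleftrightarrow> vpath c (with_proj G) \<and> 3 \<le> length c \<and> (last c, hd c) \<in> parcs G"

definition utree :: "'a pair_pre_digraph \<Rightarrow> bool" where
  "utree T \<longleftrightarrow> pair_graph T \<and> connected (with_proj T) \<and> (\<nexists>c. ucycle T c)"

text \<open>In a symmetric digraph the out-degree is the degree of the undirected graph.\<close>

definition leaves :: "'a pair_pre_digraph \<Rightarrow> 'a set" where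
  "leaves T = {t \<in> pverts T. out_degree (with_proj T) t = 1}"


subsection \<open>Mim-width and sim-width\<close>

definition matching :: "'a pair_pre_digraph \<Rightarrow> 'a set set \<Rightarrow> bool" where
  "matching G M \<longleftrightarrow> M \<subseteq> uedges G \<and> (\<forall>e\<in>M. \<forall>f\<in>M. e \<noteq> f \<longrightarrow> e \<inter> f = {})"

definition induced_matching :: "'a pair_pre_digraph \<Rightarrow> 'a set set \<Rightarrow> bool" where
  "induced_matching G M \<longleftrightarrow>
     matching G M \<and> (\<forall>(u, v) \<in> parcs G. u \<in> \<Union>M \<and> v \<in> \<Union>M \<longrightarrow> {u, v} \<in> M)"

definition cut_graph :: "'a pair_pre_digraph \<Rightarrow> 'a set \<Rightarrow> 'a pair_pre_digraph" where
  "cut_graph G X = \<lparr>pverts = pverts G, parcs = {(u, v) \<in> parcs G. (u \<in> X) \<noteq> (v \<in> X)}\<rparr>"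

definition cutmim :: "'a pair_pre_digraph \<Rightarrow> 'a set \<Rightarrow> nat" where
  "cutmim G X = Max {card M |M. induced_matching (cut_graph G X) M}"

definition cutsim :: "'a pair_pre_digraph \<Rightarrow> 'a set \<Rightarrow> nat" where
  "cutsim G X = Max {card M |M. induced_matching G M \<and> M \<subseteq> uedges (cut_graph G X)}"

text \<open>
  Decomposition trees have natural numbers as nodes; every finite tree is isomorphic to such a tree.
\<close>

definition branch_decomposition ::
    "'a pair_pre_digraph \<Rightarrow> nat pair_pre_digraph \<Rightarrow> ('a \<Rightarrow> nat) \<Rightarrow> bool" where
  "branch_decomposition G T \<delta> \<longleftrightarrow>
     utree T \<and> (\<forall>t \<in> pverts T. out_degree (with_proj T) t \<le> 3) \<and>
     bij_betw \<delta> (pverts G) (leaves T)"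

text \<open>The vertices of \<open>G\<close> mapped to the component of \<open>T - st\<close> that contains \<open>s\<close>.\<close>

definition edge_side ::
    "'a pair_pre_digraph \<Rightarrow> nat pair_pre_digraph \<Rightarrow> ('a \<Rightarrow> nat) \<Rightarrow> nat \<times> nat \<Rightarrow> 'a set" where
  "edge_side G T \<delta> = (\<lambda>(s, t). {v \<in> pverts G. (s, \<delta> v) \<in> (parcs T - {(s, t), (t, s)})\<^sup>*})"

text \<open>
  The maximum runs over both orientations of every edge of \<open>T\<close>, i.e. over both sides of every
  cut; \<^const>\<open>cutmim\<close> and \<^const>\<open>cutsim\<close> agree on the two sides.
\<close>

definition branch_decomposition_width ::
    "('a pair_pre_digraph \<Rightarrow> 'a set \<Rightarrow> nat) \<Rightarrow>
     'a pair_pre_digraph \<Rightarrow> nat pair_pre_digraph \<Rightarrow> ('a \<Rightarrow> nat) \<Rightarrow> nat" where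
  "branch_decomposition_width \<phi> G T \<delta> = Max ((\<lambda>e. \<phi> G (edge_side G T \<delta> e)) ` parcs T)"

definition cut_width ::
    "('a pair_pre_digraph \<Rightarrow> 'a set \<Rightarrow> nat) \<Rightarrow> 'a pair_pre_digraph \<Rightarrow> nat" where
  "cut_width \<phi> G =
     (if card (pverts G) \<le> 1 then 0
      else Inf {branch_decomposition_width \<phi> G T \<delta> |T \<delta>. branch_decomposition G T \<delta>})"

definition mim_width :: "'a pair_pre_digraph \<Rightarrow> nat" where
  "mim_width = cut_width cutmim"

definition sim_width :: "'a pair_pre_digraph \<Rightarrow> nat" where
  "sim_width = cut_width cutsim"


subsection \<open>Treewidth and tree-independence number\<close>

text \<open>Note that \<^const>\<open>connected\<close> implies nonemptiness.\<close>

definition tree_decomposition ::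
    "'a pair_pre_digraph \<Rightarrow> nat pair_pre_digraph \<Rightarrow> (nat \<Rightarrow> 'a set) \<Rightarrow> bool" where
  "tree_decomposition G T X \<longleftrightarrow>
     utree T \<and>
     (\<Union>t \<in> pverts T. X t) = pverts G \<and>
     (\<forall>(u, v) \<in> parcs G. \<exists>t \<in> pverts T. u \<in> X t \<and> v \<in> X t) \<and>
     (\<forall>v \<in> pverts G. connected (with_proj T \<restriction> {t \<in> pverts T. v \<in> X t}))"

text \<open>By truncated subtraction the graph without vertices has treewidth \<open>0\<close> (rather than \<open>-1\<close>).\<close>

definition treewidth :: "'a pair_pre_digraph \<Rightarrow> nat" where
  "treewidth G =
     Inf {Max ((\<lambda>t. card (X t)) ` pverts T) - 1 |T X. tree_decomposition G T X}"

definition independent_set :: "('a, 'b) pre_digraph \<Rightarrow> 'a set \<Rightarrow> bool" where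
  "independent_set G S \<longleftrightarrow> S \<subseteq> verts G \<and> (\<forall>u\<in>S. \<forall>v\<in>S. (u, v) \<notin> arcs_ends G)"

definition independence_number :: "('a, 'b) pre_digraph \<Rightarrow> nat" where
  "independence_number G = Max {card S |S. independent_set G S}"

definition tree_independence_number :: "'a pair_pre_digraph \<Rightarrow> nat" where
  "tree_independence_number G =
     Inf {Max ((\<lambda>t. independence_number (with_proj G \<restriction> X t)) ` pverts T) |T X.
            tree_decomposition G T X}"


subsection \<open>Clique-width\<close>

text \<open>
  \<open>cw_constructible k G l\<close>: the graph \<open>G\<close> with vertex labelling \<open>l\<close> can be built with the labels
  \<open>0, \<dots>, k - 1\<close> by creating a labelled vertex, disjoint union, joining two distinct label
  classes completely, and relabelling.  Values of \<open>l\<close> outside \<open>pverts G\<close> are irrelevant.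
\<close>

inductive cw_constructible :: "nat \<Rightarrow> 'a pair_pre_digraph \<Rightarrow> ('a \<Rightarrow> nat) \<Rightarrow> bool" for k where
  create: "i < k \<Longrightarrow> cw_constructible k \<lparr>pverts = {v}, parcs = {}\<rparr> (\<lambda>_. i)"
| disjoint_union:
    "cw_constructible k G l \<Longrightarrow> cw_constructible k H m \<Longrightarrow> pverts G \<inter> pverts H = {} \<Longrightarrow>
     cw_constructible k \<lparr>pverts = pverts G \<union> pverts H, parcs = parcs G \<union> parcs H\<rparr>
       (\<lambda>v. if v \<in> pverts G then l v else m v)"
| join:
    "cw_constructible k G l \<Longrightarrow> i < k \<Longrightarrow> j < k \<Longrightarrow> i \<noteq> j \<Longrightarrow>
     cw_constructible k
       \<lparr>pverts = pverts G,
        parcs = parcs G \<union> {(u, v). u \<in> pverts G \<and> v \<in> pverts G \<and>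
                               (l u = i \<and> l v = j \<or> l u = j \<and> l v = i)}\<rparr> l"
| relabel:
    "cw_constructible k G l \<Longrightarrow> i < k \<Longrightarrow> j < k \<Longrightarrow>
     cw_constructible k G (\<lambda>v. if l v = i then j else l v)"

text \<open>The graph without vertices is not constructible; its clique-width is \<open>0\<close>.\<close>

definition clique_width :: "'a pair_pre_digraph \<Rightarrow> nat" where
  "clique_width G = Inf {k. \<exists>l. cw_constructible k G l}"


subsection \<open>Twin-width\<close>

record 'a trigraph =
  tverts :: "'a set"
  black :: "'a rel"
  red :: "'a rel"

text \<open>
  The vertex resulting from the contraction of \<open>u\<close> and \<open>v\<close> keeps the name \<open>u\<close>.  Its edge to
  another vertex \<open>x\<close> is black if \<open>ux\<close> and \<open>vx\<close> are both black, absent if neither \<open>ux\<close> nor \<open>vx\<close>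
  is an edge, and red otherwise.
\<close>

definition contract :: "'a trigraph \<Rightarrow> 'a \<Rightarrow> 'a \<Rightarrow> 'a trigraph" where
  "contract H u v =
     (let R = tverts H - {u, v};
          B = {x \<in> R. (u, x) \<in> black H \<and> (v, x) \<in> black H};
          E = {x \<in> R. (u, x) \<in> black H \<union> red H \<or> (v, x) \<in> black H \<union> red H}
      in \<lparr>tverts = tverts H - {v},
          black = (black H \<inter> R \<times> R) \<union> {u} \<times> B \<union> B \<times> {u},
          red = (red H \<inter> R \<times> R) \<union> {u} \<times> (E - B) \<union> (E - B) \<times> {u}\<rparr>)"

definition red_degree_le :: "nat \<Rightarrow> 'a trigraph \<Rightarrow> bool" where
  "red_degree_le d H \<longleftrightarrow> (\<forall>x \<in> tverts H. card {y. (x, y) \<in> red H} \<le> d)"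

text \<open>
  \<open>contractible d H\<close>: some sequence of contractions leads from \<open>H\<close> to a trigraph with at most one
  vertex, all trigraphs in the sequence having maximum red degree at most \<open>d\<close>.
\<close>

inductive contractible :: "nat \<Rightarrow> 'a trigraph \<Rightarrow> bool" for d where
  finish: "card (tverts H) \<le> 1 \<Longrightarrow> red_degree_le d H \<Longrightarrow> contractible d H"
| step: "u \<in> tverts H \<Longrightarrow> v \<in> tverts H \<Longrightarrow> u \<noteq> v \<Longrightarrow> red_degree_le d H \<Longrightarrow>
         contractible d (contract H u v) \<Longrightarrow> contractible d H"

definition twin_width :: "'a pair_pre_digraph \<Rightarrow> nat" where
  "twin_width G = Inf {d. contractible d \<lparr>tverts = pverts G, black = parcs G, red = {}\<rparr>}"


subsection \<open>Comparing parameters on graph classes\<close>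

definition bounded_on ::
    "('a pair_pre_digraph \<Rightarrow> nat) \<Rightarrow> 'a pair_pre_digraph set \<Rightarrow> bool" where
  "bounded_on p C \<longleftrightarrow> (\<exists>c. \<forall>G\<in>C. p G \<le> c)"

definition dominates_on ::
    "('a pair_pre_digraph \<Rightarrow> nat) \<Rightarrow> ('a pair_pre_digraph \<Rightarrow> nat) \<Rightarrow>
     'a pair_pre_digraph set \<Rightarrow> bool" where
  "dominates_on p q C \<longleftrightarrow> (\<exists>f :: nat \<Rightarrow> nat. \<forall>G\<in>C. p G \<le> f (q G))"

definition equivalent_on ::
    "('a pair_pre_digraph \<Rightarrow> nat) \<Rightarrow> ('a pair_pre_digraph \<Rightarrow> nat) \<Rightarrow>
     'a pair_pre_digraph set \<Rightarrow> bool" where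
  "equivalent_on p q C \<longleftrightarrow> dominates_on p q C \<and> dominates_on q p C"

definition line_graphs :: "'a set pair_pre_digraph set" where
  "line_graphs = line_graph ` {G. pair_graph G}"

end

theory Submission
  imports Defs
begin

text \<open>
  If \<open>G\<close> has large treewidth, some set of vertices has no small balanced separator, which yields a
  haven \<open>\<beta>\<close> of \<open>G\<close>.  A cut of \<open>E(G)\<close> with small \<^const>\<open>cutsim\<close> in \<open>L(G)\<close> has a small set \<open>S\<close> of vertices
  of \<open>G\<close> such that every vertex of \<open>G - S\<close> sees edges of one side only; hence all edges in \<open>\<beta> S\<close> lie on
  one side, and the edges of a branch decomposition of small sim-width are oriented consistently
  towards the haven, which is impossible in a tree.  The same argument applies to a tree
  decomposition of \<open>L(G)\<close> whose bags have small independence number, as the edges of \<open>G\<close> in such a bag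
  are covered by few vertices.

  Conversely, merging the edges assigned to the bags of a tree decomposition of \<open>G\<close> leaf by leaf
  gives a recursive bipartition of \<open>E(G)\<close> in which each part meets the remaining edges in a single
  bag, so that it has boundedly many neighbourhoods in the rest of \<open>L(G)\<close>.  Such a bipartition is a
  clique-width expression without labels; it is at the same time a branch decomposition of small
  mim-width, and contracting twins from the bottom up is a contraction sequence of small red degree.
\<close>

subsection \<open>Connected vertex sets\<close>

text \<open>Every parameter of \<open>line_graph G\<close> is compared with
  \<open>treewidth G\<close>. Apart from that only the chain sim-width \<le> mim-width \<le>
  clique-width is used, so bounding its two ends by functions of treewidth settles all pairs in it.
  Havens come from balanced separators rather than from grid minors, which keeps the bounds on
  treewidth linear: \<open>27 * k + 7\<close> is \<open>3 * (9 * k + 2) + 1\<close>, where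
  \<open>9 * k\<close> stands for three tree arcs at a node with separators of size
  \<open>3 * k\<close>, and \<open>2\<close> for the ends of the edge of \<open>G\<close> placed at
  a leaf. A line graph sees only edges of \<open>G\<close>, so a haven has to offer an edge and not
  merely a vertex. In the other direction the bound is exponential, because an edge is seen from
  outside a part through its trace on a bag, one of \<open>2 ^ Suc (treewidth G)\<close> sets. An
  infimum over an empty family says nothing, so branch decompositions and clique-width expressions
  must be shown to exist before optimal ones can be used; the module trees supply both.\<close>

definition linked :: "'a rel \<Rightarrow> 'a set \<Rightarrow> bool" where
  "linked A S \<longleftrightarrow> S \<noteq> {} \<and> (\<forall>x\<in>S. \<forall>y\<in>S. (x, y) \<in> (A \<inter> S \<times> S)\<^sup>*)"

lemma rtrancl_map_closed:
  assumes "(x, y) \<in> R\<^sup>*" and "\<And>u v. (u, v) \<in> R \<Longrightarrow> (f u, f v) \<in> S\<^sup>*"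
  shows "(f x, f y) \<in> S\<^sup>*"
  using assms(1) by induction (auto intro: rtrancl_trans assms(2))

lemma rtrancl_symD:
  assumes "sym R" "(x, y) \<in> R\<^sup>*" shows "(y, x) \<in> R\<^sup>*"
  using sym_rtrancl[OF assms(1)] assms(2) by (rule symD)

lemma rtrancl_on_iff:
  "(x, y) \<in> rtrancl_on S R \<longleftrightarrow> x \<in> S \<and> y \<in> S \<and> (x, y) \<in> (R \<inter> S \<times> S)\<^sup>*"
proof
  assume "(x, y) \<in> rtrancl_on S R"
  then show "x \<in> S \<and> y \<in> S \<and> (x, y) \<in> (R \<inter> S \<times> S)\<^sup>*"
    by induction (auto intro: converse_rtrancl_into_rtrancl)
next
  assume *: "x \<in> S \<and> y \<in> S \<and> (x, y) \<in> (R \<inter> S \<times> S)\<^sup>*"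
  then have "(x, y) \<in> (R \<inter> S \<times> S)\<^sup>*" by blast
  then show "(x, y) \<in> rtrancl_on S R"
    by induction (use * in \<open>auto intro: rtrancl_on_into_rtrancl_on\<close>)
qed

lemma connected_iff_linked:
  assumes "sym (arcs_ends G)" "arcs_ends G \<subseteq> verts G \<times> verts G"
  shows "connected G \<longleftrightarrow> linked (arcs_ends G) (verts G)"
proof -
  have "pverts (mk_symmetric G) = verts G" "parcs (mk_symmetric G) = arcs_ends G"
    using assms by (auto simp: mk_symmetric_def arcs_ends_def arc_to_ends_def sym_def)
  then show ?thesis
    by (auto simp: connected_def strongly_connected_def reachable_def rtrancl_on_iff linked_def)
qed

lemma arcs_ends_induced: "arcs_ends (with_proj T \<restriction> S) = parcs T \<inter> S \<times> S"
  by (force simp: arcs_ends_def arc_to_ends_def)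

lemma connected_induced_iff:
  assumes "sym (parcs T)"
  shows "connected (with_proj T \<restriction> S) \<longleftrightarrow> linked (parcs T) S"
proof -
  have "sym (parcs T \<inter> S \<times> S)"
    using assms by (auto simp: sym_def)
  then have "connected (with_proj T \<restriction> S) \<longleftrightarrow> linked (parcs T \<inter> S \<times> S) S"
    by (subst connected_iff_linked) (auto simp: arcs_ends_induced)
  also have "\<dots> \<longleftrightarrow> linked (parcs T) S"
    by (simp add: linked_def Int_assoc)
  finally show ?thesis .
qed

lemma connected_with_proj_iff:
  assumes "sym (parcs T)" "parcs T \<subseteq> pverts T \<times> pverts T"
  shows "connected (with_proj T) \<longleftrightarrow> linked (parcs T) (pverts T)"
  using assms by (subst connected_iff_linked) auto

lemma linked_exit:
  assumes "linked A S" "x \<in> S" "x \<in> X" "y \<in> S" "y \<notin> X"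
  obtains u v where "u \<in> S \<inter> X" "v \<in> S - X" "(u, v) \<in> A"
proof -
  have "(x, y) \<in> (A \<inter> S \<times> S)\<^sup>*" using assms by (auto simp: linked_def)
  then have "y \<notin> X \<Longrightarrow> \<exists>u v. u \<in> S \<inter> X \<and> v \<in> S - X \<and> (u, v) \<in> A"
    by induction (use assms in blast)+
  then show ?thesis using that assms by blast
qed

lemma linked_mono: "linked A S \<Longrightarrow> A \<subseteq> B \<Longrightarrow> linked B S"
  unfolding linked_def by (meson Int_mono order_refl rtrancl_mono subsetD)

lemma linked_step:
  assumes "linked A S" "x \<in> S" "y \<in> S"
    and step: "\<And>u v. u \<in> S \<Longrightarrow> v \<in> S \<Longrightarrow> (u, v) \<in> A \<Longrightarrow> P u \<Longrightarrow> P v" and "P x"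
  shows "P y"
  using linked_exit[OF assms(1), of x "Collect P" y] assms by blast

lemma rtrancl_Int_mono:
  assumes "(x, y) \<in> (A \<inter> S \<times> S)\<^sup>*" "S \<subseteq> T" shows "(x, y) \<in> (A \<inter> T \<times> T)\<^sup>*"
  using rtrancl_mono[of "A \<inter> S \<times> S" "A \<inter> T \<times> T"] assms by blast

lemma linked_Un:
  assumes "linked A S" "linked A T" "S \<inter> T \<noteq> {}"
  shows "linked A (S \<union> T)"
proof -
  let ?R = "(A \<inter> (S \<union> T) \<times> (S \<union> T))\<^sup>*"
  obtain z where z: "z \<in> S" "z \<in> T" using assms by blast
  have "(x, z) \<in> ?R \<and> (z, x) \<in> ?R" if "x \<in> S \<union> T" for x
    using that
  proof
    assume "x \<in> S"
    then show ?thesis using assms(1) z unfolding linked_def by (blast intro: rtrancl_Int_mono)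
  next
    assume "x \<in> T"
    then show ?thesis using assms(2) z unfolding linked_def by (blast intro: rtrancl_Int_mono)
  qed
  then show ?thesis
    using z by (auto simp: linked_def intro: rtrancl_trans)
qed

lemma linked_singleton: "linked A {x}"
  by (simp add: linked_def)

lemma linked_insert:
  assumes "linked A S" "s \<in> S" "(s, t) \<in> A" "(t, s) \<in> A"
  shows "linked A (insert t S)"
proof -
  have "linked A {s, t}"
    using assms by (auto simp: linked_def)
  then have "linked A (S \<union> {s, t})"
    using linked_Un[OF assms(1)] assms(2) by blast
  then show ?thesis using assms(2) by (simp add: insert_absorb)
qed

subsection \<open>Trees grown leaf by leaf\<close>

text \<open>Finite trees in a form that supports induction on a leaf; \<open>utree_iff_ltree\<close>
  identifies it with the cycle-free notion, so that cycles never occur in later arguments.\<close>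

inductive ltree :: "'a set \<Rightarrow> 'a rel \<Rightarrow> bool" where
  single: "ltree {r} {}"
| leaf: "ltree V A \<Longrightarrow> s \<in> V \<Longrightarrow> t \<notin> V \<Longrightarrow> ltree (insert t V) (A \<union> {(s, t), (t, s)})"

lemma ltree_wf:
  assumes "ltree V A"
  shows "finite V" "A \<subseteq> V \<times> V" "sym A" "irrefl A" "V \<noteq> {}"
proof -
  have "finite V \<and> A \<subseteq> V \<times> V \<and> sym A \<and> irrefl A \<and> V \<noteq> {}"
    using assms by induction (auto simp: sym_def irrefl_def)
  then show "finite V" "A \<subseteq> V \<times> V" "sym A" "irrefl A" "V \<noteq> {}" by blast+
qed

lemma ltree_finite_arcs: "ltree V A \<Longrightarrow> finite A"
  using ltree_wf[of V A] by (meson finite_SigmaI finite_subset)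

lemma ltree_linked: "ltree V A \<Longrightarrow> linked A V"
proof (induction rule: ltree.induct)
  case (leaf V A s t)
  then have "linked (A \<union> {(s, t), (t, s)}) V" by (blast intro: linked_mono)
  then show ?case using leaf by (auto intro: linked_insert)
qed (simp add: linked_singleton)

text \<open>Mapping the new leaf to its neighbour retracts walks of the larger tree to the smaller one.\<close>

lemma ltree_bridge:
  assumes "ltree V A" "(s, t) \<in> A"
  shows "(s, t) \<notin> (A - {(s, t), (t, s)})\<^sup>*"
  using assms
proof (induction arbitrary: s t rule: ltree.induct)
  case (leaf V A a b)
  note wf = ltree_wf[OF leaf.hyps(1)]
  let ?A = "A \<union> {(a, b), (b, a)}"
  show ?case
  proof (cases "(s, t) \<in> A")
    case True
    define \<rho> where "\<rho> x = (if x = b then a else x)" for x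
    have st: "s \<in> V" "t \<in> V" "s \<noteq> b" "t \<noteq> b" using True wf leaf.hyps by auto
    show ?thesis
    proof
      assume "(s, t) \<in> (?A - {(s, t), (t, s)})\<^sup>*"
      then have "(\<rho> s, \<rho> t) \<in> (A - {(s, t), (t, s)})\<^sup>*"
        by (rule rtrancl_map_closed) (use wf leaf.hyps in \<open>auto simp: \<rho>_def\<close>)
      then show False using leaf.IH[OF True] st by (simp add: \<rho>_def)
    qed
  next
    case False
    then have "{(s, t), (t, s)} = {(a, b), (b, a)}" using leaf.prems by auto
    moreover from this have "s = a \<and> t = b \<or> s = b \<and> t = a" by auto
    moreover have "?A - {(a, b), (b, a)} = A" using wf leaf.hyps by auto
    moreover have "(a, b) \<notin> A\<^sup>*" "(b, a) \<notin> A\<^sup>*"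
      using wf leaf.hyps by (auto elim: rtranclE converse_rtranclE)
    ultimately show ?thesis by auto
  qed
qed simp

lemma ltree_sides_disjoint:
  assumes "ltree V A" "(s, t) \<in> A"
    and "(s, x) \<in> (A - {(s, t), (t, s)})\<^sup>*" "(t, x) \<in> (A - {(s, t), (t, s)})\<^sup>*"
  shows False
proof -
  have "sym (A - {(s, t), (t, s)})" using ltree_wf(3)[OF assms(1)] by (auto simp: sym_def)
  then have "(x, t) \<in> (A - {(s, t), (t, s)})\<^sup>*" using assms(4) by (rule rtrancl_symD)
  then show False using ltree_bridge[OF assms(1,2)] assms(3) by (meson rtrancl_trans)
qed

text \<open>Otherwise the edges between \<open>t\<close> and \<open>f t\<close> would be distinct,
  one per vertex, but a tree has one edge fewer than vertices. In the induction the new leaf can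
  only choose \<open>s\<close>; unless \<open>s\<close> chooses it back, \<open>f\<close> already
  moves along arcs of the smaller tree.\<close>

lemma ltree_two_cycle:
  assumes "ltree V A" "\<And>t. t \<in> V \<Longrightarrow> (t, f t) \<in> A"
  shows "\<exists>t\<in>V. f (f t) = t"
  using assms
proof (induction rule: ltree.induct)
  case (leaf V A s t)
  note wf = ltree_wf[OF leaf.hyps(1)]
  have ft: "f t = s" using leaf.prems[of t] leaf.hyps wf by auto
  show ?case
  proof (cases "f s = t")
    case False
    then have "(x, f x) \<in> A" if "x \<in> V" for x
      using leaf.prems[of x] that leaf.hyps wf by auto
    then show ?thesis using leaf.IH by blast
  qed (use ft in auto)
qed blast

text \<open>The neighbour is the one entered after the last visit to \<open>t\<close>: along a walk
  from \<open>t\<close> to \<open>x\<close> the induction starts afresh whenever \<open>t\<close> is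
  met again.\<close>

lemma ltree_step_towards:
  assumes "ltree V A" "t \<in> V" "x \<in> V" "x \<noteq> t"
  obtains s where "(t, s) \<in> A" "(s, x) \<in> (A - {(s, t), (t, s)})\<^sup>*"
proof -
  have "(t, x) \<in> (A \<inter> V \<times> V)\<^sup>*"
    using ltree_linked[OF assms(1)] assms by (auto simp: linked_def)
  then have "(t, x) \<in> A\<^sup>*" by (metis inf_le1 rtrancl_mono subsetD)
  then have "x = t \<or> (\<exists>s. (t, s) \<in> A \<and> (s, x) \<in> (A - {(s, t), (t, s)})\<^sup>*)"
  proof (induction rule: rtrancl_induct)
    case (step y z)
    show ?case
    proof (cases "y = t \<or> z = t")
      case False
      then obtain s where s: "(t, s) \<in> A" "(s, y) \<in> (A - {(s, t), (t, s)})\<^sup>*" using step by blast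
      then have "(s, z) \<in> (A - {(s, t), (t, s)})\<^sup>*"
        using step(2) False by (auto intro: rtrancl_into_rtrancl)
      then show ?thesis using s by blast
    qed (use step in auto)
  qed simp
  then show ?thesis using that assms(4) by blast
qed

lemma ltree_join:
  assumes "ltree V\<^sub>2 A\<^sub>2" "ltree V\<^sub>1 A\<^sub>1" "V\<^sub>1 \<inter> V\<^sub>2 = {}" "r\<^sub>1 \<in> V\<^sub>1" "r\<^sub>2 \<in> V\<^sub>2"
  shows "ltree (V\<^sub>1 \<union> V\<^sub>2) (A\<^sub>1 \<union> A\<^sub>2 \<union> {(r\<^sub>1, r\<^sub>2), (r\<^sub>2, r\<^sub>1)})"
  using assms
proof (induction arbitrary: V\<^sub>1 A\<^sub>1 r\<^sub>1 r\<^sub>2 rule: ltree.induct)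
  case (single r)
  then show ?case using ltree.leaf[of V\<^sub>1 A\<^sub>1 r\<^sub>1 r\<^sub>2] by simp
next
  case (leaf V A s t)
  show ?case
  proof (cases "r\<^sub>2 = t")
    case True
    \<comment> \<open>Here \<open>r\<^sub>2\<close> is the newest leaf: hand it over to the first
      tree as a leaf at \<open>r\<^sub>1\<close>, then join along its former arc to
      \<open>s\<close>. For this the first tree and both roots are generalised in the
      induction.\<close>
    have "ltree (insert t V\<^sub>1) (A\<^sub>1 \<union> {(r\<^sub>1, t), (t, r\<^sub>1)})"
      using leaf.prems by (intro ltree.leaf) auto
    from leaf.IH[OF this, of t s]
    show ?thesis using leaf.prems leaf.hyps True by (simp add: Un_ac insert_commute)
  next
    case False
    have "ltree (V\<^sub>1 \<union> V) (A\<^sub>1 \<union> A \<union> {(r\<^sub>1, r\<^sub>2), (r\<^sub>2, r\<^sub>1)})"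
      using leaf False by (intro leaf.IH) auto
    then have "ltree (insert t (V\<^sub>1 \<union> V)) (A\<^sub>1 \<union> A \<union> {(r\<^sub>1, r\<^sub>2), (r\<^sub>2, r\<^sub>1)} \<union> {(s, t), (t, s)})"
      using leaf by (intro ltree.leaf) auto
    then show ?thesis by (simp add: Un_ac insert_commute)
  qed
qed

section \<open>Equivalence with the cycle-free definition of trees\<close>

lemma vwalk_arcs_nth: "Suc i < length p \<Longrightarrow> (p ! i, p ! Suc i) \<in> set (vwalk_arcs p)"
proof (induction p arbitrary: i rule: vwalk_arcs.induct)
  case (3 x y xs)
  then show ?case by (cases i) auto
qed auto

text \<open>Predecessor and successor of the newest leaf on a cycle are both its only neighbour
  \<open>s\<close>, yet length at least 3 puts them at different positions of a distinct
  list.\<close>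

lemma ltree_acyclic:
  assumes "ltree V A" "distinct c" "3 \<le> length c"
    and "\<And>i. i < length c \<Longrightarrow> (c ! i, c ! (Suc i mod length c)) \<in> A"
  shows False
  using assms
proof (induction rule: ltree.induct)
  case (leaf V A s t)
  note wf = ltree_wf[OF leaf.hyps(1)]
  let ?n = "length c"
  show ?case
  proof (cases "t \<in> set c")
    case True
    then obtain i where i: "i < ?n" "c ! i = t" by (auto simp: in_set_conv_nth)
    define j where "j = Suc i mod ?n"
    define k where "k = (if i = 0 then ?n - 1 else i - 1)"
    have "j < ?n" unfolding j_def using leaf.prems(2) by (intro mod_less_divisor) linarith
    moreover have "k < ?n" using leaf.prems(2) i by (auto simp: k_def)
    ultimately have jk: "j < ?n" "k < ?n" by blast+
    have "Suc k mod ?n = i" using leaf.prems(2) i by (auto simp: k_def)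
    then have "(c ! k, t) \<in> A \<union> {(s, t), (t, s)}" using leaf.prems(3)[OF jk(2)] i by simp
    moreover have "(t, c ! j) \<in> A \<union> {(s, t), (t, s)}"
      using leaf.prems(3)[OF i(1)] i by (simp add: j_def)
    ultimately have "c ! k = c ! j" using wf leaf.hyps by auto
    then have "k = j" using leaf.prems(1) jk by (simp add: nth_eq_iff_index_eq)
    moreover have "k \<noteq> j"
      using leaf.prems(2) i by (cases "Suc i = ?n") (auto simp: j_def k_def)
    ultimately show ?thesis by blast
  next
    case False
    have "(c ! i, c ! (Suc i mod ?n)) \<in> A" if "i < ?n" for i
    proof -
      have "Suc i mod ?n < ?n" using leaf.prems(2) by (intro mod_less_divisor) linarith
      then have "c ! i \<noteq> t" "c ! (Suc i mod ?n) \<noteq> t"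
        using False that nth_mem by metis+
      then show ?thesis using leaf.prems(3)[OF that] by auto
    qed
    then show ?thesis using leaf.IH leaf.prems by blast
  qed
next
  case (single r)
  then show ?case using single.prems(2) single.prems(3)[of 0] by (cases c) auto
qed

lemma ltree_imp_utree:
  assumes "ltree (pverts T) (parcs T)"
  shows "utree T"
proof -
  note wf = ltree_wf[OF assms]
  have "pair_graph T"
    by unfold_locales
      (use wf ltree_finite_arcs[OF assms] in \<open>auto simp: irrefl_def symmetric_def\<close>)
  moreover have "connected (with_proj T)"
    using wf ltree_linked[OF assms] by (simp add: connected_with_proj_iff)
  moreover have "\<not> ucycle T c" for c
  proof
    assume c: "ucycle T c"
    then have *: "distinct c" "3 \<le> length c" "set (vwalk_arcs c) \<subseteq> parcs T" "(last c, hd c) \<in> parcs T"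
      by (auto simp: ucycle_def vpath_def vwalk_def)
    have "(c ! i, c ! (Suc i mod length c)) \<in> parcs T" if "i < length c" for i
    proof (cases "Suc i = length c")
      case True
      then have "c ! i = last c" "c ! 0 = hd c"
        using *(2) by (metis diff_Suc_1 last_conv_nth length_0_conv not_numeral_le_zero, metis hd_conv_nth length_0_conv not_numeral_le_zero *(2))
      then show ?thesis using True *(4) by simp
    next
      case False
      then show ?thesis using vwalk_arcs_nth[of i c] that *(3) by auto
    qed
    then show False using ltree_acyclic[OF assms *(1,2)] by blast
  qed
  ultimately show ?thesis by (simp add: utree_def)
qed

lemma rtrancl_imp_vpath:
  assumes "(x, y) \<in> (parcs G \<inter> S \<times> S)\<^sup>*" "x \<in> S" "y \<in> S" "S \<subseteq> pverts G"
  shows "\<exists>p. vpath p (with_proj G) \<and> set p \<subseteq> S \<and> hd p = x \<and> last p = y"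
proof -
  from assms(1) have "\<exists>p. vwalk p (with_proj G) \<and> set p \<subseteq> S \<and> hd p = x \<and> last p = y"
  proof (induction rule: converse_rtrancl_induct)
    case base
    then show ?case using assms by (intro exI[of _ "[y]"]) (auto simp: vwalk_def)
  next
    case (step x z)
    then obtain p where p: "vwalk p (with_proj G)" "set p \<subseteq> S" "hd p = z" "last p = y" by blast
    then obtain p' where "p = z # p'" by (cases p) (auto simp: vwalk_def)
    then show ?case using p step assms by (intro exI[of _ "x # p"]) (auto simp: vwalk_def)
  qed
  then obtain p where p: "vwalk p (with_proj G)" "set p \<subseteq> S" "hd p = x" "last p = y" by blast
  then show ?thesis
    by (intro exI[of _ "vwalk_to_vpath p"])
      (auto simp: vwalk_to_vpath_hd vwalk_to_vpath_last vwalk_to_vpath_vpath dest: vwalk_to_vpath_subset)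
qed

text \<open>Grow a subtree vertex by vertex along arcs leaving it. The new vertex \<open>t\<close>
  has a unique neighbour in the grown set \<open>S\<close>: a second one, together with a path
  inside \<open>S\<close> between the two, would close a cycle through \<open>t\<close>. So each new
  vertex is a leaf.\<close>

lemma utree_imp_ltree:
  assumes "utree T"
  shows "ltree (pverts T) (parcs T)"
proof -
  interpret pair_graph T using assms by (simp add: utree_def)
  let ?V = "pverts T" and ?A = "parcs T"
  have sym: "sym ?A" using pair_sym_arcs by (simp add: symmetric_def)
  have wf: "?A \<subseteq> ?V \<times> ?V" by (auto dest: in_arcsD1 in_arcsD2)
  have lnk: "linked ?A ?V"
    using assms connected_with_proj_iff[OF sym wf] by (simp add: utree_def)
  have "\<exists>S \<subseteq> ?V. card S = Suc n \<and> ltree S (?A \<inter> S \<times> S)" if "Suc n \<le> card ?V" for n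
    using that
  proof (induction n)
    case 0
    from lnk obtain r where "r \<in> ?V" by (auto simp: linked_def)
    moreover have "?A \<inter> {r} \<times> {r} = {}" using no_loops' by auto
    ultimately show ?case using ltree.single[of r] by (intro exI[of _ "{r}"]) auto
  next
    case (Suc n)
    then obtain S where S: "S \<subseteq> ?V" "card S = Suc n" "ltree S (?A \<inter> S \<times> S)" by auto
    have "S \<noteq> ?V" using S Suc.prems by auto
    then obtain x y where "x \<in> S" "y \<in> ?V" "y \<notin> S" using S by fastforce
    then obtain s t where "s \<in> ?V \<inter> S" "t \<in> ?V - S" "(s, t) \<in> ?A"
      using linked_exit[OF lnk, of x S y] S(1) by (metis subsetD)
    then have st: "s \<in> S" "t \<in> ?V" "t \<notin> S" "(s, t) \<in> ?A" by auto
    have uniq: "s' = s" if s': "s' \<in> S" "(s', t) \<in> ?A" for s'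
    proof (rule ccontr)
      assume "s' \<noteq> s"
      have "(s, s') \<in> (?A \<inter> S \<times> S \<inter> S \<times> S)\<^sup>*"
        using ltree_linked[OF S(3)] st s' by (simp add: linked_def)
      then have "(s, s') \<in> (?A \<inter> S \<times> S)\<^sup>*" by (simp add: Int_assoc)
      then obtain p where p: "vpath p (with_proj T)" "set p \<subseteq> S" "hd p = s" "last p = s'"
        using rtrancl_imp_vpath[of s s' T S] st s' S by blast
      then obtain q where q: "p = s # q" by (cases p) (auto simp: vpath_def vwalk_def)
      then have "q \<noteq> []" using p \<open>s' \<noteq> s\<close> by auto
      then have "3 \<le> length (t # p)" using q by (cases q) auto
      moreover have "vpath (t # p) (with_proj T)"
        using p q st sym by (auto simp: vpath_def vwalk_def dest: symD)
      ultimately have "ucycle T (t # p)"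
        using p q s' by (auto simp: ucycle_def)
      then show False using assms by (auto simp: utree_def)
    qed
    have uniq': "s' = s" if "s' \<in> S" "(t, s') \<in> ?A" for s'
      using uniq that symD[OF sym] by blast
    have "(t, t) \<notin> ?A" using no_loops' by blast
    then have "?A \<inter> insert t S \<times> insert t S = ?A \<inter> S \<times> S \<union> {(s, t), (t, s)}"
      using st(1,4) symD[OF sym st(4)] by (auto dest: uniq uniq')
    moreover have "finite S" using S(3) ltree_wf(1) by blast
    ultimately show ?case using ltree.leaf[OF S(3) st(1,3)] S st
      by (intro exI[of _ "insert t S"]) auto
  qed
  moreover have "card ?V \<noteq> 0" using lnk pair_finite_verts by (auto simp: linked_def)
  ultimately obtain S where "S \<subseteq> ?V" "card S = card ?V" "ltree S (?A \<inter> S \<times> S)"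
    by (metis Suc_pred le_refl neq0_conv)
  moreover from this have "S = ?V" by (simp add: card_subset_eq pair_finite_verts)
  ultimately show ?thesis using wf by (simp add: Int_absorb2)
qed

lemma utree_iff_ltree: "utree T \<longleftrightarrow> ltree (pverts T) (parcs T)"
  using ltree_imp_utree utree_imp_ltree by blast

subsection \<open>Tree decompositions\<close>

lemma pair_graph_wf:
  assumes "pair_graph G"
  shows "finite (pverts G)" "finite (parcs G)" "sym (parcs G)" "parcs G \<subseteq> pverts G \<times> pverts G"
    "(u, u) \<notin> parcs G"
proof -
  interpret pair_graph G by fact
  show "finite (pverts G)" "finite (parcs G)" "sym (parcs G)" "parcs G \<subseteq> pverts G \<times> pverts G"
    using pair_finite_verts pair_finite_arcs pair_sym_arcs
    by (auto simp: symmetric_def dest: in_arcsD1 in_arcsD2)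
  show "(u, u) \<notin> parcs G" using no_loops' by blast
qed

lemma tree_decomposition_iff:
  "tree_decomposition G T X \<longleftrightarrow>
     ltree (pverts T) (parcs T) \<and> (\<Union>t \<in> pverts T. X t) = pverts G \<and>
     (\<forall>(u, v) \<in> parcs G. \<exists>t \<in> pverts T. u \<in> X t \<and> v \<in> X t) \<and>
     (\<forall>v \<in> pverts G. linked (parcs T) {t \<in> pverts T. v \<in> X t})"
  using ltree_wf(3)[of "pverts T" "parcs T"]
  by (auto simp: tree_decomposition_def utree_iff_ltree connected_induced_iff)

text \<open>\<open>R\<close> is the interface: the vertices that a later gluing shares with other
  pieces have to sit together in one bag.\<close>

definition rooted_td ::
    "nat \<Rightarrow> 'a rel \<Rightarrow> 'a set \<Rightarrow> 'a set \<Rightarrow> nat set \<Rightarrow> nat rel \<Rightarrow> (nat \<Rightarrow> 'a set) \<Rightarrow> nat \<Rightarrow> bool" where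
  "rooted_td b A U R T E X r \<longleftrightarrow> ltree T E \<and>
     r \<in> T \<and> R \<subseteq> X r \<and> (\<Union>t\<in>T. X t) = U \<and>
     (\<forall>(u, v)\<in>A. u \<in> U \<longrightarrow> v \<in> U \<longrightarrow> (\<exists>t\<in>T. u \<in> X t \<and> v \<in> X t)) \<and>
     (\<forall>v\<in>U. linked E {t \<in> T. v \<in> X t}) \<and> (\<forall>t\<in>T. card (X t) \<le> b)"

text \<open>The nodes can be chosen to avoid any given finite set, so that decompositions can be glued.\<close>

definition td :: "nat \<Rightarrow> 'a rel \<Rightarrow> 'a set \<Rightarrow> 'a set \<Rightarrow> bool" where
  "td b A U R \<longleftrightarrow> (\<forall>F. finite F \<longrightarrow> (\<exists>T E X r. T \<inter> F = {} \<and> rooted_td b A U R T E X r))"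

lemma td_subset_root:
  assumes "td b A U R" "R' \<subseteq> R"
  shows "td b A U R'"
proof -
  have "rooted_td b A U R' T E X r" if "rooted_td b A U R T E X r" for T E X r
    using that assms(2) by (auto simp: rooted_td_def)
  then show ?thesis using assms(1) unfolding td_def by metis
qed

lemma tdE:
  assumes "td b A U R" "finite F"
  obtains T E X r where "T \<inter> F = {}" "rooted_td b A U R T E X r"
  using assms unfolding td_def by metis

lemma td_bag:
  assumes "card R \<le> b"
  shows "td b A R R"
  unfolding td_def
proof (intro allI impI)
  fix F :: "nat set"
  assume "finite F"
  then obtain r where "r \<notin> F" using ex_new_if_finite infinite_UNIV_nat by blast
  then show "\<exists>T E X r. T \<inter> F = {} \<and> rooted_td b A R R T E X r"
    using assms
    by (intro exI[of _ "{r}"] exI[of _ "{}"] exI[of _ "\<lambda>_. R"] exI[of _ r])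
      (auto simp: rooted_td_def ltree.single linked_def)
qed

text \<open>Linking the two roots keeps the nodes of every shared vertex connected, because both
  root bags contain it. By \<open>no_arc\<close> no arc runs between vertices private to the two
  pieces, so every arc already has a bag.\<close>

lemma td_glue:
  assumes td: "td b A U\<^sub>1 R\<^sub>1" "td b A U\<^sub>2 R\<^sub>2"
    and "U\<^sub>1 \<inter> U\<^sub>2 \<subseteq> R\<^sub>1" "U\<^sub>1 \<inter> U\<^sub>2 \<subseteq> R\<^sub>2" and "sym A"
    and no_arc: "\<And>u v. (u, v) \<in> A \<Longrightarrow> u \<in> U\<^sub>2 - U\<^sub>1 \<Longrightarrow> v \<in> U\<^sub>2"
  shows "td b A (U\<^sub>1 \<union> U\<^sub>2) R\<^sub>1"
  unfolding td_def
proof (intro allI impI)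
  fix F :: "nat set"
  assume F: "finite F"
  obtain T\<^sub>1 E\<^sub>1 X\<^sub>1 r\<^sub>1 where "T\<^sub>1 \<inter> F = {}" "rooted_td b A U\<^sub>1 R\<^sub>1 T\<^sub>1 E\<^sub>1 X\<^sub>1 r\<^sub>1"
    using tdE[OF td(1) F] by metis
  then have 1: "ltree T\<^sub>1 E\<^sub>1" "T\<^sub>1 \<inter> F = {}" "r\<^sub>1 \<in> T\<^sub>1" "R\<^sub>1 \<subseteq> X\<^sub>1 r\<^sub>1"
    "(\<Union>t\<in>T\<^sub>1. X\<^sub>1 t) = U\<^sub>1" "\<forall>(u, v)\<in>A. u \<in> U\<^sub>1 \<longrightarrow> v \<in> U\<^sub>1 \<longrightarrow> (\<exists>t\<in>T\<^sub>1. u \<in> X\<^sub>1 t \<and> v \<in> X\<^sub>1 t)"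
    "\<forall>v\<in>U\<^sub>1. linked E\<^sub>1 {t \<in> T\<^sub>1. v \<in> X\<^sub>1 t}" "\<forall>t\<in>T\<^sub>1. card (X\<^sub>1 t) \<le> b"
    by (simp_all add: rooted_td_def)
  \<comment> \<open>Avoiding \<open>T\<^sub>1\<close> as well makes the two node sets
    disjoint.\<close>
  have F': "finite (F \<union> T\<^sub>1)" using F ltree_wf(1)[OF 1(1)] by blast
  obtain T\<^sub>2 E\<^sub>2 X\<^sub>2 r\<^sub>2 where "T\<^sub>2 \<inter> (F \<union> T\<^sub>1) = {}" "rooted_td b A U\<^sub>2 R\<^sub>2 T\<^sub>2 E\<^sub>2 X\<^sub>2 r\<^sub>2"
    using tdE[OF td(2) F'] by metis
  then have 2: "ltree T\<^sub>2 E\<^sub>2" "T\<^sub>2 \<inter> (F \<union> T\<^sub>1) = {}" "r\<^sub>2 \<in> T\<^sub>2"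
    "R\<^sub>2 \<subseteq> X\<^sub>2 r\<^sub>2"
    "(\<Union>t\<in>T\<^sub>2. X\<^sub>2 t) = U\<^sub>2" "\<forall>(u, v)\<in>A. u \<in> U\<^sub>2 \<longrightarrow> v \<in> U\<^sub>2 \<longrightarrow> (\<exists>t\<in>T\<^sub>2. u \<in> X\<^sub>2 t \<and> v \<in> X\<^sub>2 t)"
    "\<forall>v\<in>U\<^sub>2. linked E\<^sub>2 {t \<in> T\<^sub>2. v \<in> X\<^sub>2 t}" "\<forall>t\<in>T\<^sub>2. card (X\<^sub>2 t) \<le> b"
    by (simp_all add: rooted_td_def)
  let ?T = "T\<^sub>1 \<union> T\<^sub>2" and ?E = "E\<^sub>1 \<union> E\<^sub>2 \<union> {(r\<^sub>1, r\<^sub>2), (r\<^sub>2, r\<^sub>1)}"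
  define X where "X t = (if t \<in> T\<^sub>1 then X\<^sub>1 t else X\<^sub>2 t)" for t
  have X1: "X t = X\<^sub>1 t" if "t \<in> T\<^sub>1" for t using that by (simp add: X_def)
  have X2: "X t = X\<^sub>2 t" if "t \<in> T\<^sub>2" for t using that 2(2) by (auto simp: X_def)
  have "ltree ?T ?E" using ltree_join[OF 2(1) 1(1)] 1(3) 2(2,3) by blast
  moreover have "?T \<inter> F = {}" "r\<^sub>1 \<in> ?T" "R\<^sub>1 \<subseteq> X r\<^sub>1" using 1 2 X1 by auto
  moreover have "(\<Union>t\<in>?T. X t) = U\<^sub>1 \<union> U\<^sub>2" using 1(5) 2(5) X1 X2 by auto
  moreover have "\<exists>t\<in>?T. u \<in> X t \<and> v \<in> X t"
    if uv: "(u, v) \<in> A" "u \<in> U\<^sub>1 \<union> U\<^sub>2" "v \<in> U\<^sub>1 \<union> U\<^sub>2" for u v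
  proof -
    have "u \<in> U\<^sub>1 \<and> v \<in> U\<^sub>1 \<or> u \<in> U\<^sub>2 \<and> v \<in> U\<^sub>2"
      using uv no_arc[of u v] no_arc[of v u] symD[OF \<open>sym A\<close>] by blast
    then show ?thesis
    proof
      assume "u \<in> U\<^sub>1 \<and> v \<in> U\<^sub>1"
      then obtain t where "t \<in> T\<^sub>1" "u \<in> X\<^sub>1 t" "v \<in> X\<^sub>1 t"
        using bspec[OF 1(6) uv(1)] by auto
      then show ?thesis using X1 by blast
    next
      assume "u \<in> U\<^sub>2 \<and> v \<in> U\<^sub>2"
      then obtain t where "t \<in> T\<^sub>2" "u \<in> X\<^sub>2 t" "v \<in> X\<^sub>2 t"
        using bspec[OF 2(6) uv(1)] by auto
      then show ?thesis using X2 by blast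
    qed
  qed
  moreover have "linked ?E {t \<in> ?T. v \<in> X t}" if v: "v \<in> U\<^sub>1 \<union> U\<^sub>2" for v
  proof -
    let ?N1 = "{t \<in> T\<^sub>1. v \<in> X\<^sub>1 t}" and ?N2 = "{t \<in> T\<^sub>2. v \<in> X\<^sub>2 t}"
    have N: "{t \<in> ?T. v \<in> X t} = ?N1 \<union> ?N2" using X1 X2 by auto
    have l1: "linked ?E ?N1" if "v \<in> U\<^sub>1"
      using 1(7) that by (blast intro: linked_mono)
    have l2: "linked ?E ?N2" if "v \<in> U\<^sub>2"
      using 2(7) that by (blast intro: linked_mono)
    consider (only1) "v \<in> U\<^sub>1" "v \<notin> U\<^sub>2" | (only2) "v \<notin> U\<^sub>1" "v \<in> U\<^sub>2" 
      | (both) "v \<in> U\<^sub>1" "v \<in> U\<^sub>2" using v by blast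
    then show ?thesis
    proof cases
      case only1
      then have "{t \<in> ?T. v \<in> X t} = ?N1" using N 2(5) by blast
      then show ?thesis using l1[OF only1(1)] by simp
    next
      case only2
      then have "{t \<in> ?T. v \<in> X t} = ?N2" using N 1(5) by blast
      then show ?thesis using l2[OF only2(2)] by simp
    next
      case both
      then have r: "r\<^sub>1 \<in> ?N1" "r\<^sub>2 \<in> ?N2" using 1(3,4) 2(3,4) assms(3,4) by auto
      have "linked ?E (insert r\<^sub>2 ?N1)"
        by (rule linked_insert[OF l1[OF both(1)] r(1)]) auto
      then have "linked ?E (insert r\<^sub>2 ?N1 \<union> ?N2)"
        using l2[OF both(2)] r(2) by (intro linked_Un) auto
      then show ?thesis using N r(2) by (simp add: insert_absorb)
    qed
  qed
  moreover have "\<forall>t\<in>?T. card (X t) \<le> b" using 1(8) 2(8) X1 X2 by auto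
  ultimately show "\<exists>T E X r. T \<inter> F = {} \<and> rooted_td b A (U\<^sub>1 \<union> U\<^sub>2) R\<^sub>1 T E X r"
    unfolding rooted_td_def
    by (intro exI[of _ ?T] exI[of _ ?E] exI[of _ X] exI[of _ r\<^sub>1]) blast
qed

lemma td_imp_tree_decomposition:
  assumes "td b (parcs G) (pverts G) R" "parcs G \<subseteq> pverts G \<times> pverts G"
  obtains T X where "tree_decomposition G T X" "\<And>t. t \<in> pverts T \<Longrightarrow> card (X t) \<le> b"
proof -
  obtain T E X r where "rooted_td b (parcs G) (pverts G) R T E X r"
    using tdE[OF assms(1) finite.emptyI] by metis
  then have T: "ltree T E" "(\<Union>t\<in>T. X t) = pverts G"
    "\<forall>(u, v)\<in>parcs G. u \<in> pverts G \<longrightarrow> v \<in> pverts G \<longrightarrow> (\<exists>t\<in>T. u \<in> X t \<and> v \<in> X t)"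
    "\<forall>v\<in>pverts G. linked E {t \<in> T. v \<in> X t}" "\<forall>t\<in>T. card (X t) \<le> b"
    by (simp_all add: rooted_td_def)
  let ?T = "\<lparr>pverts = T, parcs = E\<rparr>"
  have "tree_decomposition G ?T X"
    unfolding tree_decomposition_iff using T(1-4) assms(2) by auto
  then show ?thesis using that[of ?T X] T(5) by simp
qed

lemma tree_decomposition_exists:
  assumes "pair_graph G"
  shows "\<exists>T X. tree_decomposition G T X"
  using td_imp_tree_decomposition[OF td_bag[OF order_refl]] pair_graph_wf(4)[OF assms] by metis

lemma tree_decomposition_finite:
  "tree_decomposition G T X \<Longrightarrow> finite (pverts T) \<and> pverts T \<noteq> {}"
  using ltree_wf by (metis tree_decomposition_iff)

section \<open>Optimal tree decompositions\<close>

lemma treewidth_le: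
  assumes "tree_decomposition G T X" "\<And>t. t \<in> pverts T \<Longrightarrow> card (X t) \<le> Suc w"
  shows "treewidth G \<le> w"
proof -
  have "Max ((\<lambda>t. card (X t)) ` pverts T) \<le> Suc w"
    using tree_decomposition_finite[OF assms(1)] assms(2) by (simp add: Max_le_iff)
  moreover have "treewidth G \<le> Max ((\<lambda>t. card (X t)) ` pverts T) - 1"
    unfolding treewidth_def using assms(1) by (intro wellorder_Inf_le1) blast
  ultimately show ?thesis by linarith
qed

lemma treewidth_attained:
  assumes "pair_graph G"
  obtains T X where "tree_decomposition G T X"
    "\<And>t. t \<in> pverts T \<Longrightarrow> card (X t) \<le> Suc (treewidth G)"
proof -
  let ?S = "{Max ((\<lambda>t. card (X t)) ` pverts T) - 1 |T X. tree_decomposition G T X}"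
  have "?S \<noteq> {}" using tree_decomposition_exists[OF assms] by blast
  then have "treewidth G \<in> ?S" unfolding treewidth_def by (rule Inf_nat_def1)
  then obtain T X where T: "tree_decomposition G T X"
    "treewidth G = Max ((\<lambda>t. card (X t)) ` pverts T) - 1" by blast
  have "card (X t) \<le> Max ((\<lambda>t. card (X t)) ` pverts T)" if "t \<in> pverts T" for t
    using that tree_decomposition_finite[OF T(1)] by (intro Max_ge) auto
  \<comment> \<open>The truncated subtraction is harmless: bags of size \<open>0\<close> satisfy the
    bound as well.\<close>
  then have "card (X t) \<le> Suc (treewidth G)" if "t \<in> pverts T" for t
    using that T(2) by fastforce
  then show ?thesis by (rule that[OF T(1)])
qed

lemma tree_independence_number_attained:
  assumes "pair_graph G"
  obtains T X where "tree_decomposition G T X"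
    "\<And>t. t \<in> pverts T \<Longrightarrow>
       independence_number (with_proj G \<restriction> X t) \<le> tree_independence_number G"
proof -
  let ?S = "{Max ((\<lambda>t. independence_number (with_proj G \<restriction> X t)) ` pverts T) |T X.
    tree_decomposition G T X}"
  have "?S \<noteq> {}" using tree_decomposition_exists[OF assms] by blast
  then have "tree_independence_number G \<in> ?S"
    unfolding tree_independence_number_def by (rule Inf_nat_def1)
  then obtain T X where T: "tree_decomposition G T X"
    "tree_independence_number G =
       Max ((\<lambda>t. independence_number (with_proj G \<restriction> X t)) ` pverts T)" by blast
  have "independence_number (with_proj G \<restriction> X t)
      \<le> Max ((\<lambda>t. independence_number (with_proj G \<restriction> X t)) ` pverts T)" if "t \<in> pverts T" for t
    using that tree_decomposition_finite[OF T(1)] by (intro Max_ge) auto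
  then show ?thesis unfolding T(2)[symmetric] by (rule that[OF T(1)])
qed

lemma tree_independence_number_le:
  assumes "tree_decomposition G T X"
    "\<And>t. t \<in> pverts T \<Longrightarrow> independence_number (with_proj G \<restriction> X t) \<le> k"
  shows "tree_independence_number G \<le> k"
proof -
  have "Max ((\<lambda>t. independence_number (with_proj G \<restriction> X t)) ` pverts T) \<le> k"
    using tree_decomposition_finite[OF assms(1)] assms(2) by (simp add: Max_le_iff)
  moreover have "tree_independence_number G
      \<le> Max ((\<lambda>t. independence_number (with_proj G \<restriction> X t)) ` pverts T)"
    unfolding tree_independence_number_def using assms(1) by (intro wellorder_Inf_le1) blast
  ultimately show ?thesis by linarith
qed

subsection \<open>Havens\<close>

text \<open>\<open>\<beta> S\<close> is the region where a fugitive hides once \<open>S\<close> is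
  blocked. It must contain an arc because a line graph sees only edges. That it shrinks as
  \<open>S\<close> grows lets two separators be compared through their union.\<close>

definition haven :: "nat \<Rightarrow> 'a set \<Rightarrow> 'a rel \<Rightarrow> ('a set \<Rightarrow> 'a set) \<Rightarrow> bool" where
  "haven c V A \<beta> \<longleftrightarrow> (\<forall>S\<subseteq>V. card S \<le> c \<longrightarrow>
     \<beta> S \<subseteq> V - S \<and> linked A (\<beta> S) \<and> (\<exists>u\<in>\<beta> S. \<exists>v\<in>\<beta> S. (u, v) \<in> A) \<and>
     (\<forall>S'\<subseteq>V. S \<subseteq> S' \<longrightarrow> \<beta> S' \<subseteq> \<beta> S))"

lemma linked_Union:
  assumes "F \<noteq> {}" "\<And>C. C \<in> F \<Longrightarrow> linked A C" "\<And>C D. C \<in> F \<Longrightarrow> D \<in> F \<Longrightarrow> C \<inter> D \<noteq> {}"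
  shows "linked A (\<Union>F)"
  unfolding linked_def
proof (intro conjI ballI)
  show "\<Union>F \<noteq> {}" using assms(1,2) by (auto simp: linked_def)
  fix x y
  assume "x \<in> \<Union>F" "y \<in> \<Union>F"
  then obtain C D where CD: "x \<in> C" "y \<in> D" "C \<in> F" "D \<in> F" by blast
  then have "linked A (C \<union> D)" using assms by (intro linked_Un) auto
  then have "(x, y) \<in> (A \<inter> (C \<union> D) \<times> (C \<union> D))\<^sup>*" using CD by (auto simp: linked_def)
  then show "(x, y) \<in> (A \<inter> \<Union>F \<times> \<Union>F)\<^sup>*" by (rule rtrancl_Int_mono) (use CD in auto)
qed

text \<open>Take for \<open>\<beta> S\<close> the union of all connected sets outside
  \<open>S\<close> that contain more than half of \<open>W\<close>. Two such sets share a vertex of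
  \<open>W\<close>, so the union is connected; a larger \<open>S\<close> leaves fewer of them. By
  \<open>2 \<le> card W\<close> each contains two vertices of \<open>W\<close>, hence an
  arc.\<close>

lemma haven_if_no_balanced_separator:
  assumes "finite V" "W \<subseteq> V" "2 \<le> card W"
    and nosep: "\<And>S. S \<subseteq> V \<Longrightarrow> card S \<le> c \<Longrightarrow>
       \<exists>C\<subseteq>V - S. linked A C \<and> card W < 2 * card (C \<inter> W)"
  shows "\<exists>\<beta>. haven c V A \<beta>"
proof -
  define F where "F S = {C. C \<subseteq> V - S \<and> linked A C \<and> card W < 2 * card (C \<inter> W)}" for S
  have finW: "finite W" using assms finite_subset by blast
  have meet: "C \<inter> D \<noteq> {}" if "C \<in> F S" "D \<in> F S" for C D S
  proof
    assume "C \<inter> D = {}"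
    then have "card (C \<inter> W) + card (D \<inter> W) = card (C \<inter> W \<union> D \<inter> W)"
      using finW by (subst card_Un_disjoint) auto
    also have "\<dots> \<le> card W" using finW by (intro card_mono) auto
    finally show False using that by (simp add: F_def)
  qed
  have "\<Union>(F S) \<subseteq> V - S \<and> linked A (\<Union>(F S)) \<and> (\<exists>u\<in>\<Union>(F S). \<exists>v\<in>\<Union>(F S). (u, v) \<in> A) \<and>
     (\<forall>S'\<subseteq>V. S \<subseteq> S' \<longrightarrow> \<Union>(F S') \<subseteq> \<Union>(F S))" if S: "S \<subseteq> V" "card S \<le> c" for S
  proof (intro conjI allI impI)
    obtain C where C: "C \<in> F S" using nosep[OF S] by (auto simp: F_def)
    then show "linked A (\<Union>(F S))"
      by (intro linked_Union) (use meet in \<open>auto simp: F_def\<close>)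
    have lC: "linked A C" using C by (auto simp: F_def)
    have "1 < card (C \<inter> W)" using C assms(3) by (auto simp: F_def)
    then obtain x y where "x \<in> C" "y \<in> C" "x \<noteq> y"
      by (metis IntD1 One_nat_def card_le_Suc0_iff_eq finW finite_Int not_less)
    then obtain u v where "u \<in> C" "v \<in> C" "(u, v) \<in> A"
      using linked_exit[OF lC \<open>x \<in> C\<close> _ \<open>y \<in> C\<close>, of "{x}"]
      by (metis DiffD1 IntD1 singletonD singletonI)
    then show "\<exists>u\<in>\<Union>(F S). \<exists>v\<in>\<Union>(F S). (u, v) \<in> A" using C by blast
  qed (auto simp: F_def)
  then have "haven c V A (\<lambda>S. \<Union>(F S))" by (auto simp: haven_def)
  then show ?thesis by blast
qed

lemma balanced_separator:
  assumes "finite V" "\<nexists>\<beta>. haven c V A \<beta>" "W \<subseteq> V" "0 < c"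
  obtains S where "S \<subseteq> V" "card S \<le> c" "\<And>C. C \<subseteq> V - S \<Longrightarrow> linked A C \<Longrightarrow> 2 * card (C \<inter> W) \<le> card W"
proof (cases "2 \<le> card W")
  case True
  then have "\<not> (\<forall>S. S \<subseteq> V \<longrightarrow> card S \<le> c \<longrightarrow>
       (\<exists>C\<subseteq>V - S. linked A C \<and> card W < 2 * card (C \<inter> W)))"
    using haven_if_no_balanced_separator[OF assms(1,3) True] assms(2) by blast
  then show ?thesis using that by (meson linorder_not_less)
next
  case False
  \<comment> \<open>A set \<open>W\<close> with at most one vertex is its own separator, and
    \<open>0 < c\<close> makes it small enough.\<close>
  then have "card W \<le> c" using \<open>0 < c\<close> by linarith
  moreover have "C \<inter> W = {}" if "C \<subseteq> V - W" for C using that by blast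
  ultimately show ?thesis using that[of W] assms(3) by simp
qed

text \<open>
  The root bag consists of \<open>W\<close>, a further vertex \<open>z\<close> of \<open>Z\<close> and a separator \<open>S\<close> balanced for both.
  A component \<open>K\<close> of the rest together with its neighbours outside \<open>S\<close> is connected in \<open>G - S\<close>, so at
  most \<open>c + 1\<close> of these neighbours lie in \<open>W\<close> or equal \<open>z\<close>, and \<open>K\<close> has at most \<open>2 c + 1\<close> neighbours.
\<close>

lemma td_if_no_haven:
  assumes V: "finite V" "sym A" "A \<subseteq> V \<times> V"
    and no_haven: "\<nexists>\<beta>. haven c V A \<beta>" "0 < c"
    and "Z \<subseteq> V" "W \<subseteq> V" "Z \<inter> W = {}" "card W \<le> 2 * c + 1"
    and "\<And>u v. (u, v) \<in> A \<Longrightarrow> u \<in> Z \<Longrightarrow> v \<in> Z \<union> W"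
  shows "td (3 * c + 2) A (Z \<union> W) W"
  using assms(6-)
proof (induction "card Z" arbitrary: Z W rule: less_induct)
  case less
  have fin: "finite Z" "finite W" using less.prems V(1) finite_subset by blast+
  show ?case
  proof (cases "Z = {}")
    case True
    then show ?thesis using td_bag[of W "3 * c + 2" A] less.prems by simp
  next
    case False
    \<comment> \<open>Putting some \<open>z\<close> of \<open>Z\<close> into the root bag guarantees
      progress: every remaining component is strictly smaller than \<open>Z\<close>, even if the
      separator misses \<open>Z\<close>.\<close>
    then obtain z where z: "z \<in> Z" by blast
    have W': "insert z W \<subseteq> V" using z less.prems by blast
    obtain S where S: "S \<subseteq> V" "card S \<le> c"
      "\<And>C. C \<subseteq> V - S \<Longrightarrow> linked A C \<Longrightarrow> 2 * card (C \<inter> insert z W) \<le> card (insert z W)"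
      using balanced_separator[OF V(1) no_haven(1) W' no_haven(2)] by metis
    have finS: "finite S" using S V(1) finite_subset by blast
    have cW': "card (insert z W) \<le> 2 * c + 2" using card_insert_le_m1[of "2*c+2" W z] less.prems by simp
    \<comment> \<open>Only \<open>S \<inter> Z\<close> enters the bag, as \<open>S\<close> may reach
      beyond \<open>Z \<union> W\<close>. Together with the \<open>2 * c + 2\<close> from
      \<open>insert z W\<close> this gives the bag size \<open>3 * c + 2\<close>.\<close>
    define R where "R = insert z W \<union> S \<inter> Z"
    define Z' where "Z' = Z - R"
    define K where "K x = {y \<in> Z'. (x, y) \<in> (A \<inter> Z' \<times> Z')\<^sup>*}" for x
    define N where "N C = {w. w \<notin> C \<and> (\<exists>u\<in>C. (u, w) \<in> A)}" for C
    have symZ': "sym (A \<inter> Z' \<times> Z')" using V(2) by (auto simp: sym_def)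
    have Kx: "x \<in> K x" if "x \<in> Z'" for x using that by (simp add: K_def)
    have K_eq: "K y = K x" if "y \<in> K x" for x y
      using that rtrancl_symD[OF symZ'] unfolding K_def by (blast intro: rtrancl_trans)
    have K_closed: "v \<in> K x" if "u \<in> K x" "(u, v) \<in> A" "v \<in> Z'" for u v x
      using that unfolding K_def by (auto intro: rtrancl_into_rtrancl)
    have K_linked: "linked A (K x)" if x: "x \<in> Z'" for x
    proof -
      have "(x, y) \<in> (A \<inter> K x \<times> K x)\<^sup>* \<and> (y, x) \<in> (A \<inter> K x \<times> K x)\<^sup>*" if "y \<in> K x" for y
      proof -
        have "(x, y) \<in> (A \<inter> Z' \<times> Z')\<^sup>*" using that by (simp add: K_def)
        then have "(x, y) \<in> (A \<inter> K x \<times> K x)\<^sup>*"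
        proof induction
          case (step y z)
          then have "y \<in> K x" "z \<in> K x" by (auto simp: K_def intro: rtrancl_into_rtrancl)
          then show ?case using step by (auto intro: rtrancl_into_rtrancl)
        qed simp
        moreover have "sym (A \<inter> K x \<times> K x)" using V(2) by (auto simp: sym_def)
        ultimately show ?thesis using rtrancl_symD by fast
      qed
      then show ?thesis using Kx[OF x] unfolding linked_def by (blast intro: rtrancl_trans)
    qed
    have NR: "N (K x) \<subseteq> R" if "x \<in> Z'" for x
    proof
      fix w
      assume "w \<in> N (K x)"
      then obtain u where u: "u \<in> K x" "(u, w) \<in> A" "w \<notin> K x" by (auto simp: N_def)
      have "u \<in> Z" using u(1) by (simp add: K_def Z'_def)
      then have "w \<in> Z \<union> W" using less.prems(5) u(2) by blast
      then show "w \<in> R" using K_closed[OF u(1,2)] u(3) by (auto simp: Z'_def R_def)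
    qed
    have cN: "card (N (K x)) \<le> 2 * c + 1" if x: "x \<in> Z'" for x
    proof -
      let ?C = "K x \<union> (N (K x) - S)"
      have "linked A (K x \<union> M)" if "M \<subseteq> N (K x)" "finite M" for M
        using that(2,1)
      proof (induction M rule: finite_induct)
        case (insert w M)
        then obtain u where "u \<in> K x" "(u, w) \<in> A" by (auto simp: N_def)
        then have "linked A (insert w (K x \<union> M))"
          using insert V(2) by (intro linked_insert[where s=u]) (auto dest: symD)
        then show ?case by simp
      qed (use K_linked x in simp)
      moreover have "finite (N (K x) - S)"
        using NR[OF x] fin finite_subset by (fastforce simp: R_def)
      ultimately have "linked A ?C" by blast
      moreover have "?C \<subseteq> V - S"
        using V(3) less.prems(1) by (auto simp: K_def N_def Z'_def R_def)
      ultimately have "2 * card (?C \<inter> insert z W) \<le> 2 * c + 2"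
        using S(3)[of ?C] cW' by linarith
      moreover have "card (N (K x) - S) \<le> card (?C \<inter> insert z W)"
        using NR[OF x] fin by (intro card_mono) (auto simp: R_def)
      moreover have "card (N (K x)) \<le> card ((N (K x) - S) \<union> S)"
        using NR[OF x] fin finS by (intro card_mono) (auto simp: R_def finite_subset)
      moreover have "\<dots> \<le> card (N (K x) - S) + card S" by (rule card_Un_le)
      ultimately show ?thesis using S(2) by linarith
    qed
    have tdK: "td (3 * c + 2) A (K x \<union> N (K x)) (N (K x))" if x: "x \<in> Z'" for x
    proof (rule less.hyps)
      have "K x \<subset> Z" using z by (auto simp: K_def Z'_def R_def)
      then show "card (K x) < card Z" using fin by (simp add: psubset_card_mono)
      show "K x \<subseteq> V" using \<open>K x \<subset> Z\<close> less.prems(1) by blast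
      show "N (K x) \<subseteq> V" using V(3) by (auto simp: N_def)
    qed (use cN[OF x] in \<open>auto simp: N_def\<close>)
    have "td (3 * c + 2) A (R \<union> \<Union>(K ` Y)) R" if "finite Y" "Y \<subseteq> Z'" for Y
      using that
    proof (induction Y rule: finite_induct)
      case empty
      have "card R \<le> card (insert z W) + card (S \<inter> Z)" unfolding R_def by (rule card_Un_le)
      also have "card (S \<inter> Z) \<le> card S" using finS by (intro card_mono) auto
      finally show ?case using cW' S(2) td_bag[of R "3 * c + 2" A] by simp
    next
      case (insert x Y)
      show ?case
      proof (cases "x \<in> \<Union>(K ` Y)")
        case True
        \<comment> \<open>Different vertices may name the same component; a repetition adds
          nothing.\<close>
        then obtain y where "y \<in> Y" "K x = K y" using K_eq by blast
        then have "\<Union>(K ` insert x Y) = \<Union>(K ` Y)" by blast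
        then show ?thesis using insert by simp
      next
        case False
        have xZ: "x \<in> Z'" using insert by blast
        have disj: "K x \<inter> K y = {}" if "y \<in> Y" for y
        proof (rule ccontr)
          assume "K x \<inter> K y \<noteq> {}"
          then obtain w where "w \<in> K x" "w \<in> K y" by blast
          then have "K x = K y" using K_eq by metis
          then show False using False that Kx[OF xZ] by blast
        qed
        \<comment> \<open>Distinct components are disjoint, so the new piece meets what is already
          built only in its neighbours \<open>N (K x)\<close>, and these lie in the root
          bag.\<close>
        have int: "(R \<union> \<Union>(K ` Y)) \<inter> (K x \<union> N (K x)) \<subseteq> N (K x)"
          using disj by (auto simp: K_def Z'_def)
        have "td (3 * c + 2) A ((R \<union> \<Union>(K ` Y)) \<union> (K x \<union> N (K x))) R"
        proof (rule td_glue[OF _ tdK[OF xZ] _ int V(2)])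
          show "td (3 * c + 2) A (R \<union> \<Union>(K ` Y)) R" using insert by blast
          show "(R \<union> \<Union>(K ` Y)) \<inter> (K x \<union> N (K x)) \<subseteq> R" using int NR[OF xZ] by blast
          show "v \<in> K x \<union> N (K x)"
            if "(u, v) \<in> A" "u \<in> K x \<union> N (K x) - (R \<union> \<Union>(K ` Y))" for u v
            using that NR[OF xZ] by (auto simp: N_def)
        qed
        moreover have "(R \<union> \<Union>(K ` Y)) \<union> (K x \<union> N (K x)) = R \<union> \<Union>(K ` insert x Y)"
          using NR[OF xZ] by auto
        ultimately show ?thesis by simp
      qed
    qed
    from this[of Z'] have "td (3 * c + 2) A (R \<union> \<Union>(K ` Z')) R" using fin by (simp add: Z'_def)
    moreover have "\<Union>(K ` Z') = Z'" using Kx by (auto simp: K_def)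
    moreover have "R \<union> Z' = Z \<union> W" using z by (auto simp: R_def Z'_def)
    ultimately show ?thesis by (auto intro: td_subset_root simp: R_def)
  qed
qed

lemma treewidth_le_if_no_haven:
  assumes "pair_graph G" "\<nexists>\<beta>. haven c (pverts G) (parcs G) \<beta>" "0 < c"
  shows "treewidth G \<le> 3 * c + 1"
proof -
  note wf = pair_graph_wf[OF assms(1)]
  have "td (3 * c + 2) (parcs G) (pverts G \<union> {}) {}"
    using wf by (intro td_if_no_haven[OF wf(1,3,4) assms(2,3)]) auto
  then obtain T X where "tree_decomposition G T X" "\<And>t. t \<in> pverts T \<Longrightarrow> card (X t) \<le> 3 * c + 2"
    using td_imp_tree_decomposition wf(4) by (metis sup_bot_right)
  then show ?thesis by (intro treewidth_le[of G T X]) auto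
qed

subsection \<open>Line graphs, cuts and independent sets\<close>

lemma line_graph_simps [simp]:
  "pverts (line_graph G) = uedges G"
  "(e, f) \<in> parcs (line_graph G) \<longleftrightarrow> e \<in> uedges G \<and> f \<in> uedges G \<and> e \<noteq> f \<and> e \<inter> f \<noteq> {}"
  by (auto simp: line_graph_def)

lemma uedgesE:
  assumes "e \<in> uedges G"
  obtains u v where "e = {u, v}" "(u, v) \<in> parcs G"
  using assms by (auto simp: uedges_def)

lemma uedges_wf:
  assumes "pair_graph G" "e \<in> uedges G"
  shows "e \<subseteq> pverts G" "finite e" "card e = 2" "e \<noteq> {}"
proof -
  obtain u v where "e = {u, v}" "(u, v) \<in> parcs G" using assms(2) by (rule uedgesE)
  moreover from this have "u \<noteq> v" using pair_graph_wf(5)[OF assms(1)] by blast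
  ultimately show "e \<subseteq> pverts G" "finite e" "card e = 2" "e \<noteq> {}"
    using pair_graph_wf(4)[OF assms(1)] by auto
qed

lemma finite_uedges:
  assumes "pair_graph G"
  shows "finite (uedges G)"
  using pair_graph_wf(1)[OF pair_graph_line_graph[OF assms]] by simp

lemma uedges_cut_graph:
  "uedges (cut_graph G X) = {{u, v} |u v. (u, v) \<in> parcs G \<and> (u \<in> X) \<noteq> (v \<in> X)}"
  by (auto simp: uedges_def cut_graph_def)

lemma uedges_cut_graph_subset: "uedges (cut_graph G X) \<subseteq> uedges G"
  by (auto simp: uedges_def cut_graph_def)

lemma finite_matching_cards:
  assumes "pair_graph G" "\<And>M. P M \<Longrightarrow> M \<subseteq> uedges G"
  shows "finite {card M |M. P M}"
proof -
  have "{card M |M. P M} \<subseteq> card ` Pow (uedges G)" using assms(2) by auto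
  then show ?thesis using finite_uedges[OF assms(1)] by (simp add: finite_subset)
qed

lemma cutsim_ge:
  assumes "pair_graph G" "induced_matching G M" "M \<subseteq> uedges (cut_graph G X)"
  shows "card M \<le> cutsim G X"
  unfolding cutsim_def using assms uedges_cut_graph_subset
  by (intro Max_ge finite_matching_cards[OF assms(1)]) blast+

lemma cutsim_attained:
  assumes "pair_graph G"
  obtains M where "induced_matching G M" "M \<subseteq> uedges (cut_graph G X)" "card M = cutsim G X"
proof -
  let ?S = "{card M |M. induced_matching G M \<and> M \<subseteq> uedges (cut_graph G X)}"
  have "induced_matching G {} \<and> {} \<subseteq> uedges (cut_graph G X)"
    by (auto simp: induced_matching_def matching_def)
  then have "?S \<noteq> {}" by blast
  moreover have "finite ?S"
    using uedges_cut_graph_subset by (intro finite_matching_cards[OF assms]) blast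
  ultimately have "cutsim G X \<in> ?S" unfolding cutsim_def by (intro Max_in)
  then show ?thesis using that by force
qed

lemma induced_matching_cut_subset:
  "induced_matching (cut_graph G X) M \<Longrightarrow> M \<subseteq> uedges G"
  using uedges_cut_graph_subset by (auto simp: induced_matching_def matching_def)

lemma cutsim_le_cutmim:
  assumes "pair_graph G"
  shows "cutsim G X \<le> cutmim G X"
proof -
  obtain M where M: "induced_matching G M" "M \<subseteq> uedges (cut_graph G X)" "card M = cutsim G X"
    using cutsim_attained[OF assms] by metis
  have "parcs (cut_graph G X) \<subseteq> parcs G" by (auto simp: cut_graph_def)
  then have "\<forall>(u, v)\<in>parcs (cut_graph G X). u \<in> \<Union>M \<and> v \<in> \<Union>M \<longrightarrow> {u, v} \<in> M"
    using M(1) unfolding induced_matching_def by blast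
  moreover have "matching (cut_graph G X) M"
    using M(1,2) by (auto simp: induced_matching_def matching_def)
  ultimately have im: "induced_matching (cut_graph G X) M" by (simp add: induced_matching_def)
  show ?thesis
    unfolding cutmim_def M(3)[symmetric]
  proof (rule Max_ge)
    show "finite {card M |M. induced_matching (cut_graph G X) M}"
      using induced_matching_cut_subset by (intro finite_matching_cards[OF assms])
    show "card M \<in> {card M |M. induced_matching (cut_graph G X) M}" using im by auto
  qed
qed

section \<open>Optimal branch decompositions\<close>

lemma out_degree_eq: "out_degree (with_proj T) t = card {s. (t, s) \<in> parcs T}"
proof -
  have "out_arcs (with_proj T) t = Pair t ` {s. (t, s) \<in> parcs T}"
    by (auto simp: out_arcs_def)
  then show ?thesis by (simp add: out_degree_def card_image inj_on_def)
qed

lemma branch_decomposition_arcs: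
  assumes "branch_decomposition G T \<delta>" "pverts G \<noteq> {}"
  shows "finite (parcs T)" "parcs T \<noteq> {}"
proof -
  show "finite (parcs T)"
    using assms ltree_finite_arcs utree_iff_ltree by (auto simp: branch_decomposition_def)
  obtain v where "v \<in> pverts G" using assms(2) by blast
  then have "\<delta> v \<in> leaves T" using assms(1) by (auto simp: branch_decomposition_def bij_betw_def)
  then have "card {s. (\<delta> v, s) \<in> parcs T} = 1" by (simp add: leaves_def out_degree_eq)
  then show "parcs T \<noteq> {}" by auto
qed

text \<open>The given decomposition shows that the infimum ranges over a nonempty set, so it is
  attained.\<close>

lemma cut_width_attained:
  assumes "branch_decomposition G T \<delta>" "1 < card (pverts G)"
  obtains T \<delta> where "branch_decomposition G T \<delta>"
    "\<And>a. a \<in> parcs T \<Longrightarrow> \<phi> G (edge_side G T \<delta> a) \<le> cut_width \<phi> G"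
proof -
  let ?S = "{branch_decomposition_width \<phi> G T \<delta> |T \<delta>. branch_decomposition G T \<delta>}"
  have "?S \<noteq> {}" using assms(1) by blast
  then have "Inf ?S \<in> ?S" by (rule Inf_nat_def1)
  moreover have "cut_width \<phi> G = Inf ?S" using assms(2) by (simp add: cut_width_def)
  ultimately obtain T \<delta> where T: "branch_decomposition G T \<delta>"
    "cut_width \<phi> G = branch_decomposition_width \<phi> G T \<delta>" by auto
  have "pverts G \<noteq> {}" using assms(2) by auto
  then have "\<phi> G (edge_side G T \<delta> a) \<le> cut_width \<phi> G" if "a \<in> parcs T" for a
    unfolding T(2) branch_decomposition_width_def
    using that branch_decomposition_arcs[OF T(1)] by (intro Max_ge) auto
  then show ?thesis using that T(1) by blast
qed

lemma cut_width_le: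
  assumes "branch_decomposition G T \<delta>" "pverts G \<noteq> {}"
    and "\<And>a. a \<in> parcs T \<Longrightarrow> \<phi> G (edge_side G T \<delta> a) \<le> k"
  shows "cut_width \<phi> G \<le> k"
proof -
  have "branch_decomposition_width \<phi> G T \<delta> \<le> k"
    unfolding branch_decomposition_width_def
    using branch_decomposition_arcs[OF assms(1,2)] assms(3) by (simp add: Max_le_iff)
  moreover have "Inf {branch_decomposition_width \<phi> G T \<delta> |T \<delta>. branch_decomposition G T \<delta>}
      \<le> branch_decomposition_width \<phi> G T \<delta>"
    using assms(1) by (intro wellorder_Inf_le1) blast
  ultimately show ?thesis by (auto simp: cut_width_def)
qed

text \<open>A decomposition optimal for mim-width bounds sim-width cut by cut; the second hypothesis
  guarantees that an optimal one exists.\<close>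

lemma sim_width_le_mim_width:
  assumes "pair_graph G" "1 < card (pverts G) \<Longrightarrow> branch_decomposition G T \<delta>"
  shows "sim_width G \<le> mim_width G"
proof (cases "1 < card (pverts G)")
  case True
  obtain T \<delta> where T: "branch_decomposition G T \<delta>"
    "\<And>a. a \<in> parcs T \<Longrightarrow> cutmim G (edge_side G T \<delta> a) \<le> cut_width cutmim G"
    using cut_width_attained[OF assms(2)[OF True] True] by metis
  have "pverts G \<noteq> {}" using True by auto
  then show ?thesis
    unfolding sim_width_def mim_width_def using T cutsim_le_cutmim[OF assms(1)]
    by (intro cut_width_le[OF T(1)]) (auto intro: order_trans)
qed (simp add: sim_width_def cut_width_def)

section \<open>Independent sets in bags\<close>

lemma independent_set_induced_iff:
  "independent_set (with_proj G \<restriction> Y) S \<longleftrightarrow> S \<subseteq> Y \<and> (\<forall>u\<in>S. \<forall>v\<in>S. (u, v) \<notin> parcs G)"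
  unfolding independent_set_def arcs_ends_induced by auto

lemma independence_number_le:
  assumes "finite Y" "\<And>S. S \<subseteq> Y \<Longrightarrow> (\<And>u v. u \<in> S \<Longrightarrow> v \<in> S \<Longrightarrow> (u, v) \<notin> parcs G) \<Longrightarrow> card S \<le> k"
  shows "independence_number (with_proj G \<restriction> Y) \<le> k"
proof -
  let ?S = "{card S |S. independent_set (with_proj G \<restriction> Y) S}"
  have "?S \<subseteq> card ` Pow Y" by (auto simp: independent_set_induced_iff)
  then have "finite ?S" using assms(1) by (simp add: finite_subset)
  moreover have "independent_set (with_proj G \<restriction> Y) {}" by (simp add: independent_set_def)
  then have "?S \<noteq> {}" by blast
  ultimately show ?thesis
    unfolding independence_number_def using assms(2)
    by (subst Max_le_iff) (auto simp: independent_set_induced_iff)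
qed

lemma independence_number_attained:
  assumes "finite Y"
  obtains S where "S \<subseteq> Y" "\<And>u v. u \<in> S \<Longrightarrow> v \<in> S \<Longrightarrow> (u, v) \<notin> parcs G"
    "card S = independence_number (with_proj G \<restriction> Y)"
    "\<And>S'. S' \<subseteq> Y \<Longrightarrow> (\<And>u v. u \<in> S' \<Longrightarrow> v \<in> S' \<Longrightarrow> (u, v) \<notin> parcs G) \<Longrightarrow> card S' \<le> card S"
proof -
  let ?S = "{card S |S. independent_set (with_proj G \<restriction> Y) S}"
  have "?S \<subseteq> card ` Pow Y" by (auto simp: independent_set_induced_iff)
  then have fin: "finite ?S" using assms(1) by (simp add: finite_subset)
  moreover have "independent_set (with_proj G \<restriction> Y) {}" by (simp add: independent_set_def)
  then have "?S \<noteq> {}" by blast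
  ultimately have "Max ?S \<in> ?S" by (rule Max_in)
  then obtain S where S: "independent_set (with_proj G \<restriction> Y) S" "Max ?S = card S" by blast
  have max: "card S' \<le> card S" if "independent_set (with_proj G \<restriction> Y) S'" for S'
    unfolding S(2)[symmetric] using fin that by (intro Max_ge) blast+
  show ?thesis
  proof (rule that)
    show "S \<subseteq> Y" "\<And>u v. u \<in> S \<Longrightarrow> v \<in> S \<Longrightarrow> (u, v) \<notin> parcs G"
      using S(1) by (auto simp: independent_set_induced_iff)
    show "card S = independence_number (with_proj G \<restriction> Y)"
      using S(2) by (simp add: independence_number_def)
    show "card S' \<le> card S"
      if "S' \<subseteq> Y" "\<And>u v. u \<in> S' \<Longrightarrow> v \<in> S' \<Longrightarrow> (u, v) \<notin> parcs G" for S'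
      using that by (intro max) (auto simp: independent_set_induced_iff)
  qed
qed

lemma tree_independence_number_le_treewidth:
  assumes "pair_graph G"
  shows "tree_independence_number G \<le> Suc (treewidth G)"
proof -
  obtain T X where T: "tree_decomposition G T X"
    "\<And>t. t \<in> pverts T \<Longrightarrow> card (X t) \<le> Suc (treewidth G)"
    using treewidth_attained[OF assms] by metis
  show ?thesis
  proof (rule tree_independence_number_le[OF T(1)])
    fix t
    assume t: "t \<in> pverts T"
    then have "finite (X t)"
      using T(1) pair_graph_wf(1)[OF assms] by (auto simp: tree_decomposition_iff intro: finite_subset)
    then show "independence_number (with_proj G \<restriction> X t) \<le> Suc (treewidth G)"
      using T(2)[OF t] by (intro independence_number_le) (auto dest: card_mono)
  qed
qed

text \<open>Keep the tree and replace each bag by the edges that meet it. The nodes of an edge are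
  then the union of two subtrees sharing a node whose bag contains both ends. Independent edges are
  disjoint, so each has a vertex of \<open>X t\<close> to itself.\<close>

lemma tree_independence_number_line_graph_le:
  assumes G: "pair_graph G"
  shows "tree_independence_number (line_graph G) \<le> Suc (treewidth G)"
proof -
  obtain T X where T: "tree_decomposition G T X"
    "\<And>t. t \<in> pverts T \<Longrightarrow> card (X t) \<le> Suc (treewidth G)"
    using treewidth_attained[OF G] by metis
  note td = T(1)[unfolded tree_decomposition_iff]
  define Y where "Y t = {e \<in> uedges G. e \<inter> X t \<noteq> {}}" for t
  have bag: "\<exists>t\<in>pverts T. v \<in> X t" if "v \<in> pverts G" for v
    using td that by blast
  have "e \<in> (\<Union>t\<in>pverts T. Y t)" if e: "e \<in> uedges G" for e
  proof -
    obtain x where "x \<in> e" "x \<in> pverts G" using uedges_wf(1,4)[OF G e] by blast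
    then show ?thesis using bag[of x] e by (auto simp: Y_def)
  qed
  then have "(\<Union>t\<in>pverts T. Y t) = uedges G" by (auto simp: Y_def)
  moreover have "\<exists>t\<in>pverts T. e \<in> Y t \<and> f \<in> Y t" if ef: "(e, f) \<in> parcs (line_graph G)" for e f
  proof -
    obtain x where "x \<in> e" "x \<in> f" using ef by auto
    moreover obtain t where "t \<in> pverts T" "x \<in> X t"
      using bag uedges_wf(1)[OF G] ef \<open>x \<in> e\<close> by (metis line_graph_simps(2) subsetD)
    ultimately show ?thesis using ef by (auto simp: Y_def)
  qed
  moreover have "linked (parcs T) {t \<in> pverts T. e \<in> Y t}" if e: "e \<in> uedges G" for e
  proof -
    obtain u v where uv: "e = {u, v}" "(u, v) \<in> parcs G" using e by (rule uedgesE)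
    then have "u \<in> pverts G" "v \<in> pverts G" using pair_graph_wf(4)[OF G] by auto
    then have "linked (parcs T) ({t \<in> pverts T. u \<in> X t} \<union> {t \<in> pverts T. v \<in> X t})"
      using td uv(2) by (intro linked_Un) auto
    moreover have "{t \<in> pverts T. e \<in> Y t} = {t \<in> pverts T. u \<in> X t} \<union> {t \<in> pverts T. v \<in> X t}"
      using e uv(1) by (auto simp: Y_def)
    ultimately show ?thesis by simp
  qed
  ultimately have "tree_decomposition (line_graph G) T Y"
    using td unfolding tree_decomposition_iff by auto
  then show ?thesis
  proof (rule tree_independence_number_le)
    fix t
    assume t: "t \<in> pverts T"
    then have finX: "finite (X t)"
      using td pair_graph_wf(1)[OF G] by (auto intro: finite_subset)
    show "independence_number (with_proj (line_graph G) \<restriction> Y t) \<le> Suc (treewidth G)"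
    proof (rule independence_number_le)
      show "finite (Y t)" using finite_uedges[OF G] by (simp add: Y_def)
      fix S
      assume S: "S \<subseteq> Y t" "\<And>e f. e \<in> S \<Longrightarrow> f \<in> S \<Longrightarrow> (e, f) \<notin> parcs (line_graph G)"
      have "\<forall>e\<in>S. \<exists>x. x \<in> e \<inter> X t" using S(1) by (auto simp: Y_def)
      then obtain g where g: "\<And>e. e \<in> S \<Longrightarrow> g e \<in> e \<inter> X t" by metis
      have "inj_on g S"
      proof (rule inj_onI, rule ccontr)
        fix e f
        assume "e \<in> S" "f \<in> S" "g e = g f" "e \<noteq> f"
        then show False using S g[of e] g[of f] by (auto simp: Y_def)
      qed
      then have "card S \<le> card (X t)" using g finX by (intro card_inj_on_le[of g]) auto
      then show "card S \<le> Suc (treewidth G)" using T(2)[OF t] by linarith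
    qed
  qed
qed

subsection \<open>Havens force large sim-width and tree-independence number\<close>

lemma havenD:
  assumes "haven c V A \<beta>" "S \<subseteq> V" "card S \<le> c"
  shows "\<beta> S \<subseteq> V - S" "linked A (\<beta> S)" "\<exists>u\<in>\<beta> S. \<exists>v\<in>\<beta> S. (u, v) \<in> A"
    "\<And>S'. S' \<subseteq> V \<Longrightarrow> S \<subseteq> S' \<Longrightarrow> \<beta> S' \<subseteq> \<beta> S"
  using assms unfolding haven_def by blast+

lemma haven_edge:
  assumes "haven c (pverts G) (parcs G) \<beta>" "S \<subseteq> pverts G" "card S \<le> c"
  obtains e where "e \<in> uedges G" "e \<subseteq> \<beta> S"
proof -
  obtain u v where "u \<in> \<beta> S" "v \<in> \<beta> S" "(u, v) \<in> parcs G" using havenD(3)[OF assms] by blast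
  then show ?thesis using that[of "{u, v}"] by (auto simp: uedges_def)
qed

text \<open>Connectedness of \<open>C\<close> carries over to its edges: \<open>Q w\<close> says
  that all edges inside \<open>C\<close> at \<open>w\<close> satisfy \<open>P\<close>, and this
  passes along an arc because the arc itself is an edge at both of its ends.\<close>

lemma linked_edge_induct:
  assumes "linked (parcs G) C" "e \<in> uedges G" "e \<subseteq> C" "f \<in> uedges G" "f \<subseteq> C" "P e"
    and step: "\<And>e f. e \<in> uedges G \<Longrightarrow> f \<in> uedges G \<Longrightarrow> e \<subseteq> C \<Longrightarrow> f \<subseteq> C \<Longrightarrow> e \<inter> f \<noteq> {} \<Longrightarrow> P e \<Longrightarrow> P f"
  shows "P f"
proof -
  define Q where "Q w \<longleftrightarrow> (\<forall>f\<in>uedges G. f \<subseteq> C \<longrightarrow> w \<in> f \<longrightarrow> P f)" for w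
  obtain u v where uv: "e = {u, v}" using assms(2) by (rule uedgesE)
  obtain x y where xy: "f = {x, y}" using assms(4) by (rule uedgesE)
  have "Q u" unfolding Q_def using step[OF assms(2) _ assms(3)] assms(6) uv by blast
  have "Q x"
  proof (rule linked_step[OF assms(1), of u x Q])
    fix w w'
    assume w: "w \<in> C" "w' \<in> C" "(w, w') \<in> parcs G" "Q w"
    then have ww': "{w, w'} \<in> uedges G" "{w, w'} \<subseteq> C" by (auto simp: uedges_def)
    then have "P {w, w'}" using w(4) by (auto simp: Q_def)
    then show "Q w'" unfolding Q_def using step[OF ww'(1) _ ww'(2)] by blast
  qed (use assms uv xy \<open>Q u\<close> in auto)
  then show ?thesis using assms(4,5) xy unfolding Q_def by blast
qed

text \<open>
  If every node of a tree points to the neighbour on whose side the haven lies, then two adjacent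
  nodes point to each other, and the edges of \<open>\<beta> S\<close>, for \<open>S\<close> the union of their separators, lie on
  both sides.
\<close>

lemma haven_orientation:
  assumes haven: "haven c (pverts G) (parcs G) \<beta>" and "2 * d \<le> c" and T: "ltree T E"
    and orient: "\<And>t. t \<in> T \<Longrightarrow> \<exists>s S. (t, s) \<in> E \<and> S \<subseteq> pverts G \<and> card S \<le> d \<and>
      (\<forall>e\<in>uedges G. e \<subseteq> \<beta> S \<longrightarrow> e \<in> D s t)"
    and disj: "\<And>s t. (s, t) \<in> E \<Longrightarrow> D s t \<inter> D t s = {}"
  shows False
proof -
  obtain f S where fS: "\<And>t. t \<in> T \<Longrightarrow> (t, f t) \<in> E \<and> S t \<subseteq> pverts G \<and> card (S t) \<le> d \<and>
      (\<forall>e\<in>uedges G. e \<subseteq> \<beta> (S t) \<longrightarrow> e \<in> D (f t) t)"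
    using orient by metis
  then obtain t where t: "t \<in> T" "f (f t) = t" using ltree_two_cycle[OF T, of f] by blast
  have s: "f t \<in> T" using fS[OF t(1)] ltree_wf(2)[OF T] by blast
  let ?S = "S t \<union> S (f t)"
  have S: "?S \<subseteq> pverts G" using fS t s by blast
  have "card ?S \<le> card (S t) + card (S (f t))" by (rule card_Un_le)
  also have "\<dots> \<le> c" using fS[OF t(1)] fS[OF s] assms(2) by linarith
  finally have card: "card ?S \<le> c" .
  obtain e where e: "e \<in> uedges G" "e \<subseteq> \<beta> ?S" using haven_edge[OF haven S card] by blast
  have "\<beta> ?S \<subseteq> \<beta> (S r)" if "r \<in> T" "S r \<subseteq> ?S" for r
    by (rule havenD(4)[OF haven _ _ S that(2)]) (use fS[OF that(1)] assms(2) in auto)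
  then have "\<beta> ?S \<subseteq> \<beta> (S t)" "\<beta> ?S \<subseteq> \<beta> (S (f t))" using t(1) s by auto
  then have "e \<in> D (f t) t" "e \<in> D t (f t)" using e fS[OF t(1)] fS[OF s] t(2) by auto
  then show False using disj[of t "f t"] fS[OF t(1)] by blast
qed

text \<open>
  An induced matching of \<open>L(G)\<close> across a cut of \<open>E(G)\<close> consists of disjoint two-edge paths with
  one edge on each side; deleting the vertices of a maximum one leaves every vertex with edges of
  one side only.
\<close>

lemma cutsim_separator:
  assumes G: "pair_graph G"
  obtains S where "S \<subseteq> pverts G" "card S \<le> 3 * cutsim (line_graph G) X"
    "\<And>e f. e \<in> uedges G \<Longrightarrow> f \<in> uedges G \<Longrightarrow> e \<inter> S = {} \<Longrightarrow> f \<inter> S = {} \<Longrightarrow> e \<inter> f \<noteq> {} \<Longrightarrow>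
       e \<in> X \<Longrightarrow> f \<in> X"
proof -
  let ?L = "line_graph G"
  note L = pair_graph_line_graph[OF G]
  obtain M where M: "induced_matching ?L M" "M \<subseteq> uedges (cut_graph ?L X)" "card M = cutsim ?L X"
    using cutsim_attained[OF L] by metis
  \<comment> \<open>A member of \<open>M\<close> is an edge of \<open>L(G)\<close>, that is, two
    intersecting edges of \<open>G\<close>; its union therefore has at most three vertices.\<close>
  define S where "S = (\<Union>m\<in>M. \<Union>m)"
  have finM: "finite M"
    using M(2) uedges_cut_graph_subset finite_uedges[OF L] by (meson finite_subset)
  have m: "\<Union>m \<subseteq> pverts G \<and> card (\<Union>m) \<le> 3" if "m \<in> M" for m
  proof -
    have "m \<in> uedges (cut_graph ?L X)" using that M(2) by blast
    then obtain e f where ef: "m = {e, f}" "(e, f) \<in> parcs ?L"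
      unfolding uedges_cut_graph by blast
    then have *: "e \<in> uedges G" "f \<in> uedges G" "e \<inter> f \<noteq> {}" by auto
    note wf = uedges_wf[OF G *(1)] uedges_wf[OF G *(2)]
    have "card (e \<inter> f) \<noteq> 0" using * wf by simp
    moreover have "card (e \<union> f) + card (e \<inter> f) = card e + card f"
      using card_Un_Int[OF wf(2) wf(6)] by simp
    ultimately have "card (e \<union> f) \<le> 3" using wf by linarith
    then show ?thesis using ef wf by simp
  qed
  have "card S \<le> (\<Sum>m\<in>M. card (\<Union>m))" unfolding S_def by (rule card_UN_le[OF finM])
  also have "\<dots> \<le> (\<Sum>m\<in>M. 3)" using m by (intro sum_mono) blast
  finally have "card S \<le> 3 * cutsim ?L X" using M(3) by simp
  moreover have "S \<subseteq> pverts G" using m unfolding S_def by blast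
  moreover have "f \<in> X"
    if ef: "e \<in> uedges G" "f \<in> uedges G" "e \<inter> S = {}" "f \<inter> S = {}" "e \<inter> f \<noteq> {}" "e \<in> X" for e f
  proof (rule ccontr)
    assume "f \<notin> X"
    then have adj: "(e, f) \<in> parcs ?L" using ef by auto
    have sub: "x \<subseteq> S" if "x \<in> \<Union>M" for x using that by (auto simp: S_def)
    have new: "e \<notin> \<Union>M" "f \<notin> \<Union>M"
      using sub[of e] sub[of f] ef uedges_wf(4)[OF G] by blast+
    \<comment> \<open>Both \<open>e\<close> and \<open>f\<close> avoid \<open>S\<close>, so neither
      is adjacent in \<open>L(G)\<close> to an edge used by \<open>M\<close>. Adding the pair keeps
      the matching induced, against the maximality of \<open>M\<close>.\<close>
    have "induced_matching ?L (insert {e, f} M)"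
      unfolding induced_matching_def
    proof (intro conjI ballI)
      show "matching ?L (insert {e, f} M)"
        unfolding matching_def
      proof (intro conjI ballI impI)
        have "{e, f} \<in> uedges ?L" using adj by (auto simp: uedges_def)
        then show "insert {e, f} M \<subseteq> uedges ?L"
          using M(1) by (simp add: induced_matching_def matching_def)
        fix a b
        assume "a \<in> insert {e, f} M" "b \<in> insert {e, f} M" "a \<noteq> b"
        moreover have "a \<inter> b = {}" if "a \<in> M" "b \<in> M" "a \<noteq> b"
          using M(1) that by (auto simp: induced_matching_def matching_def)
        ultimately show "a \<inter> b = {}" using new by auto
      qed
      fix a
      assume a: "a \<in> parcs ?L"
      obtain u v where uv: "a = (u, v)" by (cases a)
      have "{u, v} \<in> insert {e, f} M" if "u \<in> \<Union>(insert {e, f} M)" "v \<in> \<Union>(insert {e, f} M)"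
      proof (cases "u \<in> \<Union>M \<and> v \<in> \<Union>M")
        case True
        then show ?thesis using M(1) a unfolding induced_matching_def uv by blast
      next
        case False
        have "u \<inter> v \<noteq> {}" "u \<noteq> v" using a uv by auto
        then have "u \<in> {e, f} \<and> v \<in> {e, f}"
          using that False sub[of u] sub[of v] ef(3,4) by auto
        then show ?thesis using \<open>u \<noteq> v\<close> by auto
      qed
      then show "case a of (u, v) \<Rightarrow> u \<in> \<Union>(insert {e, f} M) \<and> v \<in> \<Union>(insert {e, f} M) \<longrightarrow>
          {u, v} \<in> insert {e, f} M" by (simp add: uv)
    qed
    moreover have "insert {e, f} M \<subseteq> uedges (cut_graph ?L X)"
      using M(2) adj ef(6) \<open>f \<notin> X\<close> by (auto simp: uedges_cut_graph)
    ultimately have "card (insert {e, f} M) \<le> cutsim ?L X" by (rule cutsim_ge[OF L])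
    moreover have "{e, f} \<notin> M" using new by blast
    ultimately show False using M(3) finM by simp
  qed
  ultimately show ?thesis using that by blast
qed

text \<open>At a node \<open>t\<close> the separators of its at most three arcs, each of size at
  most \<open>3 * k\<close>, and the two ends of an edge placed at \<open>t\<close> form a set of
  size at most \<open>9 * k + 2\<close>. A haven edge avoiding this set lies beyond some neighbour
  \<open>s\<close>, and by connectedness all edges of \<open>\<beta> (S s t)\<close> lie there
  too.\<close>

lemma haven_sim_width:
  assumes G: "pair_graph G" and haven: "haven (9 * k + 2) (pverts G) (parcs G) \<beta>"
    and bd: "branch_decomposition (line_graph G) T \<delta>"
    and le: "\<And>a. a \<in> parcs T \<Longrightarrow> cutsim (line_graph G) (edge_side (line_graph G) T \<delta> a) \<le> k"
  shows False
proof -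
  let ?L = "line_graph G" and ?c = "9 * k + 2"
  have T: "ltree (pverts T) (parcs T)" and deg: "\<And>t. t \<in> pverts T \<Longrightarrow> card {s. (t, s) \<in> parcs T} \<le> 3"
    and bij: "bij_betw \<delta> (uedges G) (leaves T)"
    using bd by (auto simp: branch_decomposition_def utree_iff_ltree out_degree_eq)
  have leaf: "\<delta> e \<in> pverts T" if "e \<in> uedges G" for e
    using bij that by (auto simp: bij_betw_def leaves_def)
  have "\<exists>S. S \<subseteq> pverts G \<and> card S \<le> 3 * k \<and>
    (\<forall>e f. e \<in> uedges G \<longrightarrow> f \<in> uedges G \<longrightarrow> e \<inter> S = {} \<longrightarrow> f \<inter> S = {} \<longrightarrow> e \<inter> f \<noteq> {} \<longrightarrow>
       e \<in> edge_side ?L T \<delta> (s, t) \<longrightarrow> f \<in> edge_side ?L T \<delta> (s, t))" if "(s, t) \<in> parcs T" for s t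
  proof -
    obtain S where "S \<subseteq> pverts G" "card S \<le> 3 * cutsim ?L (edge_side ?L T \<delta> (s, t))"
      "\<And>e f. e \<in> uedges G \<Longrightarrow> f \<in> uedges G \<Longrightarrow> e \<inter> S = {} \<Longrightarrow> f \<inter> S = {} \<Longrightarrow> e \<inter> f \<noteq> {} \<Longrightarrow>
         e \<in> edge_side ?L T \<delta> (s, t) \<Longrightarrow> f \<in> edge_side ?L T \<delta> (s, t)"
      using cutsim_separator[OF G] by metis
    then show ?thesis using le[OF that] by (intro exI[of _ S]) auto
  qed
  then obtain S where S: "\<And>s t. (s, t) \<in> parcs T \<Longrightarrow> S s t \<subseteq> pverts G \<and> card (S s t) \<le> 3 * k \<and>
    (\<forall>e f. e \<in> uedges G \<longrightarrow> f \<in> uedges G \<longrightarrow> e \<inter> S s t = {} \<longrightarrow> f \<inter> S s t = {} \<longrightarrow> e \<inter> f \<noteq> {} \<longrightarrow>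
       e \<in> edge_side ?L T \<delta> (s, t) \<longrightarrow> f \<in> edge_side ?L T \<delta> (s, t))"
    by metis
  show False
  proof (rule haven_orientation[OF haven _ T, where d = "3 * k" and D = "\<lambda>s t. edge_side ?L T \<delta> (s, t)"])
    show "edge_side ?L T \<delta> (s, t) \<inter> edge_side ?L T \<delta> (t, s) = {}" if "(s, t) \<in> parcs T" for s t
      using ltree_sides_disjoint[OF T that] by (auto simp: edge_side_def insert_commute)
  next
    fix t
    assume t: "t \<in> pverts T"
    let ?N = "{s. (t, s) \<in> parcs T}"
    define S\<^sub>0 where "S\<^sub>0 = (\<Union>s\<in>?N. S s t)"
    \<comment> \<open>Blocking the ends of an edge placed at \<open>t\<close> forces the haven edge
      to a different leaf, so that it determines a direction at \<open>t\<close>.\<close>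
    define B where "B = \<Union>{e \<in> uedges G. \<delta> e = t}"
    have arc: "(s, t) \<in> parcs T" if "s \<in> ?N" for s
      using that symD[OF ltree_wf(3)[OF T]] by blast
    have finN: "finite ?N"
      using ltree_wf(1,2)[OF T] by (auto intro: finite_subset[of _ "pverts T"])
    have "card S\<^sub>0 \<le> (\<Sum>s\<in>?N. card (S s t))" unfolding S\<^sub>0_def by (rule card_UN_le[OF finN])
    also have "\<dots> \<le> (\<Sum>s\<in>?N. 3 * k)" using S arc by (intro sum_mono) blast
    also have "\<dots> \<le> 9 * k" using deg[OF t] mult_right_mono[of "card ?N" 3 "3 * k"] by simp
    finally have cS: "card S\<^sub>0 \<le> 9 * k" .
    have "card B \<le> 2 \<and> B \<subseteq> pverts G"
    proof (cases "\<exists>e\<in>uedges G. \<delta> e = t")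
      case True
      then obtain e where e: "e \<in> uedges G" "\<delta> e = t" by blast
      then have "B = e" using bij by (auto simp: B_def bij_betw_def dest: inj_onD)
      then show ?thesis using uedges_wf[OF G e(1)] by simp
    next
      case False
      then have "B = {}" by (auto simp: B_def)
      then show ?thesis by simp
    qed
    moreover have "S\<^sub>0 \<subseteq> pverts G" using S arc unfolding S\<^sub>0_def by blast
    moreover have "card (S\<^sub>0 \<union> B) \<le> card S\<^sub>0 + card B" by (rule card_Un_le)
    ultimately have S': "S\<^sub>0 \<union> B \<subseteq> pverts G" "card (S\<^sub>0 \<union> B) \<le> ?c" using cS by auto
    obtain e where e: "e \<in> uedges G" "e \<subseteq> \<beta> (S\<^sub>0 \<union> B)" using haven_edge[OF haven S'] by blast
    have "e \<inter> B = {}" using havenD(1)[OF haven S'] e(2) by blast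
    then have "\<delta> e \<noteq> t" using e(1) uedges_wf(4)[OF G e(1)] by (auto simp: B_def)
    then obtain s where s: "(t, s) \<in> parcs T" "(s, \<delta> e) \<in> (parcs T - {(s, t), (t, s)})\<^sup>*"
      using ltree_step_towards[OF T t leaf[OF e(1)]] by metis
    have st: "(s, t) \<in> parcs T" using arc s(1) by blast
    have e_side: "e \<in> edge_side ?L T \<delta> (s, t)" using e(1) s(2) by (simp add: edge_side_def)
    have Sst: "S s t \<subseteq> pverts G" "card (S s t) \<le> 3 * k" "card (S s t) \<le> ?c" using S[OF st] by auto
    \<comment> \<open>Monotonicity passes to the separator of the chosen arc alone. Its bound
      \<open>3 * k\<close> leaves room for the union of two such sets in the haven.\<close>
    have "\<beta> (S\<^sub>0 \<union> B) \<subseteq> \<beta> (S s t)"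
      using s(1) by (intro havenD(4)[OF haven Sst(1,3) S'(1)]) (auto simp: S\<^sub>0_def)
    then have e_in: "e \<subseteq> \<beta> (S s t)" using e(2) by blast
    have "f \<in> edge_side ?L T \<delta> (s, t)" if f: "f \<in> uedges G" "f \<subseteq> \<beta> (S s t)" for f
    proof (rule linked_edge_induct[OF havenD(2)[OF haven Sst(1,3)] e(1) e_in f,
          where P = "\<lambda>f. f \<in> edge_side ?L T \<delta> (s, t)"])
      fix x y
      assume "x \<in> uedges G" "y \<in> uedges G" "x \<subseteq> \<beta> (S s t)" "y \<subseteq> \<beta> (S s t)" "x \<inter> y \<noteq> {}"
        "x \<in> edge_side ?L T \<delta> (s, t)"
      moreover from this have "x \<inter> S s t = {}" "y \<inter> S s t = {}"
        using havenD(1)[OF haven Sst(1,3)] by blast+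
      ultimately show "y \<in> edge_side ?L T \<delta> (s, t)" using S[OF st] by blast
    qed (rule e_side)
    then show "\<exists>s S. (t, s) \<in> parcs T \<and> S \<subseteq> pverts G \<and> card S \<le> 3 * k \<and>
        (\<forall>e\<in>uedges G. e \<subseteq> \<beta> S \<longrightarrow> e \<in> edge_side ?L T \<delta> (s, t))"
      using s(1) Sst by blast
  qed simp
qed

text \<open>A maximum independent set of a bag consists of at most \<open>k\<close> edges whose at
  most \<open>2 * k\<close> ends meet every edge in the bag. Once these are blocked, no haven edge
  occurs in the bag, so all of them have their bags beyond the same neighbour. Two nodes pointing at
  each other block \<open>4 * k\<close> vertices.\<close>

lemma haven_tree_independence_number:
  assumes G: "pair_graph G" and haven: "haven c (pverts G) (parcs G) \<beta>" and c: "4 * k \<le> c"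
  shows "k < tree_independence_number (line_graph G)"
proof (rule ccontr)
  let ?L = "line_graph G"
  assume "\<not> ?thesis"
  then obtain T X where td: "tree_decomposition ?L T X"
    and ind: "\<And>t. t \<in> pverts T \<Longrightarrow> independence_number (with_proj ?L \<restriction> X t) \<le> k"
    using tree_independence_number_attained[OF pair_graph_line_graph[OF G]]
    by (metis not_less order_trans)
  note td' = td[unfolded tree_decomposition_iff]
  have T: "ltree (pverts T) (parcs T)" using td' by blast
  have Xsub: "X t \<subseteq> uedges G" if "t \<in> pverts T" for t using td' that by auto
  have bag: "\<exists>t\<in>pverts T. e \<in> X t" if "e \<in> uedges G" for e using td' that by auto
  \<comment> \<open>The analogue of \<open>edge_side\<close> for bags instead of leaves: an edge
    with bags on both sides of the tree arc belongs to neither set.\<close>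
  define D where
    "D s t = {e \<in> uedges G. \<forall>r\<in>pverts T. e \<in> X r \<longrightarrow> (s, r) \<in> (parcs T - {(s, t), (t, s)})\<^sup>*}" for s t
  show False
  proof (rule haven_orientation[OF haven _ T, where d = "2 * k" and D = D])
    show "D s t \<inter> D t s = {}" if "(s, t) \<in> parcs T" for s t
    proof (rule ccontr)
      assume "D s t \<inter> D t s \<noteq> {}"
      then obtain e where e: "e \<in> D s t" "e \<in> D t s" by blast
      then have "e \<in> uedges G" by (simp add: D_def)
      then obtain r where "r \<in> pverts T" "e \<in> X r" using bag by blast
      then show False using e ltree_sides_disjoint[OF T that, of r] by (auto simp: D_def insert_commute)
    qed
  next
    fix t
    assume t: "t \<in> pverts T"
    have finX: "finite (X t)" using Xsub[OF t] finite_uedges[OF G] finite_subset by blast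
    obtain I where I: "I \<subseteq> X t" "\<And>e f. e \<in> I \<Longrightarrow> f \<in> I \<Longrightarrow> (e, f) \<notin> parcs ?L"
      "card I = independence_number (with_proj ?L \<restriction> X t)"
      "\<And>I'. I' \<subseteq> X t \<Longrightarrow> (\<And>e f. e \<in> I' \<Longrightarrow> f \<in> I' \<Longrightarrow> (e, f) \<notin> parcs ?L) \<Longrightarrow> card I' \<le> card I"
      using independence_number_attained[OF finX, of ?L] by blast
    have finI: "finite I" using I(1) finX finite_subset by blast
    let ?S = "\<Union>I"
    have IE: "e \<in> uedges G" if "e \<in> I" for e using that I(1) Xsub[OF t] by blast
    have "card ?S \<le> (\<Sum>e\<in>I. card e)" using card_UN_le[OF finI, of "\<lambda>e. e"] by simp
    also have "\<dots> = (\<Sum>e\<in>I. 2)" using IE uedges_wf(3)[OF G] by (intro sum.cong) auto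
    also have "\<dots> \<le> 2 * k" using I(3) ind[OF t] by simp
    finally have cS: "card ?S \<le> 2 * k" "card ?S \<le> c" using c by auto
    have S: "?S \<subseteq> pverts G" using IE uedges_wf(1)[OF G] by blast
    \<comment> \<open>An edge of the bag missing all these ends could be added to the maximum
      independent set.\<close>
    have cover: "e \<inter> ?S \<noteq> {}" if e: "e \<in> X t" for e
    proof
      assume disj: "e \<inter> ?S = {}"
      have "e \<noteq> {}" using e Xsub[OF t] uedges_wf(4)[OF G] by blast
      then have "e \<notin> I" using disj by blast
      moreover have "card (insert e I) \<le> card I"
        using I(1,2) e disj by (intro I(4)) auto
      ultimately show False using finI by simp
    qed
    note hav = havenD[OF haven S cS(2)]
    obtain e where e: "e \<in> uedges G" "e \<subseteq> \<beta> ?S" using haven_edge[OF haven S cS(2)] by blast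
    have avoid: "f \<notin> X t" if "f \<subseteq> \<beta> ?S" for f
      using cover[of f] hav(1) that by blast
    obtain r where r: "r \<in> pverts T" "e \<in> X r" using bag[OF e(1)] by blast
    then have "r \<noteq> t" using avoid[OF e(2)] by blast
    then obtain s where s: "(t, s) \<in> parcs T" "(s, r) \<in> (parcs T - {(s, t), (t, s)})\<^sup>*"
      using ltree_step_towards[OF T t r(1)] by metis
    \<comment> \<open>The nodes of \<open>f\<close> form a subtree that misses \<open>t\<close>, so
      one of them beyond \<open>s\<close> puts all of them there.\<close>
    have spread: "f \<in> D s t"
      if f: "f \<in> uedges G" "f \<subseteq> \<beta> ?S"
        and r: "r \<in> pverts T" "f \<in> X r" "(s, r) \<in> (parcs T - {(s, t), (t, s)})\<^sup>*" for f r
    proof -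
      have lnk: "linked (parcs T) {r \<in> pverts T. f \<in> X r}" using td' f(1) by auto
      have "(s, r') \<in> (parcs T - {(s, t), (t, s)})\<^sup>*" if r': "r' \<in> pverts T" "f \<in> X r'" for r'
      proof (rule linked_step[OF lnk, of r r' "\<lambda>r. (s, r) \<in> (parcs T - {(s, t), (t, s)})\<^sup>*"])
        fix u v
        assume uv: "u \<in> {r \<in> pverts T. f \<in> X r}" "v \<in> {r \<in> pverts T. f \<in> X r}" "(u, v) \<in> parcs T"
          "(s, u) \<in> (parcs T - {(s, t), (t, s)})\<^sup>*"
        then have "u \<noteq> t" "v \<noteq> t" using avoid[OF f(2)] by auto
        then show "(s, v) \<in> (parcs T - {(s, t), (t, s)})\<^sup>*"
          using uv by (auto intro: rtrancl_into_rtrancl)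
      qed (use r r' in auto)
      then show ?thesis using f by (auto simp: D_def)
    qed
    have "f \<in> D s t" if f: "f \<in> uedges G" "f \<subseteq> \<beta> ?S" for f
    proof (rule linked_edge_induct[OF hav(2) e f, where P = "\<lambda>f. f \<in> D s t"])
      show "e \<in> D s t" using spread e r s(2) by blast
      fix x y
      assume xy: "x \<in> uedges G" "y \<in> uedges G" "x \<subseteq> \<beta> ?S" "y \<subseteq> \<beta> ?S" "x \<inter> y \<noteq> {}" "x \<in> D s t"
      have "\<exists>r\<in>pverts T. x \<in> X r \<and> y \<in> X r"
      proof (cases "x = y")
        case True
        then show ?thesis using bag[OF xy(1)] by simp
      next
        case False
        then have "(x, y) \<in> parcs ?L" using xy by auto
        then show ?thesis using td' by fast
      qed
      then obtain r where "r \<in> pverts T" "x \<in> X r" "y \<in> X r" by blast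
      then show "y \<in> D s t" using spread[OF xy(2,4)] xy(6) by (auto simp: D_def)
    qed
    then show "\<exists>s S. (t, s) \<in> parcs T \<and> S \<subseteq> pverts G \<and> card S \<le> 2 * k \<and>
        (\<forall>e\<in>uedges G. e \<subseteq> \<beta> S \<longrightarrow> e \<in> D s t)"
      using s(1) S cS(1) by blast
  qed (use c in simp)
qed

section \<open>Linear bounds on treewidth\<close>

lemma treewidth_le_tree_independence_number:
  assumes "pair_graph G"
  shows "treewidth G \<le> 12 * tree_independence_number (line_graph G) + 4"
proof -
  let ?k = "tree_independence_number (line_graph G)"
  \<comment> \<open>The order is \<open>4 * ?k + 1\<close> because
    \<open>treewidth_le_if_no_haven\<close> wants it positive; the bound becomes
    \<open>3 * (4 * ?k + 1) + 1\<close>.\<close>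
  have False if "haven (4 * ?k + 1) (pverts G) (parcs G) \<beta>" for \<beta>
    using haven_tree_independence_number[OF assms that, of ?k] by simp
  then have "\<nexists>\<beta>. haven (4 * ?k + 1) (pverts G) (parcs G) \<beta>" by blast
  from treewidth_le_if_no_haven[OF assms this] show ?thesis by simp
qed

lemma treewidth_le_sim_width:
  assumes G: "pair_graph G" and bd: "1 < card (uedges G) \<Longrightarrow> branch_decomposition (line_graph G) T \<delta>"
  shows "treewidth G \<le> 27 * sim_width (line_graph G) + 7"
proof -
  let ?k = "sim_width (line_graph G)"
  have False if haven: "haven (9 * ?k + 2) (pverts G) (parcs G) \<beta>" for \<beta>
  proof (cases "1 < card (uedges G)")
    case True
    then have "1 < card (pverts (line_graph G))" by simp
    then obtain T \<delta> where "branch_decomposition (line_graph G) T \<delta>"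
      "\<And>a. a \<in> parcs T \<Longrightarrow> cutsim (line_graph G) (edge_side (line_graph G) T \<delta> a) \<le> ?k"
      unfolding sim_width_def using cut_width_attained[OF bd[OF True]] by metis
    then show False using haven_sim_width[OF G haven] by blast
  next
    case False
    \<comment> \<open>With at most one edge no decomposition is supplied. But a haven gives one edge
      in \<open>\<beta> {}\<close> and a second one disjoint from it, because the two ends of the
      first fit into the order \<open>9 * ?k + 2\<close>.\<close>
    obtain e where e: "e \<in> uedges G" using haven_edge[OF haven, of "{}"] by auto
    note wf = uedges_wf[OF G e]
    obtain f where f: "f \<in> uedges G" "f \<subseteq> \<beta> e" using haven_edge[OF haven, of e] wf by auto
    have "f \<inter> e = {}" using havenD(1)[OF haven wf(1)] wf(3) f(2) by auto
    then have "e \<noteq> f" using wf(4) by blast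
    then show False
      using False e f(1) finite_uedges[OF G] card_le_Suc0_iff_eq by (metis One_nat_def not_less)
  qed
  then have "\<nexists>\<beta>. haven (9 * ?k + 2) (pverts G) (parcs G) \<beta>" by blast
  from treewidth_le_if_no_haven[OF G this] show ?thesis by simp
qed

subsection \<open>Clique-width and module trees\<close>

definition nb :: "'a pair_pre_digraph \<Rightarrow> 'a set \<Rightarrow> 'a \<Rightarrow> 'a set" where
  "nb H U u = parcs H `` {u} - U"

text \<open>A bound on the number of distinct rows of the adjacency matrix between \<open>U\<close>
  and its complement.\<close>

definition few :: "nat \<Rightarrow> 'a pair_pre_digraph \<Rightarrow> 'a set \<Rightarrow> bool" where
  "few k H U \<longleftrightarrow> card (nb H U ` U) \<le> k"

text \<open>A label-free form of clique-width expressions: the labels are the outside neighbourhoods.\<close>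

inductive modtree :: "nat \<Rightarrow> 'a pair_pre_digraph \<Rightarrow> 'a set \<Rightarrow> bool" for k H where
  single: "few k H {v} \<Longrightarrow> modtree k H {v}"
| split: "modtree k H U\<^sub>1 \<Longrightarrow> modtree k H U\<^sub>2 \<Longrightarrow> U\<^sub>1 \<inter> U\<^sub>2 = {} \<Longrightarrow> few k H (U\<^sub>1 \<union> U\<^sub>2) \<Longrightarrow>
     modtree k H (U\<^sub>1 \<union> U\<^sub>2)"

lemma modtree_wf:
  assumes "modtree k H U"
  shows "finite U" "U \<noteq> {}" "few k H U" "0 < k"
proof -
  have "finite U \<and> U \<noteq> {} \<and> few k H U" using assms by induction auto
  then show *: "finite U" "U \<noteq> {}" "few k H U" by blast+
  then have "card (nb H U ` U) \<noteq> 0" by simp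
  then show "0 < k" using *(3) by (auto simp: few_def)
qed

lemma few_if_labelling:
  assumes "\<And>u v. u \<in> U \<Longrightarrow> v \<in> U \<Longrightarrow> l u = l v \<Longrightarrow> nb H U u = nb H U v"
    and "l ` U \<subseteq> L" "finite L" "card L \<le> k"
  shows "few k H U"
proof -
  define g where "g i = nb H U (inv_into U l i)" for i
  have "nb H U u = g (l u)" if "u \<in> U" for u
    unfolding g_def using that by (intro assms(1)) (auto simp: inv_into_into f_inv_into_f)
  then have "nb H U ` U \<subseteq> g ` L" using assms(2) by auto
  then have "card (nb H U ` U) \<le> card (g ` L)" using assms(3) by (intro card_mono) auto
  also have "\<dots> \<le> card L" using assms(3) by (rule card_image_le)
  finally show ?thesis using assms(4) by (simp add: few_def)
qed

lemma cw_constructible_wf: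
  assumes "cw_constructible k G l"
  shows "parcs G \<subseteq> pverts G \<times> pverts G" "\<And>v. v \<in> pverts G \<Longrightarrow> l v < k"
proof -
  have "parcs G \<subseteq> pverts G \<times> pverts G \<and> (\<forall>v\<in>pverts G. l v < k)"
    using assms by induction auto
  then show "parcs G \<subseteq> pverts G \<times> pverts G" "\<And>v. v \<in> pverts G \<Longrightarrow> l v < k" by blast+
qed

text \<open>The relation \<open>R\<close> on labels records the joins that are still to be performed on \<open>G\<close> within \<open>H\<close>.\<close>

lemma cw_constructible_imp_modtree_host:
  assumes "cw_constructible k G l"
    and "\<And>u w. u \<in> pverts G \<Longrightarrow> w \<in> pverts G \<Longrightarrow> u \<noteq> w \<Longrightarrow>
      (u, w) \<in> parcs H \<longleftrightarrow> (u, w) \<in> parcs G \<or> R (l u) (l w)"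
    and "\<And>u v. u \<in> pverts G \<Longrightarrow> v \<in> pverts G \<Longrightarrow> l u = l v \<Longrightarrow>
      nb H (pverts G) u = nb H (pverts G) v"
  shows "modtree k H (pverts G)"
  using assms
proof (induction arbitrary: R rule: cw_constructible.induct)
  case (create i v)
  then have "few k H {v}" by (intro few_if_labelling[of _ "\<lambda>_. i" _ "{..<k}"]) auto
  then show ?case by (simp add: modtree.single)
next
  case (disjoint_union G l H' m)
  let ?lab = "\<lambda>v. if v \<in> pverts G then l v else m v"
  note wf = cw_constructible_wf[OF disjoint_union.hyps(1)] cw_constructible_wf[OF disjoint_union.hyps(2)]
  note host = disjoint_union.prems(1)[simplified] and nbs = disjoint_union.prems(2)[simplified]
  have m: "?lab v = m v" if "v \<in> pverts H'" for v using that disjoint_union.hyps(3) by auto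
  \<comment> \<open>Arcs between the two parts come from joins still to be performed and so depend
    on labels alone. Equally labelled vertices of one part therefore agree on the other
    part.\<close>
  have cross: "(u, w) \<in> parcs H \<longleftrightarrow> R (?lab u) (?lab w)"
    if "u \<in> pverts G \<and> w \<in> pverts H' \<or> u \<in> pverts H' \<and> w \<in> pverts G" for u w
  proof -
    have "u \<noteq> w" "(u, w) \<notin> parcs G" "(u, w) \<notin> parcs H'" "u \<in> pverts G \<or> u \<in> pverts H'"
      "w \<in> pverts G \<or> w \<in> pverts H'"
      using that wf(1,3) disjoint_union.hyps(3) by blast+
    then show ?thesis using host[of u w] by simp
  qed
  have "modtree k H (pverts G)"
  proof (rule disjoint_union.IH(1)[where R = R])
    show "(u, w) \<in> parcs H \<longleftrightarrow> (u, w) \<in> parcs G \<or> R (l u) (l w)"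
      if "u \<in> pverts G" "w \<in> pverts G" "u \<noteq> w" for u w
      using host[of u w] that wf disjoint_union.hyps(3) by auto
    show "nb H (pverts G) u = nb H (pverts G) v"
      if "u \<in> pverts G" "v \<in> pverts G" "l u = l v" for u v
    proof (rule set_eqI)
      fix w
      show "w \<in> nb H (pverts G) u \<longleftrightarrow> w \<in> nb H (pverts G) v"
      proof (cases "w \<in> pverts H'")
        case True
        then show ?thesis using that cross[of u w] cross[of v w] by (auto simp: nb_def)
      next
        case False
        then show ?thesis using nbs[of u v] that by (auto simp: nb_def)
      qed
    qed
  qed
  moreover have "modtree k H (pverts H')"
  proof (rule disjoint_union.IH(2)[where R = R])
    show "(u, w) \<in> parcs H \<longleftrightarrow> (u, w) \<in> parcs H' \<or> R (m u) (m w)"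
      if "u \<in> pverts H'" "w \<in> pverts H'" "u \<noteq> w" for u w
      using host[of u w] that m wf disjoint_union.hyps(3) by auto
    show "nb H (pverts H') u = nb H (pverts H') v"
      if "u \<in> pverts H'" "v \<in> pverts H'" "m u = m v" for u v
    proof (rule set_eqI)
      fix w
      show "w \<in> nb H (pverts H') u \<longleftrightarrow> w \<in> nb H (pverts H') v"
      proof (cases "w \<in> pverts G")
        case True
        then show ?thesis using that cross[of u w] cross[of v w] m by (auto simp: nb_def)
      next
        case False
        then show ?thesis using nbs[of u v] that m by (auto simp: nb_def)
      qed
    qed
  qed
  moreover have "few k H (pverts G \<union> pverts H')"
  proof (rule few_if_labelling[of _ ?lab _ "{..<k}"])
    show "?lab ` (pverts G \<union> pverts H') \<subseteq> {..<k}" using wf by auto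
    fix u v
    assume "u \<in> pverts G \<union> pverts H'" "v \<in> pverts G \<union> pverts H'" "?lab u = ?lab v"
    then show "nb H (pverts G \<union> pverts H') u = nb H (pverts G \<union> pverts H') v"
      using disjoint_union.prems(2)[of u v] by simp
  qed auto
  ultimately show ?case
    using modtree.split[of k H "pverts G" "pverts H'"] disjoint_union.hyps(3) by simp
next
  case (join G l i j)
  have "modtree k H (pverts G)"
  proof (rule join.IH[where R = "\<lambda>a b. R a b \<or> a = i \<and> b = j \<or> a = j \<and> b = i"])
    fix u w
    assume "u \<in> pverts G" "w \<in> pverts G" "u \<noteq> w"
    then show "(u, w) \<in> parcs H \<longleftrightarrow>
        (u, w) \<in> parcs G \<or> (R (l u) (l w) \<or> l u = i \<and> l w = j \<or> l u = j \<and> l w = i)"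
      using join.prems(1)[of u w] by auto
  next
    fix u v
    assume "u \<in> pverts G" "v \<in> pverts G" "l u = l v"
    then show "nb H (pverts G) u = nb H (pverts G) v" using join.prems(2)[of u v] by simp
  qed
  then show ?case by simp
next
  case (relabel G l i j)
  show ?case
  \<comment> \<open>Before the relabelling, pending joins are read through it.\<close>
  proof (rule relabel.IH[where R = "\<lambda>a b. R (if a = i then j else a) (if b = i then j else b)"])
    fix u v
    assume "u \<in> pverts G" "v \<in> pverts G" "l u = l v"
    then show "nb H (pverts G) u = nb H (pverts G) v" using relabel.prems(2)[of u v] by simp
  qed (rule relabel.prems(1))
qed

lemma cw_constructible_imp_modtree:
  assumes "cw_constructible k G l"
  shows "modtree k G (pverts G)"
proof (rule cw_constructible_imp_modtree_host[OF assms, where R = "\<lambda>_ _. False"])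
  show "nb G (pverts G) u = nb G (pverts G) v" for u v
    using cw_constructible_wf(1)[OF assms] by (auto simp: nb_def)
qed simp

section \<open>Clique-width expressions from module trees\<close>

lemma cw_relabel_many:
  assumes "cw_constructible k G l" "finite I" "\<And>i. i \<in> I \<Longrightarrow> i < k \<and> h i < k \<and> h i \<notin> I"
  shows "cw_constructible k G (\<lambda>v. if l v \<in> I then h (l v) else l v)"
  using assms(2,3)
proof (induction I rule: finite_induct)
  case empty
  then show ?case using assms(1) by simp
next
  case (insert i I)
  let ?l = "\<lambda>v. if l v \<in> I then h (l v) else l v"
  \<comment> \<open>No target \<open>h i\<close> lies in the set of labels to be replaced, so
    relabelling one label at a time never moves a vertex twice.\<close>
  have "cw_constructible k G (\<lambda>v. if ?l v = i then h i else ?l v)"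
    using insert by (intro cw_constructible.relabel insert.IH) auto
  moreover have "(\<lambda>v. if ?l v = i then h i else ?l v) =
      (\<lambda>v. if l v \<in> insert i I then h (l v) else l v)"
    using insert.prems by (auto simp: fun_eq_iff)
  ultimately show ?case by simp
qed

lemma cw_join_many:
  assumes "cw_constructible k G l" "finite P" "\<And>i j. (i, j) \<in> P \<Longrightarrow> i < k \<and> j < k \<and> i \<noteq> j"
  shows "cw_constructible k \<lparr>pverts = pverts G, parcs = parcs G \<union>
    {(u, v). u \<in> pverts G \<and> v \<in> pverts G \<and> ((l u, l v) \<in> P \<or> (l v, l u) \<in> P)}\<rparr> l"
  using assms(2,3)
proof (induction P rule: finite_induct)
  case empty
  then show ?case using assms(1) by (cases G) simp
next
  case (insert p P)
  obtain i j where p: "p = (i, j)" by (cases p)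
  let ?J = "\<lambda>P. {(u, v). u \<in> pverts G \<and> v \<in> pverts G \<and> ((l u, l v) \<in> P \<or> (l v, l u) \<in> P)}"
  have "cw_constructible k \<lparr>pverts = pverts G, parcs = parcs G \<union> ?J P \<union>
      {(u, v). u \<in> pverts G \<and> v \<in> pverts G \<and> (l u = i \<and> l v = j \<or> l u = j \<and> l v = i)}\<rparr> l"
    using cw_constructible.join[OF insert.IH, of i j] insert.prems p by auto
  moreover have "?J P \<union> {(u, v). u \<in> pverts G \<and> v \<in> pverts G \<and>
      (l u = i \<and> l v = j \<or> l u = j \<and> l v = i)} = ?J (insert p P)"
    using p by auto
  ultimately show ?case by (simp add: Un_assoc)
qed

lemma few_label:
  assumes "few k H U" "finite U"
  obtains f where "\<And>u. u \<in> U \<Longrightarrow> f u < k"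
    "\<And>u v. u \<in> U \<Longrightarrow> v \<in> U \<Longrightarrow> f u = f v \<longleftrightarrow> nb H U u = nb H U v"
proof -
  obtain g where g: "inj_on g (nb H U ` U)" "g ` nb H U ` U \<subseteq> {..<k}"
    using card_le_inj[of "nb H U ` U" "{..<k}"] assms by (auto simp: few_def)
  show ?thesis
  proof (rule that[of "\<lambda>u. g (nb H U u)"])
    show "g (nb H U u) < k" if "u \<in> U" for u using g(2) that by auto
    show "g (nb H U u) = g (nb H U v) \<longleftrightarrow> nb H U u = nb H U v" if "u \<in> U" "v \<in> U" for u v
      using g(1) that by (auto dest: inj_onD)
  qed
qed

text \<open>Three blocks of \<open>k\<close> labels suffice. The classes of the two halves occupy
  the first two blocks, so the halves can be joined class by class; the prescribed labels are
  written into the third block, where they cannot collide, and then moved down to the first.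
  Allowing any prescribed \<open>l\<close> lets the induction hypothesis deliver class labels for
  the halves.\<close>

lemma modtree_imp_cw_constructible:
  assumes "modtree k H U" "sym (parcs H)" "\<And>u. (u, u) \<notin> parcs H"
    and "\<And>u. u \<in> U \<Longrightarrow> l u < k"
    and "\<And>u v. u \<in> U \<Longrightarrow> v \<in> U \<Longrightarrow> nb H U u = nb H U v \<Longrightarrow> l u = l v"
  shows "\<exists>l'. cw_constructible (3 * k) \<lparr>pverts = U, parcs = parcs H \<inter> U \<times> U\<rparr> l' \<and> (\<forall>u\<in>U. l' u = l u)"
  using assms(1,4,5)
proof (induction arbitrary: l rule: modtree.induct)
  case (single v)
  have "cw_constructible (3 * k) \<lparr>pverts = {v}, parcs = {}\<rparr> (\<lambda>_. l v)"
    using single.prems(1)[of v] by (intro cw_constructible.create) auto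
  moreover have "parcs H \<inter> {v} \<times> {v} = {}" using assms(3) by auto
  ultimately show ?case by (intro exI[of _ "\<lambda>_. l v"]) simp
next
  case (split U\<^sub>1 U\<^sub>2)
  note wf1 = modtree_wf[OF split.hyps(1)] and wf2 = modtree_wf[OF split.hyps(2)]
  obtain f\<^sub>1 where f1: "\<And>u. u \<in> U\<^sub>1 \<Longrightarrow> f\<^sub>1 u < k"
    "\<And>u v. u \<in> U\<^sub>1 \<Longrightarrow> v \<in> U\<^sub>1 \<Longrightarrow> f\<^sub>1 u = f\<^sub>1 v \<longleftrightarrow> nb H U\<^sub>1 u = nb H U\<^sub>1 v"
    using few_label[OF wf1(3,1)] by blast
  obtain f\<^sub>2 where f2: "\<And>u. u \<in> U\<^sub>2 \<Longrightarrow> f\<^sub>2 u < k"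
    "\<And>u v. u \<in> U\<^sub>2 \<Longrightarrow> v \<in> U\<^sub>2 \<Longrightarrow> f\<^sub>2 u = f\<^sub>2 v \<longleftrightarrow> nb H U\<^sub>2 u = nb H U\<^sub>2 v"
    using few_label[OF wf2(3,1)] by blast
  obtain l\<^sub>1 where l1: "cw_constructible (3 * k) \<lparr>pverts = U\<^sub>1, parcs = parcs H \<inter> U\<^sub>1 \<times> U\<^sub>1\<rparr> l\<^sub>1"
    "\<And>u. u \<in> U\<^sub>1 \<Longrightarrow> l\<^sub>1 u = f\<^sub>1 u"
    using split.IH(1)[of f\<^sub>1, OF f1(1) f1(2)[THEN iffD2]] by blast
  obtain l\<^sub>2 where l2: "cw_constructible (3 * k) \<lparr>pverts = U\<^sub>2, parcs = parcs H \<inter> U\<^sub>2 \<times> U\<^sub>2\<rparr> l\<^sub>2"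
    "\<And>u. u \<in> U\<^sub>2 \<Longrightarrow> l\<^sub>2 u = f\<^sub>2 u"
    using split.IH(2)[of f\<^sub>2, OF f2(1) f2(2)[THEN iffD2]] by blast
  have shift: "cw_constructible (3 * k) \<lparr>pverts = U\<^sub>2, parcs = parcs H \<inter> U\<^sub>2 \<times> U\<^sub>2\<rparr>
      (\<lambda>v. if l\<^sub>2 v \<in> {..<k} then k + l\<^sub>2 v else l\<^sub>2 v)"
    by (rule cw_relabel_many[OF l2(1)]) auto
  define lab where
    "lab v = (if v \<in> U\<^sub>1 then l\<^sub>1 v else if l\<^sub>2 v \<in> {..<k} then k + l\<^sub>2 v else l\<^sub>2 v)" for v
  let ?U = "U\<^sub>1 \<union> U\<^sub>2"
  have lab1: "lab u = f\<^sub>1 u" if "u \<in> U\<^sub>1" for u using that l1(2) by (simp add: lab_def)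
  have lab2: "lab u = k + f\<^sub>2 u" if "u \<in> U\<^sub>2" for u
    using that l2(2) f2(1)[OF that] split.hyps(3) by (auto simp: lab_def)
  let ?G0 = "\<lparr>pverts = ?U, parcs = parcs H \<inter> U\<^sub>1 \<times> U\<^sub>1 \<union> parcs H \<inter> U\<^sub>2 \<times> U\<^sub>2\<rparr>"
  have c0: "cw_constructible (3 * k) ?G0 lab"
    using cw_constructible.disjoint_union[OF l1(1) shift] split.hyps(3)
    by (simp add: lab_def[abs_def])
  define P where "P = {(lab u, lab w) |u w. u \<in> U\<^sub>1 \<and> w \<in> U\<^sub>2 \<and> (u, w) \<in> parcs H}"
  have P: "i < k \<and> k \<le> j \<and> j < 2 * k" if "(i, j) \<in> P" for i j
    using that f1(1) f2(1) lab1 lab2 by (auto simp: P_def)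
  then have finP: "finite P" by (intro finite_subset[of P "{..<k} \<times> {..<2 * k}"]) auto
  have joined: "cw_constructible (3 * k) \<lparr>pverts = pverts ?G0, parcs = parcs ?G0 \<union>
    {(u, v). u \<in> pverts ?G0 \<and> v \<in> pverts ?G0 \<and> ((lab u, lab v) \<in> P \<or> (lab v, lab u) \<in> P)}\<rparr> lab"
    by (rule cw_join_many[OF c0 finP]) (use P in fastforce)
  \<comment> \<open>Two classes with one arc between them are completely joined in \<open>H\<close>:
    exchange one end at a time for a vertex with the same outside neighbourhood.\<close>
  have cross: "u \<in> U\<^sub>1 \<and> w \<in> U\<^sub>2 \<and> (u, w) \<in> parcs H"
    if uw: "u \<in> ?U" "w \<in> ?U" "(lab u, lab w) \<in> P" for u w
  proof -
    have "lab u < k" "k \<le> lab w" using P[OF uw(3)] by auto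
    then have uw': "u \<in> U\<^sub>1" "w \<in> U\<^sub>2" using uw lab1 lab2 f1(1) by fastforce+
    obtain u' w' where u'w': "u' \<in> U\<^sub>1" "w' \<in> U\<^sub>2" "(u', w') \<in> parcs H" "lab u = lab u'" "lab w = lab w'"
      using uw(3) by (auto simp: P_def)
    then have "nb H U\<^sub>1 u = nb H U\<^sub>1 u'" "nb H U\<^sub>2 w = nb H U\<^sub>2 w'"
      using uw' lab1 lab2 f1(2) f2(2) by auto
    moreover have "w' \<in> nb H U\<^sub>1 u'" using u'w' split.hyps(3) by (auto simp: nb_def)
    ultimately have "(u, w') \<in> parcs H" by (auto simp: nb_def)
    then have "u \<in> nb H U\<^sub>2 w'" using uw' split.hyps(3) symD[OF assms(2)] by (auto simp: nb_def)
    then have "(w, u) \<in> parcs H" using \<open>nb H U\<^sub>2 w = nb H U\<^sub>2 w'\<close> by (auto simp: nb_def)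
    then show ?thesis using uw' symD[OF assms(2)] by blast
  qed
  then have "parcs ?G0 \<union> {(u, v). u \<in> ?U \<and> v \<in> ?U \<and> ((lab u, lab v) \<in> P \<or> (lab v, lab u) \<in> P)}
      = parcs H \<inter> ?U \<times> ?U" (is "?L = ?R")
  proof (intro equalityI subrelI)
    fix u v
    assume uv: "(u, v) \<in> ?L"
    show "(u, v) \<in> ?R"
    proof (cases "(u, v) \<in> parcs ?G0")
      case False
      then have "u \<in> ?U" "v \<in> ?U" "(lab u, lab v) \<in> P \<or> (lab v, lab u) \<in> P" using uv by auto
      then show ?thesis using cross[of u v] cross[of v u] symD[OF assms(2), of v u] by blast
    qed auto
  next
    fix u v
    assume uv: "(u, v) \<in> ?R"
    then have "(v, u) \<in> parcs H" using symD[OF assms(2)] by blast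
    then have "(lab u, lab v) \<in> P" if "u \<in> U\<^sub>1" "v \<in> U\<^sub>2"
      using uv that by (auto simp: P_def)
    moreover have "(lab v, lab u) \<in> P" if "v \<in> U\<^sub>1" "u \<in> U\<^sub>2"
      using \<open>(v, u) \<in> parcs H\<close> that by (auto simp: P_def)
    ultimately show "(u, v) \<in> ?L" using uv by auto
  qed
  with joined have joined: "cw_constructible (3 * k) \<lparr>pverts = ?U, parcs = parcs H \<inter> ?U \<times> ?U\<rparr> lab"
    by simp
  \<comment> \<open>\<open>inv_into\<close> picks a representative with the same label; by the
    hypothesis on \<open>l\<close> the choice does not matter.\<close>
  define g where "g i = 2 * k + l (inv_into ?U lab i)" for i
  have g: "g (lab u) = 2 * k + l u" if u: "u \<in> ?U" for u
  proof -
    let ?v = "inv_into ?U lab (lab u)"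
    have "lab u \<in> lab ` ?U" using u by blast
    then have v: "?v \<in> ?U" "lab ?v = lab u" by (rule inv_into_into, rule f_inv_into_f)
    have "u \<in> U\<^sub>1 \<and> ?v \<in> U\<^sub>1 \<or> u \<in> U\<^sub>2 \<and> ?v \<in> U\<^sub>2"
      using u v lab1 lab2 f1(1) by (metis UnE add_leD1 le_add1 not_less)
    then have "nb H U\<^sub>1 ?v = nb H U\<^sub>1 u \<or> nb H U\<^sub>2 ?v = nb H U\<^sub>2 u"
      using v(2) lab1 lab2 f1(2) f2(2) by fastforce
    then have "nb H ?U ?v = nb H ?U u" by (auto simp: nb_def)
    then show ?thesis using split.prems(2)[OF v(1) u] by (simp add: g_def)
  qed
  define I where "I = lab ` ?U"
  have I: "i < 2 * k \<and> 2 * k \<le> g i \<and> g i < 3 * k" if i: "i \<in> I" for i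
  proof -
    obtain u where u: "u \<in> ?U" "i = lab u" using i by (auto simp: I_def)
    then have "i < 2 * k" using lab1 lab2 f1(1) f2(1) by fastforce
    then show ?thesis using g[OF u(1)] split.prems(1)[OF u(1)] u(2) by auto
  qed
  have "finite I" using wf1(1) wf2(1) by (simp add: I_def)
  then have "cw_constructible (3 * k) \<lparr>pverts = ?U, parcs = parcs H \<inter> ?U \<times> ?U\<rparr>
      (\<lambda>v. if lab v \<in> I then g (lab v) else lab v)"
  proof (rule cw_relabel_many[OF joined])
    show "i < 3 * k \<and> g i < 3 * k \<and> g i \<notin> I" if "i \<in> I" for i
      using I[OF that] I[of "g i"] by linarith
  qed
  then have "cw_constructible (3 * k) \<lparr>pverts = ?U, parcs = parcs H \<inter> ?U \<times> ?U\<rparr>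
      (\<lambda>v. if (if lab v \<in> I then g (lab v) else lab v) \<in> {2 * k..<3 * k}
        then (if lab v \<in> I then g (lab v) else lab v) - 2 * k
        else (if lab v \<in> I then g (lab v) else lab v))" (is "cw_constructible _ _ ?l'")
    by (rule cw_relabel_many[where h = "\<lambda>i. i - 2 * k"]) (auto simp: wf1(4))
  moreover have "?l' u = l u" if u: "u \<in> ?U" for u
    using u I[of "lab u"] g[OF u] by (auto simp: I_def)
  ultimately show ?case by (intro exI[of _ ?l']) simp
qed

lemma clique_width_le_modtree:
  assumes "pair_graph H" "modtree k H (pverts H)"
  shows "\<exists>l. cw_constructible (3 * k) H l"
proof -
  note wf = pair_graph_wf[OF assms(1)]
  obtain l' where "cw_constructible (3 * k) \<lparr>pverts = pverts H, parcs = parcs H \<inter> pverts H \<times> pverts H\<rparr> l'"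
    using modtree_imp_cw_constructible[OF assms(2) wf(3,5), of "\<lambda>_. 0"] modtree_wf(4)[OF assms(2)]
    by auto
  then show ?thesis using wf(4) by (cases H) (auto simp: Int_absorb2)
qed

subsection \<open>Module trees of line graphs of bounded treewidth\<close>

text \<open>An edge of \<open>U\<close> meets edges outside \<open>U\<close> only in vertices of
  \<open>B\<close>, so its outside neighbourhood is determined by its trace on
  \<open>B\<close>.\<close>

lemma few_line_graph:
  assumes "U \<subseteq> uedges G" "finite B" "2 ^ card B \<le> k"
    and boundary: "\<And>e f. e \<in> U \<Longrightarrow> f \<in> uedges G - U \<Longrightarrow> e \<inter> f \<subseteq> B"
  shows "few k (line_graph G) U"
proof (rule few_if_labelling[of _ "\<lambda>e. e \<inter> B" _ "Pow B"])
  fix e e'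
  assume e: "e \<in> U" "e' \<in> U" "e \<inter> B = e' \<inter> B"
  have "e \<inter> f \<noteq> {} \<longleftrightarrow> e' \<inter> f \<noteq> {}" if "f \<in> uedges G - U" for f
    using boundary[OF e(1) that] boundary[OF e(2) that] e(3) by blast
  moreover have "nb (line_graph G) U x = {f \<in> uedges G - U. x \<inter> f \<noteq> {}}" if "x \<in> U" for x
    using that assms(1) by (auto simp: nb_def)
  ultimately show "nb (line_graph G) U e = nb (line_graph G) U e'" using e(1,2) by auto
qed (use assms in \<open>auto simp: card_Pow\<close>)

text \<open>A caterpillar: elements are split off one at a time, and every part that occurs is a
  subset of \<open>U\<close>.\<close>

lemma modtree_if_few:
  assumes "finite U" "U \<noteq> {}" "\<And>U'. U' \<subseteq> U \<Longrightarrow> U' \<noteq> {} \<Longrightarrow> few k H U'"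
  shows "modtree k H U"
  using assms
proof (induction U rule: finite_ne_induct)
  case (singleton x)
  then show ?case by (intro modtree.single) auto
next
  case (insert x U)
  have "modtree k H ({x} \<union> U)"
    using insert by (intro modtree.split modtree.single insert.IH) auto
  then show ?case by simp
qed

text \<open>Sending \<open>t\<close> to its only neighbour \<open>s\<close> turns walks in
  \<open>S\<close> into walks that avoid \<open>t\<close>; for this \<open>s\<close> has to belong
  to \<open>S\<close> whenever \<open>t\<close> does.\<close>

lemma linked_remove_leaf:
  assumes "linked (A \<union> {(s, t), (t, s)}) S" "A \<subseteq> V \<times> V" "t \<notin> V" "s \<in> V" "S - {t} \<noteq> {}"
  shows "linked A (S - {t})" "t \<in> S \<Longrightarrow> s \<in> S"
proof -
  let ?A = "A \<union> {(s, t), (t, s)}"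
  show s: "s \<in> S" if t: "t \<in> S"
  proof -
    obtain x where "x \<in> S" "x \<notin> {t}" using assms(5) by blast
    then obtain v where "v \<in> S - {t}" "(t, v) \<in> ?A"
      using linked_exit[OF assms(1) t, of "{t}" x] by (metis IntD2 insertI1 singletonD)
    then show ?thesis using assms(2,3) by auto
  qed
  define \<rho> where "\<rho> x = (if x = t then s else x)" for x
  show "linked A (S - {t})"
    unfolding linked_def
  proof (intro conjI ballI)
    fix x y
    assume xy: "x \<in> S - {t}" "y \<in> S - {t}"
    then have "(x, y) \<in> (?A \<inter> S \<times> S)\<^sup>*" using assms(1) by (auto simp: linked_def)
    then have "(\<rho> x, \<rho> y) \<in> (A \<inter> (S - {t}) \<times> (S - {t}))\<^sup>*"
      by (rule rtrancl_map_closed) (use assms(2-4) s in \<open>auto simp: \<rho>_def\<close>)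
    then show "(x, y) \<in> (A \<inter> (S - {t}) \<times> (S - {t}))\<^sup>*" using xy by (simp add: \<rho>_def)
  qed (rule assms(5))
qed

text \<open>
  The edges assigned to a leaf of the decomposition tree are merged into its neighbour, until all
  edges are assigned to one node.  At all times the edges at a node \<open>t\<close> meet other edges in \<open>X t\<close> only.
\<close>

lemma modtree_merge:
  assumes "ltree T E"
    and "\<And>t. t \<in> T \<Longrightarrow> finite (X t) \<and> 2 ^ card (X t) \<le> k"
    and "\<And>t. t \<in> T \<Longrightarrow> U t = {} \<or> modtree k (line_graph G) (U t)"
    and "\<And>s t e f. s \<in> T \<Longrightarrow> t \<in> T \<Longrightarrow> s \<noteq> t \<Longrightarrow> e \<in> U s \<Longrightarrow> f \<in> U t \<Longrightarrow>
      e \<noteq> f \<and> e \<inter> f \<subseteq> X s \<inter> X t"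
    and "(\<Union>t\<in>T. U t) = uedges G" "uedges G \<noteq> {}"
    and "\<And>v. v \<in> (\<Union>t\<in>T. X t) \<Longrightarrow> linked E {t \<in> T. v \<in> X t}"
  shows "modtree k (line_graph G) (uedges G)"
  using assms
proof (induction arbitrary: U rule: ltree.induct)
  case (single r)
  then show ?case by auto
next
  case (leaf V A s t)
  note wf = ltree_wf[OF leaf.hyps(1)]
  note bag = leaf.prems(1) and mod = leaf.prems(2) and meet = leaf.prems(3) and cover = leaf.prems(4)
  have st: "s \<noteq> t" "s \<in> insert t V" "t \<in> insert t V" using leaf.hyps by auto
  have lnk: "linked (A \<union> {(s, t), (t, s)}) {r \<in> insert t V. v \<in> X r}" if "r \<in> insert t V" "v \<in> X r" for v r
    using leaf.prems(6)[of v] that by blast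
  \<comment> \<open>A vertex of the removed bag that occurs in another bag is also in the bag of the
    neighbour. Hence after the merge the edges at \<open>s\<close> still meet the others in
    \<open>X s\<close> only.\<close>
  have Xs: "v \<in> X s" if v: "v \<in> X t" "v \<in> X r" "r \<in> V" for v r
  proof -
    have "{r \<in> insert t V. v \<in> X r} - {t} \<noteq> {}" using v leaf.hyps by auto
    from linked_remove_leaf(2)[OF lnk[OF st(3) v(1)] wf(2) leaf.hyps(3,2) this]
    show ?thesis using v by auto
  qed
  define U' where "U' = U(s := U s \<union> U t)"
  have U's: "U' s = U s \<union> U t" and U'r: "\<And>r. r \<noteq> s \<Longrightarrow> U' r = U r" by (auto simp: U'_def)
  have s_meet: "e \<noteq> f \<and> e \<inter> f \<subseteq> X s \<inter> X r"
    if r: "r \<in> V" "r \<noteq> s" and e: "e \<in> U' s" and f: "f \<in> U r" for e f r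
  proof (cases "e \<in> U s")
    case True
    then show ?thesis using meet[of s r e f] r f st by auto
  next
    case False
    then have "e \<in> U t" using e U's by blast
    then have "e \<noteq> f \<and> e \<inter> f \<subseteq> X t \<inter> X r" using meet[of t r e f] r f leaf.hyps by auto
    then show ?thesis using Xs r(1) by blast
  qed
  have few_s: "few k (line_graph G) (U' s)"
  proof (rule few_line_graph)
    show "U' s \<subseteq> uedges G" using cover st U's by auto
    show "finite (X s)" "2 ^ card (X s) \<le> k" using bag st(2) by auto
    fix e f
    assume ef: "e \<in> U' s" "f \<in> uedges G - U' s"
    then obtain r where "r \<in> insert t V" "f \<in> U r" using cover by blast
    then have "r \<in> V" "r \<noteq> s" "f \<in> U r" using ef(2) U's by auto
    then show "e \<inter> f \<subseteq> X s" using s_meet ef(1) by blast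
  qed
  show ?case
  proof (rule leaf.IH[of U'])
    show "finite (X r) \<and> 2 ^ card (X r) \<le> k" if "r \<in> V" for r using bag that by blast
    show "U' r = {} \<or> modtree k (line_graph G) (U' r)" if r: "r \<in> V" for r
    proof (cases "r = s")
      case True
      have "U s \<inter> U t = {}" using meet[OF st(2,3,1)] by blast
      then show ?thesis
        using mod[OF st(2)] mod[OF st(3)] few_s modtree.split[of k "line_graph G" "U s" "U t"]
        unfolding True U's by auto
    qed (use mod r U'r in auto)
    show "e \<noteq> f \<and> e \<inter> f \<subseteq> X p \<inter> X r"
      if "p \<in> V" "r \<in> V" "p \<noteq> r" "e \<in> U' p" "f \<in> U' r" for p r e f
    proof -
      consider "p = s" | "r = s" | "p \<noteq> s" "r \<noteq> s" by blast
      then show ?thesis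
      proof cases
        case 1
        then show ?thesis using s_meet[of r e f] that U'r by auto
      next
        case 2
        then show ?thesis using s_meet[of p f e] that U'r by auto
      next
        case 3
        then show ?thesis using meet[of p r e f] that U'r by auto
      qed
    qed
    show "(\<Union>r\<in>V. U' r) = uedges G"
    proof -
      have "(\<Union>r\<in>V. U' r) = (\<Union>r\<in>insert t V. U r)"
        using leaf.hyps(2,3) by (auto simp: U'_def split: if_splits)
      then show ?thesis using cover by simp
    qed
    show "linked A {r \<in> V. v \<in> X r}" if v: "v \<in> (\<Union>r\<in>V. X r)" for v
    proof -
      obtain r where r: "r \<in> V" "v \<in> X r" using v by blast
      have "{r \<in> insert t V. v \<in> X r} - {t} = {r \<in> V. v \<in> X r}" using leaf.hyps(3) by auto
      moreover from this have "{r \<in> insert t V. v \<in> X r} - {t} \<noteq> {}" using r by auto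
      ultimately show ?thesis
        using linked_remove_leaf(1)[OF lnk wf(2) leaf.hyps(3,2), of r v] r by auto
    qed
  qed (rule leaf.prems(5))
qed

text \<open>Each edge is assigned to one bag containing both its ends. The edges at one node meet
  all others inside that bag, so they form a caterpillar, and these are then merged along the
  tree.\<close>

lemma modtree_line_graph:
  assumes G: "pair_graph G" and "uedges G \<noteq> {}"
  shows "modtree (2 ^ Suc (treewidth G)) (line_graph G) (uedges G)"
proof -
  obtain T X where T: "tree_decomposition G T X"
    "\<And>t. t \<in> pverts T \<Longrightarrow> card (X t) \<le> Suc (treewidth G)"
    using treewidth_attained[OF G] by metis
  note td = T(1)[unfolded tree_decomposition_iff]
  have "\<exists>t\<in>pverts T. e \<subseteq> X t" if "e \<in> uedges G" for e
    using uedgesE[OF that] td by fastforce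
  then obtain \<tau> where \<tau>: "\<And>e. e \<in> uedges G \<Longrightarrow> \<tau> e \<in> pverts T \<and> e \<subseteq> X (\<tau> e)" by metis
  have X: "finite (X t) \<and> (2 :: nat) ^ card (X t) \<le> 2 ^ Suc (treewidth G)" if "t \<in> pverts T" for t
  proof
    show "finite (X t)" using td that pair_graph_wf(1)[OF G] by (auto intro: finite_subset)
    show "(2 :: nat) ^ card (X t) \<le> 2 ^ Suc (treewidth G)"
      using T(2)[OF that] by (intro power_increasing) auto
  qed
  define U where "U t = {e \<in> uedges G. \<tau> e = t}" for t
  show ?thesis
  proof (rule modtree_merge[where U = U and X = X and T = "pverts T" and E = "parcs T"])
    show "U t = {} \<or> modtree (2 ^ Suc (treewidth G)) (line_graph G) (U t)" if t: "t \<in> pverts T" for t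
    proof -
      have "few (2 ^ Suc (treewidth G)) (line_graph G) U'" if "U' \<subseteq> U t" for U'
      proof (rule few_line_graph[of _ _ "X t"])
        show "e \<inter> f \<subseteq> X t" if "e \<in> U'" for e f
          using that \<open>U' \<subseteq> U t\<close> \<tau>[of e] by (auto simp: U_def)
      qed (use that X[OF t] in \<open>auto simp: U_def\<close>)
      moreover have "finite (U t)" using finite_uedges[OF G] by (simp add: U_def)
      ultimately show ?thesis using modtree_if_few by blast
    qed
    show "e \<noteq> f \<and> e \<inter> f \<subseteq> X s \<inter> X t"
      if "s \<in> pverts T" "t \<in> pverts T" "s \<noteq> t" "e \<in> U s" "f \<in> U t" for s t e f
      using that \<tau>[of e] \<tau>[of f] by (auto simp: U_def)
  qed (use td X \<tau> assms(2) in \<open>auto simp: U_def\<close>)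
qed

subsection \<open>Branch decompositions from module trees\<close>

definition side :: "nat rel \<Rightarrow> nat \<Rightarrow> nat \<Rightarrow> nat set" where
  "side E s t = {x. (s, x) \<in> (E - {(s, t), (t, s)})\<^sup>*}"

lemma edge_side_eq: "edge_side G T \<delta> (s, t) = {v \<in> pverts G. \<delta> v \<in> side (parcs T) s t}"
  by (simp add: edge_side_def side_def)

lemma side_disjoint: "ltree V E \<Longrightarrow> (s, t) \<in> E \<Longrightarrow> side E s t \<inter> side E t s = {}"
  using ltree_sides_disjoint[of V E s t] by (auto simp: side_def insert_commute)

lemma side_cover:
  assumes "ltree V E" "(s, t) \<in> E" "x \<in> V"
  shows "x \<in> side E s t \<union> side E t s"
proof (rule linked_step[OF ltree_linked[OF assms(1)], of s x])
  show "s \<in> V" using ltree_wf(2)[OF assms(1)] assms(2) by blast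
  show "s \<in> side E s t \<union> side E t s" by (simp add: side_def)
  fix u v
  assume uv: "(u, v) \<in> E" "u \<in> side E s t \<union> side E t s"
  show "v \<in> side E s t \<union> side E t s"
  proof (cases "(u, v) \<in> {(s, t), (t, s)}")
    case True
    then show ?thesis by (auto simp: side_def)
  next
    case False
    then have "(u, v) \<in> E - {(s, t), (t, s)}" "(u, v) \<in> E - {(t, s), (s, t)}" using uv(1) by auto
    then show ?thesis using uv(2) by (auto simp: side_def intro: rtrancl_into_rtrancl)
  qed
qed (rule assms(3))

text \<open>A side that reached \<open>r\<^sub>1\<close> could step on to \<open>r\<close>. As it
  misses \<open>r\<close>, it stays away from \<open>r\<^sub>1\<close>, the only exit of the
  subtree, and is the same in the larger tree.\<close>

lemma side_extend:
  assumes "E\<^sub>1 \<subseteq> E" "E\<^sub>1 \<subseteq> V\<^sub>1 \<times> V\<^sub>1" "(r\<^sub>1, r) \<in> E" "r \<notin> V\<^sub>1"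
    and closed: "\<And>y z. (y, z) \<in> E \<Longrightarrow> y \<in> V\<^sub>1 \<Longrightarrow> y \<noteq> r\<^sub>1 \<Longrightarrow> (y, z) \<in> E\<^sub>1"
    and st: "(s, t) \<in> E\<^sub>1" "r \<notin> side E s t"
  shows "r\<^sub>1 \<notin> side E\<^sub>1 s t" "side E s t = side E\<^sub>1 s t" "side E\<^sub>1 s t \<subseteq> V\<^sub>1"
proof -
  have sub: "side E\<^sub>1 s t \<subseteq> side E s t"
    unfolding side_def using rtrancl_mono[of "E\<^sub>1 - {(s, t), (t, s)}" "E - {(s, t), (t, s)}"] assms(1)
    by blast
  have "(r\<^sub>1, r) \<in> E - {(s, t), (t, s)}" using assms(2-4) st(1) by auto
  then have r1: "r\<^sub>1 \<notin> side E s t"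
    using st(2) by (auto simp: side_def intro: rtrancl_into_rtrancl)
  then show "r\<^sub>1 \<notin> side E\<^sub>1 s t" using sub by blast
  have *: "x \<in> side E\<^sub>1 s t \<and> x \<in> V\<^sub>1" if x: "(s, x) \<in> (E - {(s, t), (t, s)})\<^sup>*" for x
    using x
  proof (induction rule: rtrancl_induct)
    case base
    then show ?case using st(1) assms(2) by (auto simp: side_def)
  next
    case (step y z)
    then have "y \<noteq> r\<^sub>1" using r1 by (auto simp: side_def)
    then have "(y, z) \<in> E\<^sub>1 - {(s, t), (t, s)}" using step closed by auto
    then show ?case using step assms(2) by (auto simp: side_def intro: rtrancl_into_rtrancl)
  qed
  then have "side E s t \<subseteq> side E\<^sub>1 s t" by (auto simp: side_def)
  then show "side E s t = side E\<^sub>1 s t" using sub by blast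
  show "side E\<^sub>1 s t \<subseteq> V\<^sub>1" using * sub by (auto simp: side_def)
qed

lemma side_attached:
  assumes "ltree V\<^sub>1 E\<^sub>1" "E\<^sub>1 \<subseteq> E" "r\<^sub>1 \<in> V\<^sub>1" "r \<notin> V\<^sub>1"
    and closed: "\<And>y z. (y, z) \<in> E \<Longrightarrow> y \<in> V\<^sub>1 \<Longrightarrow> (y, z) \<in> E\<^sub>1 \<or> (y, z) = (r\<^sub>1, r)"
  shows "side E r\<^sub>1 r = V\<^sub>1"
proof
  note wf = ltree_wf[OF assms(1)]
  show "side E r\<^sub>1 r \<subseteq> V\<^sub>1"
  proof
    fix x
    assume "x \<in> side E r\<^sub>1 r"
    then have "(r\<^sub>1, x) \<in> (E - {(r\<^sub>1, r), (r, r\<^sub>1)})\<^sup>*" by (simp add: side_def)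
    then show "x \<in> V\<^sub>1"
      by induction (use closed wf(2) assms(3) in auto)
  qed
  show "V\<^sub>1 \<subseteq> side E r\<^sub>1 r"
  proof
    fix x
    assume "x \<in> V\<^sub>1"
    then have "(r\<^sub>1, x) \<in> (E\<^sub>1 \<inter> V\<^sub>1 \<times> V\<^sub>1)\<^sup>*"
      using ltree_linked[OF assms(1)] assms(3) by (auto simp: linked_def)
    moreover have "E\<^sub>1 \<inter> V\<^sub>1 \<times> V\<^sub>1 \<subseteq> E - {(r\<^sub>1, r), (r, r\<^sub>1)}" using assms(2,4) by auto
    ultimately show "x \<in> side E r\<^sub>1 r" using rtrancl_mono by (auto simp: side_def)
  qed
qed

text \<open>A cubic tree with a pending arc at the root: the extra \<open>1\<close> in the degree
  count is the arc to a future parent. Only sides away from the root are bounded; the others are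
  complements of these.\<close>

definition rooted_bd ::
    "nat \<Rightarrow> 'a pair_pre_digraph \<Rightarrow> 'a set \<Rightarrow> nat set \<Rightarrow> nat rel \<Rightarrow> ('a \<Rightarrow> nat) \<Rightarrow> nat \<Rightarrow> bool" where
  "rooted_bd k H U T E \<delta> r \<longleftrightarrow> ltree T E \<and> r \<in> T \<and> inj_on \<delta> U \<and> \<delta> ` U \<subseteq> T \<and>
     (\<forall>t\<in>T. card {s. (t, s) \<in> E} + (if t = r then 1 else 0) = (if t \<in> \<delta> ` U then 1 else 3)) \<and>
     (\<forall>s t. (s, t) \<in> E \<longrightarrow> r \<notin> side E s t \<longrightarrow> few k H {v \<in> U. \<delta> v \<in> side E s t})"

text \<open>A new root takes up the pending arcs of both subtrees and has one of its own. The
  subtrees keep their cuts, and the arcs at the new root cut off exactly the two halves, which are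
  parts of the module tree.\<close>

lemma modtree_imp_rooted_bd:
  assumes "modtree k H U" "finite F"
  shows "\<exists>T E \<delta> r. T \<inter> F = {} \<and> rooted_bd k H U T E \<delta> r"
  using assms
proof (induction arbitrary: F rule: modtree.induct)
  case (single v)
  obtain r where "r \<notin> F" using ex_new_if_finite[OF infinite_UNIV_nat single.prems] by blast
  then show ?case
    by (intro exI[of _ "{r}"] exI[of _ "{}"] exI[of _ "\<lambda>_. r"] exI[of _ r])
      (auto simp: rooted_bd_def ltree.single)
next
  case (split U\<^sub>1 U\<^sub>2)
  obtain T\<^sub>1 E\<^sub>1 \<delta>\<^sub>1 r\<^sub>1 where T1: "T\<^sub>1 \<inter> F = {}" "rooted_bd k H U\<^sub>1 T\<^sub>1 E\<^sub>1 \<delta>\<^sub>1 r\<^sub>1"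
    using split.IH(1)[OF split.prems] by blast
  note 1 = T1(2)[unfolded rooted_bd_def]
  have tree1: "ltree T\<^sub>1 E\<^sub>1" and r1: "r\<^sub>1 \<in> T\<^sub>1" using 1 by blast+
  note wf1 = ltree_wf[OF tree1]
  have F1: "finite (F \<union> T\<^sub>1)" using split.prems wf1(1) by blast
  obtain T\<^sub>2 E\<^sub>2 \<delta>\<^sub>2 r\<^sub>2 where T2: "T\<^sub>2 \<inter> (F \<union> T\<^sub>1) = {}" "rooted_bd k H U\<^sub>2 T\<^sub>2 E\<^sub>2 \<delta>\<^sub>2 r\<^sub>2"
    using split.IH(2)[OF F1] by blast
  note 2 = T2(2)[unfolded rooted_bd_def]
  have tree2: "ltree T\<^sub>2 E\<^sub>2" and r2: "r\<^sub>2 \<in> T\<^sub>2" using 2 by blast+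
  note wf2 = ltree_wf[OF tree2]
  have "finite (F \<union> T\<^sub>1 \<union> T\<^sub>2)" using split.prems wf1(1) wf2(1) by blast
  then obtain r where r: "r \<notin> F" "r \<notin> T\<^sub>1" "r \<notin> T\<^sub>2"
    using ex_new_if_finite[OF infinite_UNIV_nat, of "F \<union> T\<^sub>1 \<union> T\<^sub>2"] by auto
  have T12: "T\<^sub>1 \<inter> T\<^sub>2 = {}" using T2(1) by blast
  define T where "T = insert r T\<^sub>1 \<union> T\<^sub>2"
  define E where "E = E\<^sub>1 \<union> {(r, r\<^sub>1), (r\<^sub>1, r)} \<union> E\<^sub>2 \<union> {(r, r\<^sub>2), (r\<^sub>2, r)}"
  define \<delta> where "\<delta> v = (if v \<in> U\<^sub>1 then \<delta>\<^sub>1 v else \<delta>\<^sub>2 v)" for v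
  have d1: "\<delta> v = \<delta>\<^sub>1 v" if "v \<in> U\<^sub>1" for v using that by (simp add: \<delta>_def)
  have d2: "\<delta> v = \<delta>\<^sub>2 v" if "v \<in> U\<^sub>2" for v using that split.hyps(3) by (auto simp: \<delta>_def)
  have img: "\<delta> ` (U\<^sub>1 \<union> U\<^sub>2) = \<delta>\<^sub>1 ` U\<^sub>1 \<union> \<delta>\<^sub>2 ` U\<^sub>2" using d1 d2 by force
  have dT: "\<delta>\<^sub>1 ` U\<^sub>1 \<subseteq> T\<^sub>1" "\<delta>\<^sub>2 ` U\<^sub>2 \<subseteq> T\<^sub>2" using 1 2 by blast+
  have loc1: "\<delta> v = \<delta>\<^sub>1 v \<and> \<delta> v \<in> T\<^sub>1 \<and> \<delta> v \<notin> T\<^sub>2" if "v \<in> U\<^sub>1" for v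
    using d1[OF that] dT(1) T12 that by auto
  have loc2: "\<delta> v = \<delta>\<^sub>2 v \<and> \<delta> v \<in> T\<^sub>2 \<and> \<delta> v \<notin> T\<^sub>1" if "v \<in> U\<^sub>2" for v
    using d2[OF that] dT(2) T12 that by auto
  have "ltree ({r} \<union> T\<^sub>1) ({} \<union> E\<^sub>1 \<union> {(r, r\<^sub>1), (r\<^sub>1, r)})"
    using r r1 by (intro ltree_join[OF tree1 ltree.single]) auto
  then have "ltree (insert r T\<^sub>1 \<union> T\<^sub>2) (({} \<union> E\<^sub>1 \<union> {(r, r\<^sub>1), (r\<^sub>1, r)}) \<union> E\<^sub>2 \<union> {(r, r\<^sub>2), (r\<^sub>2, r)})"
    using r r2 T12 by (intro ltree_join[OF tree2]) auto
  then have tree: "ltree T E" by (simp add: T_def E_def)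
  have N1: "{s. (t, s) \<in> E} = {s. (t, s) \<in> E\<^sub>1} \<union> (if t = r\<^sub>1 then {r} else {})" if "t \<in> T\<^sub>1" for t
    using that r wf2(2) T12 r2 by (auto simp: E_def)
  have N2: "{s. (t, s) \<in> E} = {s. (t, s) \<in> E\<^sub>2} \<union> (if t = r\<^sub>2 then {r} else {})" if "t \<in> T\<^sub>2" for t
    using that r wf1(2) T12 r1 by (auto simp: E_def)
  have Nr: "{s. (r, s) \<in> E} = {r\<^sub>1, r\<^sub>2}"
    using r wf1(2) wf2(2) r1 r2 by (auto simp: E_def)
  have fin1: "finite {s. (t, s) \<in> E\<^sub>1}" for t
    by (rule finite_subset[OF _ wf1(1)]) (use wf1(2) in auto)
  have fin2: "finite {s. (t, s) \<in> E\<^sub>2}" for t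
    by (rule finite_subset[OF _ wf2(1)]) (use wf2(2) in auto)
  have E: "E\<^sub>1 \<subseteq> E" "E\<^sub>2 \<subseteq> E" "(r\<^sub>1, r) \<in> E" "(r\<^sub>2, r) \<in> E" by (auto simp: E_def)
  have closed1: "(y, z) \<in> E\<^sub>1 \<or> (y, z) = (r\<^sub>1, r)" if "(y, z) \<in> E" "y \<in> T\<^sub>1" for y z
    using that(1) N1[OF that(2)] by (auto split: if_splits)
  have closed2: "(y, z) \<in> E\<^sub>2 \<or> (y, z) = (r\<^sub>2, r)" if "(y, z) \<in> E" "y \<in> T\<^sub>2" for y z
    using that(1) N2[OF that(2)] by (auto split: if_splits)
  have "card {s. (t, s) \<in> E} + (if t = r then 1 else 0) = (if t \<in> \<delta> ` (U\<^sub>1 \<union> U\<^sub>2) then 1 else 3)"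
    if t: "t \<in> T" for t
  proof -
    consider "t = r" | "t \<in> T\<^sub>1" "t \<noteq> r" | "t \<in> T\<^sub>2" "t \<noteq> r" using t r by (auto simp: T_def)
    then show ?thesis
    proof cases
      case t: 1
      have "r\<^sub>1 \<noteq> r\<^sub>2" using r1 r2 T12 by blast
      moreover have "r \<notin> \<delta> ` (U\<^sub>1 \<union> U\<^sub>2)" using img dT r by blast
      ultimately show ?thesis using t Nr by simp
    next
      case t: 2
      have "(r \<in> {s. (t, s) \<in> E\<^sub>1}) = False" using wf1(2) r by auto
      then have "card {s. (t, s) \<in> E} = card {s. (t, s) \<in> E\<^sub>1} + (if t = r\<^sub>1 then 1 else 0)"
        using N1[OF t(1)] fin1[of t] by (auto split: if_splits)
      moreover have "t \<in> \<delta> ` (U\<^sub>1 \<union> U\<^sub>2) \<longleftrightarrow> t \<in> \<delta>\<^sub>1 ` U\<^sub>1" using img dT T12 t by blast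
      ultimately show ?thesis using 1 t by auto
    next
      case t: 3
      have "(r \<in> {s. (t, s) \<in> E\<^sub>2}) = False" using wf2(2) r by auto
      then have "card {s. (t, s) \<in> E} = card {s. (t, s) \<in> E\<^sub>2} + (if t = r\<^sub>2 then 1 else 0)"
        using N2[OF t(1)] fin2[of t] by (auto split: if_splits)
      moreover have "t \<in> \<delta> ` (U\<^sub>1 \<union> U\<^sub>2) \<longleftrightarrow> t \<in> \<delta>\<^sub>2 ` U\<^sub>2" using img dT T12 t by blast
      ultimately show ?thesis using 2 t by auto
    qed
  qed
  moreover have "few k H {v \<in> U\<^sub>1 \<union> U\<^sub>2. \<delta> v \<in> side E s t}"
    if st: "(s, t) \<in> E" "r \<notin> side E s t" for s t
  proof -
    \<comment> \<open>The side contains \<open>s\<close> itself, so an arc whose side misses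
      \<open>r\<close> points towards the root.\<close>
    have "s \<noteq> r" using st(2) by (auto simp: side_def)
    then consider "(s, t) \<in> E\<^sub>1" | "(s, t) \<in> E\<^sub>2" | "(s, t) = (r\<^sub>1, r)" | "(s, t) = (r\<^sub>2, r)"
      using st(1) by (auto simp: E_def)
    then show ?thesis
    proof cases
      case a: 1
      have *: "r\<^sub>1 \<notin> side E\<^sub>1 s t" "side E s t = side E\<^sub>1 s t" "side E\<^sub>1 s t \<subseteq> T\<^sub>1"
        using side_extend[OF E(1) wf1(2) E(3) r(2) _ a st(2)] closed1 by blast+
      have "{v \<in> U\<^sub>1 \<union> U\<^sub>2. \<delta> v \<in> side E s t} = {v \<in> U\<^sub>1. \<delta>\<^sub>1 v \<in> side E\<^sub>1 s t}"
        using *(2,3) loc1 loc2 by fastforce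
      then show ?thesis using 1 a *(1) by simp
    next
      case a: 2
      have *: "r\<^sub>2 \<notin> side E\<^sub>2 s t" "side E s t = side E\<^sub>2 s t" "side E\<^sub>2 s t \<subseteq> T\<^sub>2"
        using side_extend[OF E(2) wf2(2) E(4) r(3) _ a st(2)] closed2 by blast+
      have "{v \<in> U\<^sub>1 \<union> U\<^sub>2. \<delta> v \<in> side E s t} = {v \<in> U\<^sub>2. \<delta>\<^sub>2 v \<in> side E\<^sub>2 s t}"
        using *(2,3) loc1 loc2 by fastforce
      then show ?thesis using 2 a *(1) by simp
    next
      case a: 3
      have "side E r\<^sub>1 r = T\<^sub>1"
        by (rule side_attached[OF tree1 E(1) r1 r(2) closed1])
      then have "{v \<in> U\<^sub>1 \<union> U\<^sub>2. \<delta> v \<in> side E s t} = U\<^sub>1"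
        using a loc1 loc2 by auto
      then show ?thesis using modtree_wf(3)[OF split.hyps(1)] by simp
    next
      case a: 4
      have "side E r\<^sub>2 r = T\<^sub>2"
        by (rule side_attached[OF tree2 E(2) r2 r(3) closed2])
      then have "{v \<in> U\<^sub>1 \<union> U\<^sub>2. \<delta> v \<in> side E s t} = U\<^sub>2"
        using a loc1 loc2 by auto
      then show ?thesis using modtree_wf(3)[OF split.hyps(2)] by simp
    qed
  qed
  moreover have "inj_on \<delta> (U\<^sub>1 \<union> U\<^sub>2)"
  proof -
    have "inj_on \<delta> U\<^sub>1" "inj_on \<delta> U\<^sub>2"
      using 1 2 d1 d2 by (auto simp: inj_on_def)
    moreover have "\<delta> ` U\<^sub>1 \<inter> \<delta> ` U\<^sub>2 = {}" using loc1 loc2 by force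
    ultimately show ?thesis by (auto simp: inj_on_Un)
  qed
  moreover have "\<delta> ` (U\<^sub>1 \<union> U\<^sub>2) \<subseteq> T" using img dT by (auto simp: T_def)
  moreover have "T \<inter> F = {}" using T1(1) T2(1) r(1) by (auto simp: T_def)
  moreover have "r \<in> T" by (simp add: T_def)
  ultimately show ?case
    using tree unfolding rooted_bd_def
    by (intro exI[of _ T] exI[of _ E] exI[of _ \<delta>] exI[of _ r]) blast
qed

text \<open>The ends in \<open>X\<close> of distinct matching edges have distinct outside
  neighbourhoods: if two agreed, one would be adjacent to the partner of the other, and the matching
  would not be induced in the cut.\<close>

lemma cutmim_le_few:
  assumes H: "pair_graph H" and "few k H X" "finite X"
  shows "cutmim H X \<le> k"
proof -
  let ?C = "cut_graph H X"
  have "card M \<le> k" if M: "induced_matching ?C M" for M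
  proof -
    have "\<exists>a b. m = {a, b} \<and> a \<in> X \<and> b \<notin> X \<and> (a, b) \<in> parcs H" if "m \<in> M" for m
    proof -
      have "m \<in> uedges ?C" using M that by (auto simp: induced_matching_def matching_def)
      then obtain u v where "m = {u, v}" "(u, v) \<in> parcs H" "(u \<in> X) \<noteq> (v \<in> X)"
        unfolding uedges_cut_graph by blast
      then show ?thesis using symD[OF pair_graph_wf(3)[OF H]] by (cases "u \<in> X") blast+
    qed
    then obtain a b where ab: "\<And>m. m \<in> M \<Longrightarrow> m = {a m, b m} \<and> a m \<in> X \<and> b m \<notin> X \<and> (a m, b m) \<in> parcs H"
      by metis
    have "inj_on (\<lambda>m. nb H X (a m)) M"
    proof (rule inj_onI, rule ccontr)
      fix m n
      assume mn: "m \<in> M" "n \<in> M" "nb H X (a m) = nb H X (a n)" "m \<noteq> n"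
      have "b n \<in> nb H X (a m)" unfolding mn(3) using ab[OF mn(2)] by (auto simp: nb_def)
      then have "(a m, b n) \<in> parcs ?C" using ab[OF mn(1)] by (auto simp: nb_def cut_graph_def)
      moreover have "a m \<in> \<Union>M" "b n \<in> \<Union>M" using ab mn(1,2) by (blast, metis UnionI insertI1 insertI2)
      ultimately have "{a m, b n} \<in> M" using M unfolding induced_matching_def by blast
      moreover have disj: "p \<inter> q = {}" if "p \<in> M" "q \<in> M" "p \<noteq> q" for p q
        using M that by (auto simp: induced_matching_def matching_def)
      ultimately have "{a m, b n} = m" "{a m, b n} = n"
        using ab[OF mn(1)] ab[OF mn(2)] mn(1,2) by blast+
      then show False using mn(4) by simp
    qed
    then have "card M \<le> card (nb H X ` X)"
      using ab assms(3) by (intro card_inj_on_le[of "\<lambda>m. nb H X (a m)"]) auto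
    then show ?thesis using assms(2) by (simp add: few_def)
  qed
  moreover have "finite {card M |M. induced_matching ?C M}"
    using induced_matching_cut_subset by (intro finite_matching_cards[OF H])
  moreover have "induced_matching ?C {}" by (simp add: induced_matching_def matching_def)
  then have "{card M |M. induced_matching ?C M} \<noteq> {}" by blast
  ultimately show ?thesis unfolding cutmim_def by (subst Max_le_iff) auto
qed

lemma cutmim_complement:
  assumes "pair_graph H"
  shows "cutmim H (pverts H - X) = cutmim H X"
proof -
  have "cut_graph H (pverts H - X) = cut_graph H X"
    using pair_graph_wf(4)[OF assms] by (auto simp: cut_graph_def)
  then show ?thesis by (simp add: cutmim_def)
qed

lemma modtree_imp_branch_decomposition:
  assumes H: "pair_graph H" and "modtree k H (pverts H)" and "1 < card (pverts H)"
  shows "\<exists>T \<delta>. branch_decomposition H T \<delta> \<and>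
    (\<forall>a\<in>parcs T. cutmim H (edge_side H T \<delta> a) \<le> k)"
proof -
  obtain T E \<delta> r where bd: "rooted_bd k H (pverts H) T E \<delta> r"
    using modtree_imp_rooted_bd[OF assms(2) finite.emptyI] by blast
  note bd' = bd[unfolded rooted_bd_def]
  have tree: "ltree T E" and r: "r \<in> T" and inj: "inj_on \<delta> (pverts H)" and img: "\<delta> ` pverts H \<subseteq> T"
    using bd' by blast+
  have deg: "card {s. (t, s) \<in> E} + (if t = r then 1 else 0) = (if t \<in> \<delta> ` pverts H then 1 else 3)"
    if "t \<in> T" for t
    using bd' that by blast
  have finN: "finite {s. (t, s) \<in> E}" for t
    by (rule finite_subset[OF _ ltree_wf(1)[OF tree]]) (use ltree_wf(2)[OF tree] in auto)
  \<comment> \<open>If a vertex were placed at the root, the pending arc would be its only one; but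
    with more than one vertex the root has a real neighbour.\<close>
  have r_inner: "r \<notin> \<delta> ` pverts H"
  proof
    assume "r \<in> \<delta> ` pverts H"
    then have "{s. (r, s) \<in> E} = {}" using deg[OF r] finN[of r] by simp
    moreover have "1 < card (\<delta> ` pverts H)" using assms(3) inj by (simp add: card_image)
    then obtain x where "x \<in> \<delta> ` pverts H" "x \<noteq> r"
      by (metis One_nat_def card_le_Suc0_iff_eq card.infinite less_nat_zero_code not_less)
    then have "\<exists>s. (r, s) \<in> E" using ltree_step_towards[OF tree r, of x] img by blast
    ultimately show False by blast
  qed
  let ?T = "\<lparr>pverts = T, parcs = E\<rparr>"
  \<comment> \<open>Without the pending arc the root has degree 2, so it is no leaf; a branch
    decomposition only requires degrees of at most 3.\<close>
  have deg': "card {s. (t, s) \<in> E} = (if t \<in> \<delta> ` pverts H then 1 else if t = r then 2 else 3)"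
    if "t \<in> T" for t
    using deg[OF that] r_inner by (auto split: if_splits)
  then have "leaves ?T = \<delta> ` pverts H"
    using img by (auto simp: leaves_def out_degree_eq split: if_splits)
  moreover have "out_degree (with_proj ?T) t \<le> 3" if "t \<in> T" for t
    using deg'[OF that] by (simp add: out_degree_eq)
  ultimately have "branch_decomposition H ?T \<delta>"
    using inj tree by (auto simp: branch_decomposition_def utree_iff_ltree bij_betw_def)
  moreover have "cutmim H (edge_side H ?T \<delta> (s, t)) \<le> k" if st: "(s, t) \<in> E" for s t
  proof -
    have small: "cutmim H (edge_side H ?T \<delta> (p, q)) \<le> k" if "(p, q) \<in> E" "r \<notin> side E p q" for p q
    proof (rule cutmim_le_few[OF H])
      show "few k H (edge_side H ?T \<delta> (p, q))" using bd' that by (simp add: edge_side_eq)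
      show "finite (edge_side H ?T \<delta> (p, q))" using pair_graph_wf(1)[OF H] by (simp add: edge_side_eq)
    qed
    \<comment> \<open>One of the two sides of an arc misses the root; the other is its complement
      and has the same \<open>cutmim\<close>.\<close>
    have ts: "(t, s) \<in> E" using symD[OF ltree_wf(3)[OF tree] st] .
    have "edge_side H ?T \<delta> (s, t) = pverts H - edge_side H ?T \<delta> (t, s)"
      using side_disjoint[OF tree st] side_cover[OF tree st] img by (auto simp: edge_side_eq)
    then have "cutmim H (edge_side H ?T \<delta> (s, t)) = cutmim H (edge_side H ?T \<delta> (t, s))"
      using cutmim_complement[OF H] by simp
    moreover have "r \<notin> side E s t \<or> r \<notin> side E t s" using side_disjoint[OF tree st] by blast
    ultimately show ?thesis using small[OF st] small[OF ts] by auto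
  qed
  ultimately show ?thesis by (intro exI[of _ ?T] exI[of _ \<delta>]) auto
qed

lemma mim_width_le_modtree:
  assumes H: "pair_graph H" and "modtree k H (pverts H)"
  shows "mim_width H \<le> k"
proof (cases "1 < card (pverts H)")
  case True
  obtain T \<delta> where "branch_decomposition H T \<delta>" "\<forall>a\<in>parcs T. cutmim H (edge_side H T \<delta> a) \<le> k"
    using modtree_imp_branch_decomposition[OF assms True] by blast
  moreover have "pverts H \<noteq> {}" using True by auto
  ultimately show ?thesis unfolding mim_width_def by (intro cut_width_le) auto
qed (simp add: mim_width_def cut_width_def)

subsection \<open>Contraction sequences from module trees\<close>

text \<open>On these pairs the trigraph is still a faithful copy of \<open>H\<close>: contracted
  vertices look to \<open>Y\<close> exactly like their representatives.\<close>

definition pure :: "'a pair_pre_digraph \<Rightarrow> 'a trigraph \<Rightarrow> 'a set \<Rightarrow> 'a set \<Rightarrow> bool" where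
  "pure H Q S Y \<longleftrightarrow> (\<forall>x\<in>S. \<forall>y\<in>Y. (x, y) \<notin> red Q \<and> (y, x) \<notin> red Q \<and>
     ((x, y) \<in> black Q \<longleftrightarrow> (x, y) \<in> parcs H) \<and> ((y, x) \<in> black Q \<longleftrightarrow> (y, x) \<in> parcs H))"

definition same_edges :: "'a trigraph \<Rightarrow> 'a trigraph \<Rightarrow> 'a set \<Rightarrow> bool" where
  "same_edges Q Q' Y \<longleftrightarrow> (\<forall>x\<in>Y. \<forall>y\<in>Y.
     ((x, y) \<in> black Q \<longleftrightarrow> (x, y) \<in> black Q') \<and> ((x, y) \<in> red Q \<longleftrightarrow> (x, y) \<in> red Q'))"

definition valid :: "nat \<Rightarrow> 'a trigraph \<Rightarrow> bool" where
  "valid d Q \<longleftrightarrow> finite (tverts Q) \<and> red Q \<subseteq> tverts Q \<times> tverts Q \<and> red_degree_le d Q"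

text \<open>The last clause stands for a contraction sequence from \<open>Q\<close> to
  \<open>Q'\<close>; as an implication it composes without any list of trigraphs.\<close>

definition reduces ::
    "nat \<Rightarrow> 'a pair_pre_digraph \<Rightarrow> 'a trigraph \<Rightarrow> 'a set \<Rightarrow> 'a set \<Rightarrow> 'a trigraph \<Rightarrow> bool" where
  "reduces d H Q S R Q' \<longleftrightarrow> R \<subseteq> S \<and> valid d Q' \<and> tverts Q' = tverts Q - S \<union> R \<and>
     pure H Q' R (tverts Q - S) \<and> same_edges Q Q' (tverts Q - S) \<and>
     (contractible d Q' \<longrightarrow> contractible d Q)"

lemma pure_mono: "pure H Q S Y \<Longrightarrow> S' \<subseteq> S \<Longrightarrow> Y' \<subseteq> Y \<Longrightarrow> pure H Q S' Y'"
  unfolding pure_def by blast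

lemma pure_same_edges:
  assumes "pure H Q S Y" "same_edges Q Q' Z" "S \<subseteq> Z" "Y \<subseteq> Z"
  shows "pure H Q' S Y"
  unfolding pure_def
proof (intro ballI)
  fix x y
  assume xy: "x \<in> S" "y \<in> Y"
  then have "x \<in> Z" "y \<in> Z" using assms(3,4) by blast+
  then have "(x, y) \<in> red Q' \<longleftrightarrow> (x, y) \<in> red Q" "(y, x) \<in> red Q' \<longleftrightarrow> (y, x) \<in> red Q"
    "(x, y) \<in> black Q' \<longleftrightarrow> (x, y) \<in> black Q" "(y, x) \<in> black Q' \<longleftrightarrow> (y, x) \<in> black Q"
    using assms(2) unfolding same_edges_def by blast+
  then show "(x, y) \<notin> red Q' \<and> (y, x) \<notin> red Q' \<and>
      ((x, y) \<in> black Q' \<longleftrightarrow> (x, y) \<in> parcs H) \<and> ((y, x) \<in> black Q' \<longleftrightarrow> (y, x) \<in> parcs H)"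
    using assms(1) xy unfolding pure_def by blast
qed

lemma pure_swap: "pure H Q S Y \<Longrightarrow> pure H Q Y S"
  unfolding pure_def by blast

lemma pure_Un: "pure H Q S Y \<Longrightarrow> pure H Q S' Y \<Longrightarrow> pure H Q (S \<union> S') Y"
  unfolding pure_def by blast

lemma same_edges_mono: "same_edges Q Q' Y \<Longrightarrow> Y' \<subseteq> Y \<Longrightarrow> same_edges Q Q' Y'"
  unfolding same_edges_def by blast

lemma same_edges_trans: "same_edges Q Q' Y \<Longrightarrow> same_edges Q' Q'' Y \<Longrightarrow> same_edges Q Q'' Y"
  unfolding same_edges_def by blast

lemma contract_simps:
  "tverts (contract Q u v) = tverts Q - {v}"
  "x \<noteq> u \<Longrightarrow> y \<noteq> u \<Longrightarrow> (x, y) \<in> black (contract Q u v) \<longleftrightarrow>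
     (x, y) \<in> black Q \<and> x \<in> tverts Q - {u, v} \<and> y \<in> tverts Q - {u, v}"
  "x \<noteq> u \<Longrightarrow> y \<noteq> u \<Longrightarrow> (x, y) \<in> red (contract Q u v) \<longleftrightarrow>
     (x, y) \<in> red Q \<and> x \<in> tverts Q - {u, v} \<and> y \<in> tverts Q - {u, v}"
  "(u, y) \<in> black (contract Q u v) \<longleftrightarrow>
     y \<in> tverts Q - {u, v} \<and> (u, y) \<in> black Q \<and> (v, y) \<in> black Q"
  "(y, u) \<in> black (contract Q u v) \<longleftrightarrow>
     y \<in> tverts Q - {u, v} \<and> (u, y) \<in> black Q \<and> (v, y) \<in> black Q"
  "(u, y) \<in> red (contract Q u v) \<longleftrightarrow> y \<in> tverts Q - {u, v} \<and>
     ((u, y) \<in> black Q \<union> red Q \<or> (v, y) \<in> black Q \<union> red Q) \<and>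
     \<not> ((u, y) \<in> black Q \<and> (v, y) \<in> black Q)"
  "(y, u) \<in> red (contract Q u v) \<longleftrightarrow> y \<in> tverts Q - {u, v} \<and>
     ((u, y) \<in> black Q \<union> red Q \<or> (v, y) \<in> black Q \<union> red Q) \<and>
     \<not> ((u, y) \<in> black Q \<and> (v, y) \<in> black Q)"
  unfolding contract_def Let_def by auto

text \<open>As \<open>u\<close> and \<open>v\<close> agree outside \<open>S\<close>, new red edges
  arise inside \<open>S\<close> only. The red neighbours of a vertex left in \<open>S\<close> lie
  among the at most \<open>d\<close> vertices of \<open>S - {v}\<close>, and no vertex outside gains
  a red neighbour.\<close>

lemma reduces_contract:
  assumes H: "sym (parcs H)" and valid: "valid d Q" and S: "S \<subseteq> tverts Q" "card S \<le> Suc d"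
    and pure: "pure H Q S (tverts Q - S)"
    and uv: "u \<in> S" "v \<in> S" "u \<noteq> v"
    and twins: "\<And>y. y \<in> tverts Q - S \<Longrightarrow> (u, y) \<in> parcs H \<longleftrightarrow> (v, y) \<in> parcs H"
  shows "reduces d H Q S (S - {v}) (contract Q u v)"
proof -
  let ?Q = "contract Q u v" and ?O = "tverts Q - S"
  have finS: "finite S" using valid S(1) finite_subset by (auto simp: valid_def)
  have uQ: "u \<in> tverts Q" "v \<in> tverts Q" using uv S(1) by auto
  have tv: "tverts ?Q = ?O \<union> (S - {v})" using S(1) uv by (auto simp: contract_simps)
  have u: "(u, y) \<notin> red ?Q \<and> (y, u) \<notin> red ?Q \<and> ((u, y) \<in> black ?Q \<longleftrightarrow> (u, y) \<in> parcs H) \<and>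
      ((y, u) \<in> black ?Q \<longleftrightarrow> (y, u) \<in> parcs H)" if y: "y \<in> ?O" for y
  proof -
    have "(u, y) \<notin> red Q" "(v, y) \<notin> red Q" "(u, y) \<in> black Q \<longleftrightarrow> (u, y) \<in> parcs H"
      "(v, y) \<in> black Q \<longleftrightarrow> (u, y) \<in> parcs H"
      using pure uv y twins[OF y] by (auto simp: pure_def)
    moreover have "(u, y) \<in> parcs H \<longleftrightarrow> (y, u) \<in> parcs H" using H by (auto dest: symD)
    moreover have "y \<in> tverts Q - {u, v}" using y uv by auto
    ultimately show ?thesis by (simp add: contract_simps)
  qed
  have pure': "pure H ?Q (S - {v}) ?O"
    unfolding pure_def
  proof (intro ballI)
    fix x y
    assume x: "x \<in> S - {v}" and y: "y \<in> ?O"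
    show "(x, y) \<notin> red ?Q \<and> (y, x) \<notin> red ?Q \<and> ((x, y) \<in> black ?Q \<longleftrightarrow> (x, y) \<in> parcs H) \<and>
        ((y, x) \<in> black ?Q \<longleftrightarrow> (y, x) \<in> parcs H)"
    proof (cases "x = u")
      case True
      then show ?thesis using u[OF y] by simp
    next
      case False
      moreover have "y \<noteq> u" "y \<noteq> v" using y uv by auto
      ultimately show ?thesis using pure x y S(1) by (auto simp: contract_simps pure_def)
    qed
  qed
  have same: "same_edges Q ?Q ?O"
    unfolding same_edges_def
  proof (intro ballI)
    fix x y
    assume xy: "x \<in> ?O" "y \<in> ?O"
    then have "x \<noteq> u" "y \<noteq> u" "x \<noteq> v" "y \<noteq> v" using uv by auto
    then show "((x, y) \<in> black Q \<longleftrightarrow> (x, y) \<in> black ?Q) \<and> ((x, y) \<in> red Q \<longleftrightarrow> (x, y) \<in> red ?Q)"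
      using xy by (simp add: contract_simps)
  qed
  have red_wf: "red ?Q \<subseteq> tverts ?Q \<times> tverts ?Q"
  proof (rule subrelI)
    fix x y
    assume "(x, y) \<in> red ?Q"
    then show "(x, y) \<in> tverts ?Q \<times> tverts ?Q"
      using uQ uv by (cases "x = u"; cases "y = u") (auto simp: contract_simps)
  qed
  have "card {y. (x, y) \<in> red ?Q} \<le> d" if x: "x \<in> tverts ?Q" for x
  proof (cases "x \<in> S")
    case True
    have "{y. (x, y) \<in> red ?Q} \<subseteq> S - {v}"
      using pure' red_wf tv True x by (auto simp: pure_def contract_simps)
    then have "card {y. (x, y) \<in> red ?Q} \<le> card (S - {v})" using finS by (intro card_mono) auto
    also have "\<dots> \<le> d" using S(2) uv(2) finS by simp
    finally show ?thesis .
  next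
    case False
    then have x': "x \<in> ?O" using x by (auto simp: contract_simps)
    then have "x \<noteq> u" using uv by auto
    have "{y. (x, y) \<in> red ?Q} \<subseteq> {y. (x, y) \<in> red Q}"
    proof
      fix y
      assume "y \<in> {y. (x, y) \<in> red ?Q}"
      then show "y \<in> {y. (x, y) \<in> red Q}"
        using u[OF x'] \<open>x \<noteq> u\<close> by (cases "y = u") (auto simp: contract_simps)
    qed
    moreover have "finite {y. (x, y) \<in> red Q}"
      by (rule finite_subset[of _ "tverts Q"]) (use valid in \<open>auto simp: valid_def\<close>)
    ultimately have "card {y. (x, y) \<in> red ?Q} \<le> card {y. (x, y) \<in> red Q}" by (intro card_mono)
    also have "\<dots> \<le> d" using valid x' by (auto simp: valid_def red_degree_le_def)
    finally show ?thesis .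
  qed
  then have "valid d ?Q"
    using valid red_wf by (auto simp: valid_def red_degree_le_def contract_simps(1))
  moreover have "contractible d ?Q \<longrightarrow> contractible d Q"
    using contractible.step[OF uQ uv(3)] valid by (auto simp: valid_def)
  ultimately show ?thesis using pure' same tv by (simp add: reduces_def)
qed

text \<open>Contract two vertices of the same class until each class has one representative. What
  lies outside \<open>S\<close> in the trigraph also lies outside \<open>U\<close>, so vertices with
  equal \<open>nb H U\<close> are twins there.\<close>

lemma reduces_to_classes:
  assumes H: "sym (parcs H)"
    and "valid d Q" "S \<subseteq> tverts Q" "card S \<le> d" "pure H Q S (tverts Q - S)"
    and "S \<subseteq> U" "(tverts Q - S) \<inter> U = {}"
  shows "\<exists>R Q'. reduces d H Q S R Q' \<and> inj_on (nb H U) R"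
  using assms(2-)
proof (induction "card S" arbitrary: S Q rule: less_induct)
  case less
  have finS: "finite S" using less.prems(1,2) finite_subset by (auto simp: valid_def)
  show ?case
  proof (cases "inj_on (nb H U) S")
    case True
    moreover have "reduces d H Q S S Q"
      using less.prems by (auto simp: reduces_def same_edges_def)
    ultimately show ?thesis by blast
  next
    case False
    then obtain u v where uv: "u \<in> S" "v \<in> S" "u \<noteq> v" "nb H U u = nb H U v"
      by (auto simp: inj_on_def)
    let ?Q = "contract Q u v" and ?S = "S - {v}"
    have red: "reduces d H Q S ?S ?Q"
    proof (rule reduces_contract[OF H less.prems(1,2) _ less.prems(4) uv(1-3)])
      fix y
      assume "y \<in> tverts Q - S"
      then have "y \<notin> U" using less.prems(6) by blast
      then show "(u, y) \<in> parcs H \<longleftrightarrow> (v, y) \<in> parcs H" using uv(4) by (auto simp: nb_def)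
    qed (use less.prems(3) in simp)
    then have O: "tverts ?Q - ?S = tverts Q - S" using less.prems(2) uv by (auto simp: reduces_def)
    have "card ?S < card S" using finS uv(2) by (rule card_Diff1_less)
    moreover have "valid d ?Q" "?S \<subseteq> tverts ?Q" "card ?S \<le> d" "pure H ?Q ?S (tverts ?Q - ?S)"
      "?S \<subseteq> U" "(tverts ?Q - ?S) \<inter> U = {}"
      using red less.prems(3,5,6) \<open>card ?S < card S\<close> unfolding O by (auto simp: reduces_def)
    ultimately obtain R Q' where R: "reduces d H ?Q ?S R Q'" "inj_on (nb H U) R"
      using less.hyps by blast
    have "reduces d H Q S R Q'"
      using R(1) red unfolding reduces_def O by (auto intro: same_edges_trans)
    then show ?thesis using R(2) by blast
  qed
qed

text \<open>Each half is reduced to one vertex per class, at most \<open>k\<close> of them, so at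
  most \<open>2 * k\<close> vertices remain when the halves are combined; this is the red degree
  allowed. While one half is reduced, the other is part of the untouched outside.\<close>

lemma modtree_reduces:
  assumes H: "sym (parcs H)" and "modtree k H U"
    and "valid (2 * k) Q" "U \<subseteq> tverts Q" "pure H Q U (tverts Q)"
  shows "\<exists>R Q'. reduces (2 * k) H Q U R Q' \<and> inj_on (nb H U) R"
  using assms(2-)
proof (induction arbitrary: Q rule: modtree.induct)
  case (single v)
  have "reduces (2 * k) H Q {v} {v} Q"
    using single.prems by (auto simp: reduces_def same_edges_def intro: pure_mono)
  then show ?case by (intro exI[of _ "{v}"] exI[of _ Q]) auto
next
  case (split U\<^sub>1 U\<^sub>2)
  have few_card: "card R \<le> k" if "modtree k H U" "R \<subseteq> U" "inj_on (nb H U) R" for R U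
  proof -
    have "card R = card (nb H U ` R)" using that(3) by (simp add: card_image)
    also have "\<dots> \<le> card (nb H U ` U)" using that(2) modtree_wf(1)[OF that(1)] by (intro card_mono) auto
    finally show ?thesis using modtree_wf(3)[OF that(1)] by (simp add: few_def)
  qed
  have "pure H Q U\<^sub>1 (tverts Q)" using split.prems(3) by (rule pure_mono) auto
  then obtain R\<^sub>1 Q\<^sub>1 where 1: "reduces (2 * k) H Q U\<^sub>1 R\<^sub>1 Q\<^sub>1" "inj_on (nb H U\<^sub>1) R\<^sub>1"
    using split.IH(1)[of Q] split.prems by auto
  note red1 = 1(1)[unfolded reduces_def]
  have U2: "U\<^sub>2 \<subseteq> tverts Q - U\<^sub>1" using split.prems(2) split.hyps(3) by blast
  have "pure H Q\<^sub>1 U\<^sub>2 (tverts Q - U\<^sub>1)"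
  proof (rule pure_same_edges[where Z = "tverts Q - U\<^sub>1"])
    show "pure H Q U\<^sub>2 (tverts Q - U\<^sub>1)" using split.prems(3) by (rule pure_mono) auto
  qed (use red1 U2 in auto)
  moreover have "pure H Q\<^sub>1 U\<^sub>2 R\<^sub>1"
  proof -
    have "pure H Q\<^sub>1 R\<^sub>1 (tverts Q - U\<^sub>1)" using red1 by blast
    then have "pure H Q\<^sub>1 R\<^sub>1 U\<^sub>2" by (rule pure_mono) (use U2 in auto)
    then show ?thesis by (rule pure_swap)
  qed
  moreover have tv1: "tverts Q\<^sub>1 = tverts Q - U\<^sub>1 \<union> R\<^sub>1" using red1 by blast
  ultimately have "pure H Q\<^sub>1 U\<^sub>2 (tverts Q\<^sub>1)" by (auto simp: pure_def)
  then obtain R\<^sub>2 Q\<^sub>2 where 2: "reduces (2 * k) H Q\<^sub>1 U\<^sub>2 R\<^sub>2 Q\<^sub>2" "inj_on (nb H U\<^sub>2) R\<^sub>2"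
    using split.IH(2)[of Q\<^sub>1] red1 U2 tv1 by auto
  note red2 = 2(1)[unfolded reduces_def]
  let ?S = "R\<^sub>1 \<union> R\<^sub>2" and ?U = "U\<^sub>1 \<union> U\<^sub>2"
  have R12: "R\<^sub>1 \<subseteq> U\<^sub>1" "R\<^sub>2 \<subseteq> U\<^sub>2" using red1 red2 by blast+
  have tv2: "tverts Q\<^sub>2 = tverts Q - ?U \<union> ?S" using tv1 red2 R12 split.hyps(3) by auto
  then have O: "tverts Q\<^sub>2 - ?S = tverts Q - ?U" using R12 by auto
  have O1: "tverts Q - ?U \<subseteq> tverts Q - U\<^sub>1" "tverts Q - ?U \<subseteq> tverts Q\<^sub>1 - U\<^sub>2" using tv1 by auto
  have "\<exists>R Q'. reduces (2 * k) H Q\<^sub>2 ?S R Q' \<and> inj_on (nb H ?U) R"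
  proof (rule reduces_to_classes[OF H])
    have "card ?S \<le> card R\<^sub>1 + card R\<^sub>2" by (rule card_Un_le)
    then show "card ?S \<le> 2 * k"
      using few_card[OF split.hyps(1) R12(1) 1(2)] few_card[OF split.hyps(2) R12(2) 2(2)] by linarith
    have "pure H Q\<^sub>2 R\<^sub>1 (tverts Q - ?U)"
    proof (rule pure_same_edges[where Z = "tverts Q\<^sub>1 - U\<^sub>2"])
      show "pure H Q\<^sub>1 R\<^sub>1 (tverts Q - ?U)" using red1 O1(1) by (blast intro: pure_mono)
      show "R\<^sub>1 \<subseteq> tverts Q\<^sub>1 - U\<^sub>2" using tv1 R12 split.hyps(3) by auto
    qed (use red2 O1 in auto)
    moreover have "pure H Q\<^sub>2 R\<^sub>2 (tverts Q - ?U)" using red2 O1(2) by (blast intro: pure_mono)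
    ultimately show "pure H Q\<^sub>2 ?S (tverts Q\<^sub>2 - ?S)" unfolding O by (rule pure_Un)
  qed (use red2 tv2 R12 in auto)
  then obtain R Q' where R: "reduces (2 * k) H Q\<^sub>2 ?S R Q'" "inj_on (nb H ?U) R" by blast
  note R' = R(1)[unfolded reduces_def O]
  have "same_edges Q Q' (tverts Q - ?U)"
  proof (rule same_edges_trans)
    show "same_edges Q Q\<^sub>1 (tverts Q - ?U)" using red1 O1(1) by (blast intro: same_edges_mono)
    have "same_edges Q\<^sub>1 Q\<^sub>2 (tverts Q - ?U)" using red2 O1(2) by (blast intro: same_edges_mono)
    then show "same_edges Q\<^sub>1 Q' (tverts Q - ?U)" using R' by (blast intro: same_edges_trans)
  qed
  then have "reduces (2 * k) H Q ?U R Q'"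
    using R' red1 red2 R12 unfolding reduces_def by blast
  then show ?case using R(2) by blast
qed

lemma twin_width_le_modtree:
  assumes H: "pair_graph H" and "modtree k H (pverts H)"
  shows "twin_width H \<le> 2 * k"
proof -
  let ?Q = "\<lparr>tverts = pverts H, black = parcs H, red = {}\<rparr>"
  note wf = pair_graph_wf[OF H]
  have "valid (2 * k) ?Q" using wf(1) by (simp add: valid_def red_degree_le_def)
  moreover have "pure H ?Q (pverts H) (tverts ?Q)" by (simp add: pure_def)
  ultimately obtain R Q' where R: "reduces (2 * k) H ?Q (pverts H) R Q'" "inj_on (nb H (pverts H)) R"
    using modtree_reduces[OF wf(3) assms(2), of ?Q] by auto
  \<comment> \<open>Nothing lies outside the full vertex set, so there is a single class and at most
    one vertex is left.\<close>
  have "nb H (pverts H) u = nb H (pverts H) v" for u v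
    using wf(4) by (auto simp: nb_def)
  then have "u = v" if "u \<in> R" "v \<in> R" for u v using inj_onD[OF R(2) _ that] by blast
  moreover have "finite R" using R(1) wf(1) by (auto simp: reduces_def intro: finite_subset)
  ultimately have "card R \<le> Suc 0" by (subst card_le_Suc0_iff_eq) auto
  moreover have "tverts Q' = R" "valid (2 * k) Q'" using R(1) by (auto simp: reduces_def)
  ultimately have "contractible (2 * k) Q'" by (intro contractible.finish) (auto simp: valid_def)
  then have "contractible (2 * k) ?Q" using R(1) by (simp add: reduces_def)
  then show ?thesis unfolding twin_width_def by (intro wellorder_Inf_le1) simp
qed

lemma twin_width_empty:
  assumes "pverts H = {}"
  shows "twin_width H = 0"
proof -
  have "contractible 0 \<lparr>tverts = pverts H, black = parcs H, red = {}\<rparr>"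
    using assms by (intro contractible.finish) (auto simp: red_degree_le_def)
  then have "twin_width H \<le> 0" unfolding twin_width_def by (intro wellorder_Inf_le1) simp
  then show ?thesis by simp
qed

subsection \<open>Comparing the parameters on line graphs\<close>

text \<open>
  The infimum of the empty set of natural numbers is unspecified in the library.  The clique-width
  of the graph without vertices therefore enters all bounds as an unknown constant.
\<close>

lemma clique_width_empty:
  assumes "pverts H = {}"
  shows "clique_width H = Inf {}"
proof -
  have "\<not> cw_constructible k H l" for k l
    using cw_constructible_imp_modtree[of k H l] modtree_wf(2)[of k H "pverts H"] assms by blast
  then show ?thesis by (simp add: clique_width_def)
qed

lemma clique_width_line_graph_le:
  assumes G: "pair_graph G"
  shows "clique_width (line_graph G) \<le> 3 * 2 ^ Suc (treewidth G) + Inf {}"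
proof (cases "uedges G = {}")
  case True
  then show ?thesis by (simp add: clique_width_empty)
next
  case False
  then have "modtree (2 ^ Suc (treewidth G)) (line_graph G) (pverts (line_graph G))"
    using modtree_line_graph[OF G] by simp
  then have "\<exists>l. cw_constructible (3 * 2 ^ Suc (treewidth G)) (line_graph G) l"
    by (rule clique_width_le_modtree[OF pair_graph_line_graph[OF G]])
  then have "clique_width (line_graph G) \<le> 3 * 2 ^ Suc (treewidth G)"
    unfolding clique_width_def by (intro wellorder_Inf_le1) simp
  then show ?thesis by linarith
qed

text \<open>The treewidth bound supplies some expression, so the infimum is attained; an optimal
  expression then becomes a module tree.\<close>

lemma modtree_clique_width:
  assumes G: "pair_graph G" and "uedges G \<noteq> {}"
  shows "modtree (clique_width (line_graph G)) (line_graph G) (uedges G)"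
proof -
  let ?S = "{k. \<exists>l. cw_constructible k (line_graph G) l}"
  have "modtree (2 ^ Suc (treewidth G)) (line_graph G) (pverts (line_graph G))"
    using modtree_line_graph[OF assms] by simp
  then have "?S \<noteq> {}" using clique_width_le_modtree[OF pair_graph_line_graph[OF G]] by blast
  then have "clique_width (line_graph G) \<in> ?S" unfolding clique_width_def by (rule Inf_nat_def1)
  then show ?thesis using cw_constructible_imp_modtree[of _ "line_graph G"] by auto
qed

lemma mim_width_line_graph_le:
  assumes G: "pair_graph G"
  shows "mim_width (line_graph G) \<le> clique_width (line_graph G)"
proof (cases "uedges G = {}")
  case True
  then show ?thesis by (simp add: mim_width_def cut_width_def)
next
  case False
  then show ?thesis
    using modtree_clique_width[OF G]
    by (intro mim_width_le_modtree[OF pair_graph_line_graph[OF G]]) simp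
qed

lemma twin_width_line_graph_le:
  assumes G: "pair_graph G"
  shows "twin_width (line_graph G) \<le> 2 * clique_width (line_graph G)"
proof (cases "uedges G = {}")
  case True
  then show ?thesis by (simp add: twin_width_empty)
next
  case False
  then show ?thesis
    using modtree_clique_width[OF G]
    by (intro twin_width_le_modtree[OF pair_graph_line_graph[OF G]]) simp
qed

lemma line_graph_branch_decomposition:
  assumes G: "pair_graph G" and "1 < card (uedges G)"
  shows "\<exists>T \<delta>. branch_decomposition (line_graph G) T \<delta>"
proof -
  have "uedges G \<noteq> {}" using assms(2) by auto
  then show ?thesis
    using modtree_imp_branch_decomposition[OF pair_graph_line_graph[OF G]]
      modtree_line_graph[OF G] assms(2) by (metis line_graph_simps(1))
qed

text \<open>The chain sim-width, mim-width, clique-width is bounded at both ends by functions of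
  \<open>treewidth G\<close>; the linear bounds for tree-independence number are weakened to the
  same two functions.\<close>

lemma line_graph_parameters:
  fixes p :: "'a set pair_pre_digraph \<Rightarrow> nat"
  assumes G: "pair_graph G"
    and p: "p \<in> {sim_width, mim_width, clique_width, tree_independence_number}"
  shows "p (line_graph G) \<le> 3 * 2 ^ Suc (treewidth G) + Inf {}" "treewidth G \<le> 27 * p (line_graph G) + 7"
proof -
  let ?L = "line_graph G"
  obtain T \<delta> where bd: "1 < card (uedges G) \<Longrightarrow> branch_decomposition ?L T \<delta>"
    using line_graph_branch_decomposition[OF G] by blast
  have "sim_width ?L \<le> mim_width ?L"
    using bd by (intro sim_width_le_mim_width[OF pair_graph_line_graph[OF G]]) simp
  moreover note mim_width_line_graph_le[OF G] clique_width_line_graph_le[OF G]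
    treewidth_le_sim_width[OF G bd] treewidth_le_tree_independence_number[OF G]
    tree_independence_number_line_graph_le[OF G]
  moreover have "Suc (treewidth G) \<le> 3 * 2 ^ Suc (treewidth G)"
    using less_exp[of "Suc (treewidth G)"] by linarith
  ultimately show "p ?L \<le> 3 * 2 ^ Suc (treewidth G) + Inf {}" "treewidth G \<le> 27 * p ?L + 7"
    using p by auto
qed

lemma bounded_on_line_graph_iff:
  fixes p :: "'a set pair_pre_digraph \<Rightarrow> nat"
  assumes "\<forall>G\<in>\<G>. pair_graph G"
    and p: "p \<in> {sim_width, mim_width, clique_width, tree_independence_number}"
  shows "bounded_on treewidth \<G> \<longleftrightarrow> bounded_on p (line_graph ` \<G>)"
proof
  assume "bounded_on treewidth \<G>"
  then obtain c where c: "\<And>G. G \<in> \<G> \<Longrightarrow> treewidth G \<le> c" by (auto simp: bounded_on_def)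
  have "p (line_graph G) \<le> 3 * 2 ^ Suc c + Inf {}" if "G \<in> \<G>" for G
  proof -
    have "p (line_graph G) \<le> 3 * 2 ^ Suc (treewidth G) + Inf {}"
      using line_graph_parameters(1)[OF _ p] assms(1) that by blast
    also have "\<dots> \<le> 3 * 2 ^ Suc c + Inf {}"
      using c[OF that] by (intro add_right_mono mult_le_mono2 power_increasing) auto
    finally show ?thesis .
  qed
  then show "bounded_on p (line_graph ` \<G>)" by (auto simp: bounded_on_def)
next
  assume "bounded_on p (line_graph ` \<G>)"
  then obtain c where c: "\<And>G. G \<in> \<G> \<Longrightarrow> p (line_graph G) \<le> c" by (auto simp: bounded_on_def)
  have "treewidth G \<le> 27 * c + 7" if "G \<in> \<G>" for G
    using line_graph_parameters(2)[OF _ p, of G] assms(1) that c[OF that] by fastforce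
  then show "bounded_on treewidth \<G>" by (auto simp: bounded_on_def)
qed

lemma line_graphs_parameter_le:
  fixes p q :: "'a set pair_pre_digraph \<Rightarrow> nat"
  assumes p: "p \<in> {sim_width, mim_width, clique_width, tree_independence_number}"
    and q: "q \<in> {sim_width, mim_width, clique_width, tree_independence_number}"
    and "L \<in> line_graphs"
  shows "p L \<le> 3 * 2 ^ Suc (27 * q L + 7) + Inf {}"
proof -
  obtain G where G: "pair_graph G" "L = line_graph G" using assms(3) by (auto simp: line_graphs_def)
  have "p L \<le> 3 * 2 ^ Suc (treewidth G) + Inf {}"
    using line_graph_parameters(1)[OF G(1) p] G(2) by simp
  also have "\<dots> \<le> 3 * 2 ^ Suc (27 * q L + 7) + Inf {}"
    using line_graph_parameters(2)[OF G(1) q] G(2)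
    by (intro add_right_mono mult_le_mono2 power_increasing) auto
  finally show ?thesis .
qed

lemma dominates_on_line_graphs:
  fixes p q :: "'a set pair_pre_digraph \<Rightarrow> nat"
  assumes "p \<in> {sim_width, mim_width, clique_width, tree_independence_number}"
    and "q \<in> {sim_width, mim_width, clique_width, tree_independence_number}"
  shows "dominates_on p q line_graphs"
  unfolding dominates_on_def
  by (intro exI[of _ "\<lambda>x. 3 * 2 ^ Suc (27 * x + 7) + Inf {}"] ballI line_graphs_parameter_le assms)

lemma dominates_on_trans:
  assumes "\<And>G. G \<in> C \<Longrightarrow> p G \<le> h (q G)" "mono h" "dominates_on q r C"
  shows "dominates_on p r C"
proof -
  obtain f where f: "\<And>G. G \<in> C \<Longrightarrow> q G \<le> f (r G)" using assms(3) by (auto simp: dominates_on_def)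
  have "p G \<le> h (f (r G))" if "G \<in> C" for G
    using assms(1)[OF that] monoD[OF assms(2) f[OF that]] by linarith
  then show ?thesis unfolding dominates_on_def by (intro exI[of _ "h \<circ> f"]) auto
qed

theorem theorem1p3:
  fixes \<G> :: "'a pair_pre_digraph set"
  assumes "\<forall>G\<in>\<G>. pair_graph G"
  shows
    "(bounded_on treewidth \<G> \<longleftrightarrow> bounded_on clique_width (line_graph ` \<G>)) \<and>
     (bounded_on treewidth \<G> \<longleftrightarrow> bounded_on mim_width (line_graph ` \<G>)) \<and>
     (bounded_on treewidth \<G> \<longleftrightarrow> bounded_on sim_width (line_graph ` \<G>)) \<and>
     (bounded_on treewidth \<G> \<longleftrightarrow> bounded_on tree_independence_number (line_graph ` \<G>)) \<and>
     (\<forall>p \<in> {sim_width, mim_width, clique_width, tree_independence_number}.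
        (\<forall>q \<in> {sim_width, mim_width, clique_width, tree_independence_number}.
           equivalent_on p q (line_graphs :: 'a set pair_pre_digraph set)) \<and>
        dominates_on twin_width p (line_graphs :: 'a set pair_pre_digraph set) \<and>
        dominates_on p treewidth (line_graphs :: 'a set pair_pre_digraph set))"
proof -
  have "dominates_on twin_width p (line_graphs :: 'a set pair_pre_digraph set)"
    if "p \<in> {sim_width, mim_width, clique_width, tree_independence_number}" for p
  \<comment> \<open>The contraction sequence is built from the module tree of an optimal
    clique-width expression; the other parameters enter through clique-width.\<close>
  proof (rule dominates_on_trans[where q = clique_width and h = "\<lambda>x. 2 * x"])
    show "dominates_on clique_width p line_graphs"
      by (rule dominates_on_line_graphs[OF _ that]) simp
    show "twin_width L \<le> 2 * clique_width L" if "L \<in> line_graphs" for L :: "'a set pair_pre_digraph"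
      using that twin_width_line_graph_le by (auto simp: line_graphs_def)
  qed (simp add: mono_def)
  moreover have "dominates_on p treewidth (line_graphs :: 'a set pair_pre_digraph set)"
    if p: "p \<in> {sim_width, mim_width, clique_width, tree_independence_number}" for p
  proof -
    have tin: "tree_independence_number \<in> {sim_width, mim_width, clique_width, tree_independence_number}"
      by simp
    show ?thesis
    \<comment> \<open>The treewidth here is that of the line graph itself. It bounds the
      tree-independence number of every graph up to one, and the other parameters follow from
      that.\<close>
    proof (rule dominates_on_trans[where q = tree_independence_number
          and h = "\<lambda>x. 3 * 2 ^ Suc (27 * x + 7) + Inf {}"])
      show "p L \<le> 3 * 2 ^ Suc (27 * tree_independence_number L + 7) + Inf {}"
        if "L \<in> line_graphs" for L :: "'a set pair_pre_digraph"
        by (rule line_graphs_parameter_le[OF p tin that])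
      show "dominates_on tree_independence_number treewidth
          (line_graphs :: 'a set pair_pre_digraph set)"
        unfolding dominates_on_def line_graphs_def
        using tree_independence_number_le_treewidth[OF pair_graph_line_graph]
        by (intro exI[of _ Suc]) auto
      show "mono (\<lambda>x :: nat. 3 * 2 ^ Suc (27 * x + 7) + Inf {} :: nat)"
        by (intro monoI add_right_mono mult_le_mono2 power_increasing) auto
    qed
  qed
  moreover have "equivalent_on p q (line_graphs :: 'a set pair_pre_digraph set)"
    if "p \<in> {sim_width, mim_width, clique_width, tree_independence_number}"
      "q \<in> {sim_width, mim_width, clique_width, tree_independence_number}" for p q
    unfolding equivalent_on_def using dominates_on_line_graphs that by blast
  moreover note bounded_on_line_graph_iff[OF assms, of clique_width]
    bounded_on_line_graph_iff[OF assms, of mim_width]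
    bounded_on_line_graph_iff[OF assms, of sim_width]
    bounded_on_line_graph_iff[OF assms, of tree_independence_number]
  ultimately show ?thesis by (intro conjI ballI) simp_all
qed

end
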